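(* Let $L$ be a computable linear order whose condensation-type is $\eta$ and which has no infinite, strongly $\eta$-like interval. Then there is a computable linear order $M$, isomorphic to $L$ (as a linear order), whose non-block relation $\neg B_M(x,y)$ is computably enumerable.
   Context: A computable linear order $L$ is a linear order with universe $\mathbb{N}$ whose order relation $<_L$ is computable. A computable copy of $L$ is a computable linear order isomorphic to $L$ (the isomorphism need not be computable). $\eta$ denotes the order-type of the rationals $(\mathbb{Q},<)$. The block relation $B_L(x,y)$ of a linear order $L$ holds of elements $x,y$ exactly when the closed $L$-interval between $x$ and $y$ is finite; it is an equivalence relation whose equivalence classes are called the blocks of $L$. The non-block relation is its complement $\neg B_L(x,y)$, i.e. the set of pairs $(x,y)$ not in the same block. The condensation-type of $L$ is the order-type of the linear order obtained by factoring $L$ by $B_L$ (collapsing each block to a single point). An interval of $L$ is a convex subset of $L$, with the induced order. An interval is strongly $\eta$-like if it has condensation-type $\eta$ and there is a fixed finite $k$ such that all of its blocks have size less than $k$. *)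

theory Defs
  imports Complex_Main
begin

section \<open>Partial recursive functions\<close>

text \<open>
  Codes for the partial recursive functions. Codes carry no arity: a code denotes one partial
  function on the argument lists of each length, undefined at lengths that do not fit. Every
  partial function obtained in this way is partial recursive in the usual sense, and conversely.
\<close>

datatype recf =
    Zero
  | Succ
  | Proj nat
  | Comp recf "recf list"
  | Prec recf recf
  | Mu recf

text \<open>
  \<open>eval f xs y\<close>: the function with code \<open>f\<close> converges on \<open>xs\<close> with value \<open>y\<close>. The recursion argument
  of \<open>Prec\<close> and the searched argument of \<open>Mu\<close> come first; the step function of \<open>Prec\<close> receives the
  previous value, then the counter, then the parameters. In rule \<open>mu\<close>, the values at all smaller
  arguments have to be defined and nonzero.
\<close>

inductive eval :: "recf \<Rightarrow> nat list \<Rightarrow> nat \<Rightarrow> bool" where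
  zero: "eval Zero xs 0"
| succ: "eval Succ [x] (Suc x)"
| proj: "i < length xs \<Longrightarrow> eval (Proj i) xs (xs ! i)"
| comp: "list_all2 (\<lambda>g y. eval g xs y) gs ys \<Longrightarrow> eval f ys z \<Longrightarrow> eval (Comp f gs) xs z"
| prec_0: "eval f xs y \<Longrightarrow> eval (Prec f g) (0 # xs) y"
| prec_Suc: "eval (Prec f g) (n # xs) y \<Longrightarrow> eval g (y # n # xs) z \<Longrightarrow> eval (Prec f g) (Suc n # xs) z"
| mu: "eval f (n # xs) 0 \<Longrightarrow> (\<forall>m<n. \<exists>y. eval f (m # xs) (Suc y)) \<Longrightarrow> eval (Mu f) xs n"

inductive_cases eval_ZeroE: "eval Zero xs y"
inductive_cases eval_SuccE: "eval Succ xs y"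
inductive_cases eval_ProjE: "eval (Proj i) xs y"
inductive_cases eval_CompE: "eval (Comp f gs) xs y"
inductive_cases eval_Prec_0E: "eval (Prec f g) (0 # xs) y"
inductive_cases eval_Prec_SucE: "eval (Prec f g) (Suc n # xs) y"
inductive_cases eval_MuE: "eval (Mu f) xs y"

lemma eval_deterministic: "eval f xs y \<Longrightarrow> eval f xs z \<Longrightarrow> y = z"
proof (induction arbitrary: z rule: eval.induct)
  case (zero xs)
  then show ?case by (rule eval_ZeroE) simp
next
  case (succ x)
  then show ?case by (rule eval_SuccE) simp_all
next
  case (proj i xs)
  from proj.prems show ?case by (rule eval_ProjE) simp
next
  case (comp xs gs ys f z z')
  obtain ys' where ys': "list_all2 (\<lambda>g y. eval g xs y) gs ys'" "eval f ys' z'"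
    using \<open>eval (Comp f gs) xs z'\<close> by (rule eval_CompE)
  have "ys = ys'"
  proof (rule nth_equalityI)
    show len: "length ys = length ys'"
      using comp.IH(1)[THEN list_all2_lengthD] ys'(1)[THEN list_all2_lengthD] by simp
    show "ys ! i = ys' ! i" if "i < length ys" for i
      using list_all2_nthD2[OF comp.IH(1) that] list_all2_nthD2[OF ys'(1)] that len by auto
  qed
  with comp.IH(2) ys'(2) show ?case by simp
next
  case (prec_0 f xs y g)
  from prec_0.prems have "eval f xs z" by (rule eval_Prec_0E)
  then show ?case by (rule prec_0.IH)
next
  case (prec_Suc f g n xs y z z')
  from prec_Suc.prems obtain y' where y': "eval (Prec f g) (n # xs) y'" "eval g (y' # n # xs) z'"
    by (rule eval_Prec_SucE)
  from y'(1) have "y = y'" by (rule prec_Suc.IH(1))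
  with y'(2) show ?case by (simp add: prec_Suc.IH(2))
next
  case (mu f n xs)
  from mu.prems obtain "eval f (z # xs) 0" "\<forall>m<z. \<exists>y. eval f (m # xs) (Suc y)"
    by (rule eval_MuE)
  note z = this
  show ?case
  proof (cases n z rule: linorder_cases)
    case less
    then obtain y where "eval f (n # xs) (Suc y)" using z(2) by blast
    then have "0 = Suc y" by (rule mu.IH(1))
    then show ?thesis by simp
  next
    case greater
    then obtain y where "\<And>v. eval f (z # xs) v \<Longrightarrow> Suc y = v" using mu.IH(2) by blast
    with z(1) have "Suc y = 0" by blast
    then show ?thesis by simp
  qed
qed

definition computable_rel :: "nat rel \<Rightarrow> bool" where
  "computable_rel R \<longleftrightarrow> (\<exists>f. \<forall>x y. eval f [x, y] (if (x, y) \<in> R then 1 else 0))"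

definition ce_rel :: "nat rel \<Rightarrow> bool" where
  "ce_rel R \<longleftrightarrow> (\<exists>f. \<forall>x y. (x, y) \<in> R \<longleftrightarrow> (\<exists>z. eval f [x, y] z))"

section \<open>Linear orders and blocks\<close>

text \<open>
  Orders are strict relations \<open>r\<close> together with an explicit carrier \<open>A\<close>. All notions below look at
  \<open>r\<close> on \<open>A\<close> only, so a subset \<open>I\<close> of \<open>A\<close> with the induced order is given by \<open>I\<close> and the same \<open>r\<close>.
\<close>

definition computable_linear_order :: "nat rel \<Rightarrow> bool" where
  "computable_linear_order L \<longleftrightarrow> strict_linear_order_on UNIV L \<and> computable_rel L"

definition order_isomorphic :: "'a set \<Rightarrow> 'a rel \<Rightarrow> 'b set \<Rightarrow> 'b rel \<Rightarrow> bool" where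
  "order_isomorphic A r B s \<longleftrightarrow>
     (\<exists>f. bij_betw f A B \<and> (\<forall>x\<in>A. \<forall>y\<in>A. (x, y) \<in> r \<longleftrightarrow> (f x, f y) \<in> s))"

text \<open>The closed interval between \<open>x\<close> and \<open>y\<close>, in whichever order they come.\<close>

definition closed_interval :: "'a set \<Rightarrow> 'a rel \<Rightarrow> 'a \<Rightarrow> 'a \<Rightarrow> 'a set" where
  "closed_interval A r x y =
     {z \<in> A. ((x, z) \<in> r\<^sup>= \<and> (z, y) \<in> r\<^sup>=) \<or> ((y, z) \<in> r\<^sup>= \<and> (z, x) \<in> r\<^sup>=)}"

definition block_rel :: "'a set \<Rightarrow> 'a rel \<Rightarrow> 'a rel" where
  "block_rel A r = {(x, y). x \<in> A \<and> y \<in> A \<and> finite (closed_interval A r x y)}"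

lemma equiv_block_rel:
  assumes "strict_linear_order_on A r"
  shows "equiv A (block_rel A r)"
proof (rule equivI)
  have r: "trans r" "irrefl r" "total_on A r"
    using assms by (auto simp: strict_linear_order_on_def)
  show "block_rel A r \<subseteq> A \<times> A"
    by (auto simp: block_rel_def)
  have "closed_interval A r x x \<subseteq> {x}" for x
    using r(1,2) unfolding closed_interval_def irrefl_def trans_def by blast
  then show "refl_on A (block_rel A r)"
    by (auto simp: refl_on_def block_rel_def intro: finite_subset)
  have "closed_interval A r x y = closed_interval A r y x" for x y
    by (auto simp: closed_interval_def)
  then show "sym (block_rel A r)"
    by (simp add: sym_def block_rel_def)
  show "trans (block_rel A r)"
  proof (rule transI)
    fix x y z assume xyz: "(x, y) \<in> block_rel A r" "(y, z) \<in> block_rel A r"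
    have "closed_interval A r x z \<subseteq> closed_interval A r x y \<union> closed_interval A r y z"
    proof
      fix w assume w: "w \<in> closed_interval A r x z"
      have "w = y \<or> (w, y) \<in> r \<or> (y, w) \<in> r"
        using w xyz r(3) by (auto simp: total_on_def closed_interval_def block_rel_def)
      then show "w \<in> closed_interval A r x y \<union> closed_interval A r y z"
        using w by (auto simp: closed_interval_def)
    qed
    with xyz show "(x, z) \<in> block_rel A r"
      by (auto simp: block_rel_def intro: finite_subset)
  qed
qed

definition blocks :: "'a set \<Rightarrow> 'a rel \<Rightarrow> 'a set set" where
  "blocks A r = A // block_rel A r"

definition condensation_rel :: "'a set \<Rightarrow> 'a rel \<Rightarrow> 'a set rel" where
  "condensation_rel A r =
     {(X, Y). X \<in> blocks A r \<and> Y \<in> blocks A r \<and> X \<noteq> Y \<and> (\<exists>x\<in>X. \<exists>y\<in>Y. (x, y) \<in> r)}"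

definition condensation_type_eta :: "'a set \<Rightarrow> 'a rel \<Rightarrow> bool" where
  "condensation_type_eta A r \<longleftrightarrow>
     order_isomorphic (blocks A r) (condensation_rel A r) (UNIV :: rat set) {(p, q). p < q}"

definition order_interval :: "'a set \<Rightarrow> 'a rel \<Rightarrow> 'a set \<Rightarrow> bool" where
  "order_interval A r I \<longleftrightarrow>
     I \<subseteq> A \<and> (\<forall>x\<in>I. \<forall>z\<in>I. \<forall>y\<in>A. (x, y) \<in> r \<and> (y, z) \<in> r \<longrightarrow> y \<in> I)"

definition strongly_eta_like :: "'a set \<Rightarrow> 'a rel \<Rightarrow> bool" where
  "strongly_eta_like A r \<longleftrightarrow>
     condensation_type_eta A r \<and> (\<exists>k. \<forall>B\<in>blocks A r. finite B \<and> card B < k)"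

end

theory Submission
  imports Defs "HOL-Library.Nat_Bijection" "HOL-Library.Sublist"
begin

text \<open>
  The copy is built in two finite-injury constructions. The first one runs relative to the halting
  problem, i.e. with limit computable functions: successors of \<open>L\<close> are then decidable and the block
  relation is enumerable. It builds an isomorphism \<open>\<phi>\<close> from the rationals onto the blocks of \<open>L\<close>
  together with a list of all pairs \<open>(q, k)\<close> such that the base point \<open>\<phi> q\<close> has a \<open>k\<close>-th successor
  (predecessor, for negative \<open>k\<close>). Pairs that are already listed are never taken back, so when a false
  guess about blocks is discovered, \<open>q\<close> has to be moved to a block that is at least as large; there is
  one between any two blocks because no interval is strongly \<open>\<eta>\<close>-like. The bounds between which
  that block is sought are guessed before its size is looked at. Otherwise every wrong
  guess could enlarge what is to be placed next, and so force a new guess.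

  The second construction is computable and follows approximations to that list. Its points are rationals,
  and it separates two of them by putting a cut between them. Points whose label turns out to be
  false are cut off and become blocks of their own, to be completed by later points. Two points lie in
  different blocks exactly if some cut is put between them, which is an enumerable condition.
\<close>

section \<open>Classes of recursive functions\<close>

text \<open>In a computable order, being immediate successors is co-c.e. and sharing a block is
  Sigma_2, so a guess that an element starts a new block need not settle. Relative to the halting
  problem such a guess concerns a co-c.e. condition and changes only finitely often. The list
  obtained in this way is a limit of computable functions, and reading it costs a second round of
  finitely many changes per entry. What would be one infinite-injury argument is thus split into two
  finite-injury ones, and one abstract stack argument serves both.

  The list is the whole interface: every \<open>(q, 0)\<close> occurs in it, and any other label
  comes after its neighbour on the side of \<open>0\<close>. The second construction knows nothing
  else about \<open>L\<close>. Withdrawing labels would turn the list into a limit of limits, whose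
  entries could no longer be followed by finitely many changes.\<close>

abbreviation \<pi>\<^sub>1 :: "nat \<Rightarrow> nat" where "\<pi>\<^sub>1 p \<equiv> fst (prod_decode p)"
abbreviation \<pi>\<^sub>2 :: "nat \<Rightarrow> nat" where "\<pi>\<^sub>2 p \<equiv> snd (prod_decode p)"

text \<open>
  Functions of several arguments are functions of one coded argument. Besides the computable
  functions, the limit computable functions form such a class, which is what allows the same
  construction to be run relative to the halting problem.
\<close>

locale rec_class =
  fixes C :: "(nat \<Rightarrow> nat) set"
  assumes C_id: "(\<lambda>x. x) \<in> C"
    and C_zero: "(\<lambda>x. 0) \<in> C"
    and C_Suc: "Suc \<in> C"
    and C_comp: "f \<in> C \<Longrightarrow> g \<in> C \<Longrightarrow> (\<lambda>x. f (g x)) \<in> C"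
    and C_pair: "f \<in> C \<Longrightarrow> g \<in> C \<Longrightarrow> (\<lambda>x. prod_encode (f x, g x)) \<in> C"
    and C_fst: "\<pi>\<^sub>1 \<in> C"
    and C_snd: "\<pi>\<^sub>2 \<in> C"
    and C_rec: "f \<in> C \<Longrightarrow> g \<in> C \<Longrightarrow>
      (\<lambda>p. rec_nat (f (\<pi>\<^sub>1 p)) (\<lambda>i y. g (prod_encode (\<pi>\<^sub>1 p, prod_encode (i, y)))) (\<pi>\<^sub>2 p)) \<in> C"
    and C_mu: "f \<in> C \<Longrightarrow> (\<And>x. \<exists>n. f (prod_encode (x, n)) = 0) \<Longrightarrow>
      (\<lambda>x. LEAST n. f (prod_encode (x, n)) = 0) \<in> C"

section \<open>Recursive functions of fixed arity, and the pairing function\<close>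

definition rec_fun :: "nat \<Rightarrow> (nat list \<Rightarrow> nat) \<Rightarrow> bool" where
  "rec_fun n f \<longleftrightarrow> (\<exists>r. \<forall>xs. length xs = n \<longrightarrow> eval r xs (f xs))"

lemma rec_fun_cong: "rec_fun n f \<Longrightarrow> (\<And>xs. length xs = n \<Longrightarrow> f xs = g xs) \<Longrightarrow> rec_fun n g"
  by (auto simp: rec_fun_def)

lemma rec_fun_nth: "i < n \<Longrightarrow> rec_fun n (\<lambda>xs. xs ! i)"
  unfolding rec_fun_def by (rule exI[of _ "Proj i"]) (auto intro: eval.proj)

lemma rec_fun_Comp:
  assumes "rec_fun (length gs) f" and "\<forall>g\<in>set gs. rec_fun n g"
  shows "rec_fun n (\<lambda>xs. f (map (\<lambda>g. g xs) gs))"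
proof -
  obtain r where r: "\<And>ys. length ys = length gs \<Longrightarrow> eval r ys (f ys)"
    using assms(1) by (auto simp: rec_fun_def)
  obtain c where c: "\<And>g xs. g \<in> set gs \<Longrightarrow> length xs = n \<Longrightarrow> eval (c g) xs (g xs)"
    using assms(2) unfolding rec_fun_def by metis
  have "eval (Comp r (map c gs)) xs (f (map (\<lambda>g. g xs) gs))" if "length xs = n" for xs
    by (rule eval.comp[OF _ r]) (auto simp: list_all2_conv_all_nth c that)
  then show ?thesis unfolding rec_fun_def by blast
qed

lemma rec_fun_0: "rec_fun n (\<lambda>_. 0)"
  unfolding rec_fun_def by (rule exI[of _ Zero]) (auto intro: eval.zero)

lemma rec_fun_comp1:
  assumes "rec_fun 1 (\<lambda>xs. f (xs ! 0))" "rec_fun n g"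
  shows "rec_fun n (\<lambda>xs. f (g xs))"
  using rec_fun_Comp[of "[g]" "\<lambda>xs. f (xs ! 0)" n] assms by simp

lemma rec_fun_comp2:
  assumes "rec_fun 2 (\<lambda>xs. f (xs ! 0) (xs ! 1))" "rec_fun n g" "rec_fun n h"
  shows "rec_fun n (\<lambda>xs. f (g xs) (h xs))"
  using rec_fun_Comp[of "[g, h]" "\<lambda>xs. f (xs ! 0) (xs ! 1)" n] assms by (simp add: numeral_2_eq_2)

lemma rec_fun_Suc1: "rec_fun 1 (\<lambda>xs. Suc (xs ! 0))"
  unfolding rec_fun_def by (rule exI[of _ Succ]) (auto simp: length_Suc_conv intro: eval.succ)

lemmas rec_fun_Suc = rec_fun_comp1[OF rec_fun_Suc1]

lemma rec_fun_Prec: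
  assumes f: "rec_fun n f" and g: "rec_fun (Suc (Suc n)) g"
  shows "rec_fun (Suc n) (\<lambda>xs. rec_nat (f (tl xs)) (\<lambda>i y. g (y # i # tl xs)) (hd xs))"
proof -
  obtain r where r: "\<And>xs. length xs = n \<Longrightarrow> eval r xs (f xs)"
    using f by (auto simp: rec_fun_def)
  obtain r' where r': "\<And>xs. length xs = Suc (Suc n) \<Longrightarrow> eval r' xs (g xs)"
    using g by (auto simp: rec_fun_def)
  have "eval (Prec r r') (m # xs) (rec_nat (f xs) (\<lambda>i y. g (y # i # xs)) m)" if "length xs = n" for m xs
  proof (induction m)
    case 0
    show ?case using eval.prec_0[OF r[OF that]] by simp
  next
    case (Suc m)
    show ?case using eval.prec_Suc[OF Suc r'] that by simp
  qed
  then show ?thesis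
    unfolding rec_fun_def by (intro exI[of _ "Prec r r'"]) (auto simp: length_Suc_conv)
qed

lemma rec_fun_Mu:
  assumes f: "rec_fun (Suc n) f" and ex: "\<And>xs. length xs = n \<Longrightarrow> \<exists>m. f (m # xs) = 0"
  shows "rec_fun n (\<lambda>xs. LEAST m. f (m # xs) = 0)"
proof -
  obtain r where r: "\<And>xs. length xs = Suc n \<Longrightarrow> eval r xs (f xs)"
    using f by (auto simp: rec_fun_def)
  have "eval (Mu r) xs (LEAST m. f (m # xs) = 0)" if l: "length xs = n" for xs
  proof (rule eval.mu)
    show "eval r ((LEAST m. f (m # xs) = 0) # xs) 0"
      using r[of "(LEAST m. f (m # xs) = 0) # xs"] LeastI_ex[OF ex[OF l]] l by simp
    show "\<forall>m<LEAST m. f (m # xs) = 0. \<exists>y. eval r (m # xs) (Suc y)"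
    proof (intro allI impI)
      fix m assume "m < (LEAST m. f (m # xs) = 0)"
      then have "f (m # xs) \<noteq> 0" by (rule not_less_Least)
      then show "\<exists>y. eval r (m # xs) (Suc y)"
        using r[of "m # xs"] l by (auto simp: gr0_conv_Suc)
    qed
  qed
  then show ?thesis unfolding rec_fun_def by blast
qed

lemma rec_fun_prec2:
  assumes "rec_fun 1 (\<lambda>xs. f (xs ! 0))" "rec_fun 3 (\<lambda>xs. g (xs ! 2) (xs ! 1) (xs ! 0))"
  shows "rec_fun 2 (\<lambda>xs. rec_nat (f (xs ! 1)) (g (xs ! 1)) (xs ! 0))"
proof -
  have "rec_fun (Suc (Suc 0)) (\<lambda>xs. rec_nat (f (tl xs ! 0))
      (\<lambda>i y. g ((y # i # tl xs) ! 2) ((y # i # tl xs) ! 1) ((y # i # tl xs) ! 0)) (hd xs))"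
    using assms by (intro rec_fun_Prec) (simp_all add: numeral_3_eq_3)
  then show ?thesis
    unfolding numeral_2_eq_2 by (rule rec_fun_cong) (auto simp: length_Suc_conv numeral_2_eq_2)
qed

lemma rec_fun_add2: "rec_fun 2 (\<lambda>xs. xs ! 0 + xs ! 1)"
proof -
  have "rec_fun 2 (\<lambda>xs. rec_nat (xs ! 1) (\<lambda>i y. Suc y) (xs ! 0))"
    by (rule rec_fun_prec2) (simp_all add: rec_fun_nth rec_fun_Suc)
  moreover have "rec_nat a (\<lambda>i y. Suc y) n = n + a" for a n :: nat by (induction n) auto
  ultimately show ?thesis by simp
qed

lemmas rec_fun_add = rec_fun_comp2[OF rec_fun_add2]

text \<open>The recursion argument of \<open>Prec\<close> comes first, hence the reversed operands.
  The predecessor is the recursion that returns its counter.\<close>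

lemma rec_fun_diff2: "rec_fun 2 (\<lambda>xs. xs ! 1 - xs ! 0)"
proof -
  have "rec_fun 2 (\<lambda>xs. rec_nat 0 (\<lambda>i y. i) (xs ! 0))"
    by (rule rec_fun_prec2) (simp_all add: rec_fun_nth rec_fun_0)
  moreover have "rec_nat 0 (\<lambda>i y. i) n = n - 1" for n :: nat by (cases n) auto
  ultimately have "rec_fun 2 (\<lambda>xs. xs ! 0 - 1)" by simp
  then have pred: "rec_fun 1 (\<lambda>xs. xs ! 0 - 1)"
    using rec_fun_comp2[of "\<lambda>x y. x - 1" 1 "\<lambda>xs. xs ! 0" "\<lambda>xs. xs ! 0"] by (simp add: rec_fun_nth)
  have "rec_fun 2 (\<lambda>xs. rec_nat (xs ! 1) (\<lambda>i y. y - 1) (xs ! 0))"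
    by (rule rec_fun_prec2[where g = "\<lambda>_ _ y. y - 1"]; intro rec_fun_nth rec_fun_comp1[OF pred]) simp_all
  moreover have "rec_nat a (\<lambda>i y. y - 1) n = a - n" for a n :: nat by (induction n) auto
  ultimately show ?thesis by simp
qed

lemma rec_fun_diff: "rec_fun n f \<Longrightarrow> rec_fun n g \<Longrightarrow> rec_fun n (\<lambda>xs. f xs - g xs)"
  using rec_fun_comp2[OF rec_fun_diff2] by simp

lemma rec_fun_triangle1: "rec_fun 1 (\<lambda>xs. triangle (xs ! 0))"
proof -
  have "rec_fun 2 (\<lambda>xs. rec_nat 0 (\<lambda>i y. y + Suc i) (xs ! 0))"
    by (rule rec_fun_prec2[where g = "\<lambda>_ i y. y + Suc i"])
      (intro rec_fun_nth rec_fun_0 rec_fun_add rec_fun_Suc; simp)+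
  moreover have "rec_nat 0 (\<lambda>i y. y + Suc i) n = triangle n" for n by (induction n) auto
  ultimately have "rec_fun 2 (\<lambda>xs. triangle (xs ! 0))" by simp
  then show ?thesis
    using rec_fun_comp2[of "\<lambda>x y. triangle x" 1 "\<lambda>xs. xs ! 0" "\<lambda>xs. xs ! 0"] by (simp add: rec_fun_nth)
qed

lemmas rec_fun_triangle = rec_fun_comp1[OF rec_fun_triangle1]

lemma rec_fun_prod_encode:
  "rec_fun n f \<Longrightarrow> rec_fun n g \<Longrightarrow> rec_fun n (\<lambda>xs. prod_encode (f xs, g xs))"
  by (simp add: prod_encode_def rec_fun_add rec_fun_triangle)

text \<open>The pairing is \<open>triangle (a + b) + a\<close>, so the diagonal \<open>a + b\<close>
  of a code \<open>p\<close> is the first \<open>w\<close> with \<open>p < triangle (Suc w)\<close>.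
  Truncated subtraction turns the inequality into the search for a zero that \<open>Mu\<close>
  performs.\<close>

definition tri_root :: "nat \<Rightarrow> nat" where
  "tri_root p = (LEAST w. Suc p - triangle (Suc w) = 0)"

lemma tri_root_prod_encode: "tri_root (prod_encode (a, b)) = a + b"
proof -
  have mono: "triangle x \<le> triangle y" if "x \<le> y" for x y
    using that by (induction rule: dec_induct) auto
  show ?thesis unfolding tri_root_def
  proof (rule Least_equality)
    fix w assume w: "Suc (prod_encode (a, b)) - triangle (Suc w) = 0"
    show "a + b \<le> w"
    proof (rule ccontr)
      assume "\<not> a + b \<le> w"
      then have "triangle (Suc w) \<le> triangle (a + b)" by (intro mono) simp
      with w show False by (simp add: prod_encode_def)
    qed
  qed (simp add: prod_encode_def)
qed

lemma rec_fun_tri_root1: "rec_fun 1 (\<lambda>xs. tri_root (xs ! 0))"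
proof -
  have *: "rec_fun (Suc 1) (\<lambda>xs. Suc (xs ! 1) - triangle (Suc (xs ! 0)))"
    by (intro rec_fun_diff rec_fun_triangle rec_fun_Suc rec_fun_nth) simp_all
  have "rec_fun 1 (\<lambda>xs. LEAST m. Suc ((m # xs) ! 1) - triangle (Suc ((m # xs) ! 0)) = 0)"
  proof (rule rec_fun_Mu[OF *])
    fix xs :: "nat list"
    have "n \<le> triangle n" for n by (induction n) auto
    from this[of "Suc (xs ! 0)"]
    show "\<exists>m. Suc ((m # xs) ! 1) - triangle (Suc ((m # xs) ! 0)) = 0"
      by (intro exI[of _ "xs ! 0"]) simp
  qed
  then show ?thesis by (simp add: tri_root_def)
qed

lemma \<pi>\<^sub>1_eq: "\<pi>\<^sub>1 p = p - triangle (tri_root p)"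
  and \<pi>\<^sub>2_eq: "\<pi>\<^sub>2 p = tri_root p - \<pi>\<^sub>1 p"
proof -
  have p: "p = prod_encode (\<pi>\<^sub>1 p, \<pi>\<^sub>2 p)" by simp
  then have "tri_root p = \<pi>\<^sub>1 p + \<pi>\<^sub>2 p" by (metis tri_root_prod_encode)
  moreover have "p = triangle (\<pi>\<^sub>1 p + \<pi>\<^sub>2 p) + \<pi>\<^sub>1 p"
    using p unfolding prod_encode_def case_prod_beta by simp
  ultimately show "\<pi>\<^sub>1 p = p - triangle (tri_root p)" "\<pi>\<^sub>2 p = tri_root p - \<pi>\<^sub>1 p"
    by simp_all
qed

lemma rec_fun_\<pi>\<^sub>1: "rec_fun n f \<Longrightarrow> rec_fun n (\<lambda>xs. \<pi>\<^sub>1 (f xs))"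
  unfolding \<pi>\<^sub>1_eq by (intro rec_fun_diff rec_fun_triangle rec_fun_comp1[OF rec_fun_tri_root1])

lemma rec_fun_\<pi>\<^sub>2: "rec_fun n f \<Longrightarrow> rec_fun n (\<lambda>xs. \<pi>\<^sub>2 (f xs))"
  unfolding \<pi>\<^sub>2_eq by (intro rec_fun_diff rec_fun_\<pi>\<^sub>1 rec_fun_comp1[OF rec_fun_tri_root1])

section \<open>Computable functions and computably enumerable relations\<close>

definition computable_funs :: "(nat \<Rightarrow> nat) set" where
  "computable_funs = {f. rec_fun 1 (\<lambda>xs. f (xs ! 0))}"

lemma computable_funs_rec_fun: "f \<in> computable_funs \<Longrightarrow> rec_fun n g \<Longrightarrow> rec_fun n (\<lambda>xs. f (g xs))"
  unfolding computable_funs_def by (auto intro: rec_fun_comp1)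

interpretation comp: rec_class computable_funs
proof
  show "(\<lambda>x. x) \<in> computable_funs" "(\<lambda>x. 0) \<in> computable_funs" "Suc \<in> computable_funs"
    "\<pi>\<^sub>1 \<in> computable_funs" "\<pi>\<^sub>2 \<in> computable_funs"
    by (simp_all add: computable_funs_def rec_fun_nth rec_fun_0 rec_fun_Suc rec_fun_\<pi>\<^sub>1 rec_fun_\<pi>\<^sub>2)
next
  fix f g assume f: "f \<in> computable_funs" and g: "g \<in> computable_funs"
  from f g show "(\<lambda>x. f (g x)) \<in> computable_funs"
    by (auto simp: computable_funs_def intro: rec_fun_comp1)
  from f g show "(\<lambda>x. prod_encode (f x, g x)) \<in> computable_funs"
    by (auto simp: computable_funs_def intro: rec_fun_prod_encode)
  have "rec_fun 2 (\<lambda>xs. rec_nat (f (xs ! 1)) (\<lambda>i y. g (prod_encode (xs ! 1, prod_encode (i, y)))) (xs ! 0))"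
    using f by (intro rec_fun_prec2 computable_funs_rec_fun[OF g] rec_fun_prod_encode rec_fun_nth)
      (simp_all add: computable_funs_def)
  from rec_fun_comp2[OF this, of 1 "\<lambda>xs. \<pi>\<^sub>2 (xs ! 0)" "\<lambda>xs. \<pi>\<^sub>1 (xs ! 0)"]
  show "(\<lambda>p. rec_nat (f (\<pi>\<^sub>1 p)) (\<lambda>i y. g (prod_encode (\<pi>\<^sub>1 p, prod_encode (i, y)))) (\<pi>\<^sub>2 p)) \<in> computable_funs"
    unfolding computable_funs_def by (simp add: rec_fun_\<pi>\<^sub>1 rec_fun_\<pi>\<^sub>2 rec_fun_nth)
next
  fix f assume f: "f \<in> computable_funs" and ex: "\<And>x. \<exists>n. f (prod_encode (x, n)) = 0"
  have "rec_fun (Suc 1) (\<lambda>xs. f (prod_encode (xs ! 1, xs ! 0)))"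
    by (intro computable_funs_rec_fun[OF f] rec_fun_prod_encode rec_fun_nth) simp_all
  from rec_fun_Mu[OF this] ex
  show "(\<lambda>x. LEAST n. f (prod_encode (x, n)) = 0) \<in> computable_funs"
    unfolding computable_funs_def by simp
qed

lemma computable_rel_iff:
  "computable_rel R \<longleftrightarrow> (\<lambda>p. if prod_decode p \<in> R then 1 else 0) \<in> computable_funs"
proof
  assume "computable_rel R"
  then obtain r where r: "\<And>x y. eval r [x, y] (if (x, y) \<in> R then 1 else 0)"
    by (auto simp: computable_rel_def)
  have *: "rec_fun 2 (\<lambda>xs. if (xs ! 0, xs ! 1) \<in> R then 1 else 0)"
    unfolding rec_fun_def
  proof (intro exI allI impI)
    fix xs :: "nat list" assume "length xs = 2"
    then obtain x y where "xs = [x, y]" by (auto simp: length_Suc_conv numeral_2_eq_2)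
    then show "eval r xs (if (xs ! 0, xs ! 1) \<in> R then 1 else 0)" using r[of x y] by simp
  qed
  from rec_fun_comp2[of "\<lambda>x y. if (x, y) \<in> R then 1 else 0", OF *,
      of 1 "\<lambda>xs. \<pi>\<^sub>1 (xs ! 0)" "\<lambda>xs. \<pi>\<^sub>2 (xs ! 0)"]
  show "(\<lambda>p. if prod_decode p \<in> R then 1 else 0) \<in> computable_funs"
    by (simp add: computable_funs_def rec_fun_\<pi>\<^sub>1 rec_fun_\<pi>\<^sub>2 rec_fun_nth)
next
  assume "(\<lambda>p. if prod_decode p \<in> R then 1 else 0) \<in> computable_funs"
  from computable_funs_rec_fun[OF this, of 2 "\<lambda>xs. prod_encode (xs ! 0, xs ! 1)"]
  have "rec_fun 2 (\<lambda>xs. if (xs ! 0, xs ! 1) \<in> R then 1 else 0)"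
    by (simp add: rec_fun_prod_encode rec_fun_nth)
  then obtain r where r: "\<And>xs. length xs = 2 \<Longrightarrow> eval r xs (if (xs ! 0, xs ! 1) \<in> R then 1 else 0)"
    by (auto simp: rec_fun_def)
  show "computable_rel R" unfolding computable_rel_def
    using r[of "[_, _]"] by (intro exI[of _ r]) simp
qed

text \<open>A condition decidable stage by stage becomes a domain of convergence: unbounded search
  for a stage halts exactly if there is one.\<close>

lemma ce_relI:
  assumes D: "D \<in> computable_funs"
    and R: "\<And>x y. (x, y) \<in> R \<longleftrightarrow> (\<exists>s. D (prod_encode (prod_encode (x, y), s)) = 0)"
  shows "ce_rel R"
proof -
  have "rec_fun 3 (\<lambda>xs. D (prod_encode (prod_encode (xs ! 1, xs ! 2), xs ! 0)))"
    by (intro computable_funs_rec_fun[OF D] rec_fun_prod_encode rec_fun_nth) simp_all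
  then obtain r where r: "\<And>xs. length xs = 3 \<Longrightarrow>
      eval r xs (D (prod_encode (prod_encode (xs ! 1, xs ! 2), xs ! 0)))"
    by (auto simp: rec_fun_def)
  have r': "eval r [s, x, y] (D (prod_encode (prod_encode (x, y), s)))" for s x y
    using r[of "[s, x, y]"] by simp
  have "(\<exists>z. eval (Mu r) [x, y] z) \<longleftrightarrow> (\<exists>s. D (prod_encode (prod_encode (x, y), s)) = 0)" (is "?L \<longleftrightarrow> ?R") for x y
  proof
    assume ?L
    then obtain z where "eval (Mu r) [x, y] z" ..
    then have "eval r [z, x, y] 0" by (rule eval_MuE)
    from eval_deterministic[OF this r'] show ?R by auto
  next
    assume ex: ?R
    define z where "z = (LEAST s. D (prod_encode (prod_encode (x, y), s)) = 0)"
    have "eval (Mu r) [x, y] z"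
    proof (rule eval.mu)
      show "eval r (z # [x, y]) 0" using r'[of z x y] LeastI_ex[OF ex] by (simp add: z_def)
      show "\<forall>m<z. \<exists>w. eval r (m # [x, y]) (Suc w)"
      proof (intro allI impI)
        fix m assume "m < z"
        then have "D (prod_encode (prod_encode (x, y), m)) \<noteq> 0"
          unfolding z_def by (rule not_less_Least)
        then show "\<exists>w. eval r (m # [x, y]) (Suc w)" using r'[of m x y] by (auto simp: gr0_conv_Suc)
      qed
    qed
    then show ?L ..
  qed
  then show ?thesis unfolding ce_rel_def R by blast
qed

section \<open>Functions on coded types\<close>

text \<open>\<open>enc\<close> need not be onto, and several numbers may decode to one value. No
  computability is built in: that of \<open>dec\<close> is a separate hypothesis wherever a search
  has to decode.\<close>

class enc =
  fixes enc :: "'a \<Rightarrow> nat" and dec :: "nat \<Rightarrow> 'a"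
  assumes dec_enc [simp]: "dec (enc x) = x"

lemma enc_eq_iff [simp]: "enc x = enc y \<longleftrightarrow> x = y"
  by (metis dec_enc)

instantiation nat :: enc
begin
definition [simp]: "enc (n :: nat) = n"
definition dec_nat_def [simp]: "dec n = (n :: nat)"
instance by standard simp
end

instantiation bool :: enc
begin
definition enc_bool_def: "enc (b :: bool) = (if b then 1 else 0)"
definition dec_bool_def: "dec n \<longleftrightarrow> n \<noteq> 0"
instance by standard (simp add: enc_bool_def dec_bool_def)
end

instantiation prod :: (enc, enc) enc
begin
definition enc_prod_def: "enc p = prod_encode (enc (fst p), enc (snd p))"
definition dec_prod_def: "dec n = (dec (\<pi>\<^sub>1 n), dec (\<pi>\<^sub>2 n))"
instance by standard (simp add: enc_prod_def dec_prod_def)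
end

instantiation list :: (enc) enc
begin
definition enc_list_def: "enc xs = list_encode (map enc xs)"
definition dec_list_def: "dec n = map dec (list_decode n)"
instance by standard (simp add: enc_list_def dec_list_def comp_def)
end

instantiation int :: enc
begin
definition enc_int_def: "enc k = prod_encode (nat k, nat (- k))"
definition dec_int_def: "dec n = int (\<pi>\<^sub>1 n) - int (\<pi>\<^sub>2 n)"
instance by standard (simp add: enc_int_def dec_int_def)
end

text \<open>The numerator is a difference of naturals and the denominator is stored minus one, so
  every number is the code of some rational.\<close>

definition rat_val :: "nat \<Rightarrow> rat" where
  "rat_val n = (of_nat (\<pi>\<^sub>1 n) - of_nat (\<pi>\<^sub>1 (\<pi>\<^sub>2 n))) / of_nat (Suc (\<pi>\<^sub>2 (\<pi>\<^sub>2 n)))"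

lemma rat_val_surj: "\<exists>n. rat_val n = q"
proof (cases q)
  case (Fract a b)
  have "rat_val (prod_encode (nat a, prod_encode (nat (- a), nat b - 1))) = q"
    using Fract by (simp add: rat_val_def Fract_of_int_quotient)
  then show ?thesis ..
qed

text \<open>Many codes have the same value; \<open>enc\<close> takes the least, which a bounded
  search recovers from any other.\<close>

instantiation rat :: enc
begin
definition enc_rat_def: "enc q = (LEAST n. rat_val n = q)"
definition dec_rat_def: "dec n = rat_val n"
instance by standard (simp add: enc_rat_def dec_rat_def LeastI_ex[OF rat_val_surj])
end

section \<open>Closure rules for functions between coded types\<close>

named_theorems cf_intros

context rec_class
begin

text \<open>The values of \<open>g\<close> at numbers outside the range of \<open>enc\<close> are
  left open, so closure rules need not recognise codes.\<close>

definition cf :: "('a :: enc \<Rightarrow> 'b :: enc) \<Rightarrow> bool" where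
  "cf f \<longleftrightarrow> (\<exists>g\<in>C. \<forall>x. g (enc x) = enc (f x))"

lemma cf_natI: "g \<in> C \<Longrightarrow> cf g"
  unfolding cf_def by auto

lemma cf_natD: "cf (g :: nat \<Rightarrow> nat) \<Longrightarrow> g \<in> C"
proof -
  assume "cf g"
  then obtain g' where "g' \<in> C" "\<And>x. g' x = g x" by (auto simp: cf_def)
  moreover then have "g' = g" by blast
  ultimately show ?thesis by simp
qed

lemma cf_cong: "cf f \<Longrightarrow> (\<And>x. f x = g x) \<Longrightarrow> cf g"
  unfolding cf_def by simp

lemma cf_comp: "cf f \<Longrightarrow> cf g \<Longrightarrow> cf (\<lambda>x. f (g x))"
proof -
  assume "cf f" "cf g"
  then obtain f' g' where "f' \<in> C" "\<And>x. f' (enc x) = enc (f x)" "g' \<in> C" "\<And>x. g' (enc x) = enc (g x)"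
    by (auto simp: cf_def)
  then show "cf (\<lambda>x. f (g x))" unfolding cf_def by - (rule bexI[OF _ C_comp[of f' g']], simp_all)
qed

lemma cf_id [cf_intros]: "cf (\<lambda>x. x)"
  unfolding cf_def by (rule bexI[OF _ C_id]) simp

lemma cf_const [cf_intros]: "cf (\<lambda>_. c)"
proof -
  have "(\<lambda>_. n) \<in> C" for n by (induction n) (auto intro: C_zero C_comp[OF C_Suc])
  from this[of "enc c"] show ?thesis unfolding cf_def by (rule bexI[rotated]) simp
qed

lemma cf_Pair [cf_intros]: "cf f \<Longrightarrow> cf g \<Longrightarrow> cf (\<lambda>x. (f x, g x))"
proof -
  assume "cf f" "cf g"
  then obtain f' g' where "f' \<in> C" "\<And>x. f' (enc x) = enc (f x)" "g' \<in> C" "\<And>x. g' (enc x) = enc (g x)"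
    by (auto simp: cf_def)
  then show "cf (\<lambda>x. (f x, g x))" unfolding cf_def enc_prod_def
    by - (rule bexI[OF _ C_pair[of f' g']], simp_all)
qed

lemma cf_fst [cf_intros]: "cf f \<Longrightarrow> cf (\<lambda>x. fst (f x))"
  by (rule cf_comp[of fst]) (auto simp: cf_def enc_prod_def intro!: bexI[OF _ C_fst])

lemma cf_snd [cf_intros]: "cf f \<Longrightarrow> cf (\<lambda>x. snd (f x))"
  by (rule cf_comp[of snd]) (auto simp: cf_def enc_prod_def intro!: bexI[OF _ C_snd])

lemma cf_comp2: "cf (\<lambda>p. f (fst p) (snd p)) \<Longrightarrow> cf a \<Longrightarrow> cf b \<Longrightarrow> cf (\<lambda>x. f (a x) (b x))"
  using cf_comp[of "\<lambda>p. f (fst p) (snd p)", OF _ cf_Pair] by simp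

lemma cf_comp3: "cf (\<lambda>p. f (fst p) (fst (snd p)) (snd (snd p))) \<Longrightarrow> cf a \<Longrightarrow> cf b \<Longrightarrow> cf c \<Longrightarrow>
    cf (\<lambda>x. f (a x) (b x) (c x))"
  using cf_comp[of "\<lambda>p. f (fst p) (fst (snd p)) (snd (snd p))", OF _ cf_Pair[OF _ cf_Pair]] by simp

lemma cf_Suc [cf_intros]: "cf f \<Longrightarrow> cf (\<lambda>x. Suc (f x))"
  by (rule cf_comp[OF cf_natI[OF C_Suc]])

lemma cf_enc [cf_intros]: "cf f \<Longrightarrow> cf (\<lambda>x. enc (f x))"
  by (simp add: cf_def)

lemma cf_prod_encode [cf_intros]: "cf f \<Longrightarrow> cf g \<Longrightarrow> cf (\<lambda>x. prod_encode (f x, g x))"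
  using cf_enc[OF cf_Pair, of f g] by (simp add: enc_prod_def)

lemma cf_prod_decode [cf_intros]: "cf f \<Longrightarrow> cf (\<lambda>x. prod_decode (f x))"
proof (rule cf_comp[of prod_decode])
  show "cf prod_decode" unfolding cf_def by (rule bexI[OF _ C_id]) (simp add: enc_prod_def)
qed

lemma cf_rec_nat [cf_intros]:
  assumes f: "cf f" and g: "cf (\<lambda>p. g (fst p) (fst (snd p)) (snd (snd p)))" and n: "cf n"
  shows "cf (\<lambda>x. rec_nat (f x) (g x) (n x))"
proof -
  obtain f' where f': "f' \<in> C" "\<And>x. f' (enc x) = enc (f x)" using f by (auto simp: cf_def)
  obtain g' where g': "g' \<in> C"
      "\<And>x i y. g' (prod_encode (enc x, prod_encode (i, enc y))) = enc (g x i y)"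
    using g by (fastforce simp: cf_def enc_prod_def)
  have "rec_nat (enc (f x)) (\<lambda>i y. g' (prod_encode (enc x, prod_encode (i, y)))) m
      = enc (rec_nat (f x) (g x) m)" for x m
    by (induction m) (auto simp: g')
  then have "cf (\<lambda>p. rec_nat (f (fst p)) (g (fst p)) (snd p))"
    unfolding cf_def by (intro bexI[OF _ C_rec[OF f'(1) g'(1)]]) (simp add: enc_prod_def f')
  from cf_comp2[of "\<lambda>x. rec_nat (f x) (g x)", OF this cf_id n] show ?thesis .
qed

text \<open>A conditional is a recursion of length \<open>0\<close> or \<open>1\<close>, the code of
  the truth value.\<close>

lemma cf_if [cf_intros]:
  assumes "cf b" "cf f" "cf g"
  shows "cf (\<lambda>x. if b x then f x else g x)"
proof -
  have "cf (\<lambda>x. rec_nat (g x) (\<lambda>_ _. f x) (enc (b x)))"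
    by (intro cf_rec_nat cf_enc assms cf_comp[OF assms(2)] cf_intros)
  moreover have "rec_nat (g x) (\<lambda>_ _. f x) (enc (b x)) = (if b x then f x else g x)" for x
    by (simp add: enc_bool_def)
  ultimately show ?thesis by simp
qed

lemma cf_not [cf_intros]: "cf a \<Longrightarrow> cf (\<lambda>x. \<not> a x)"
  by (rule cf_cong[OF cf_if[of a "\<lambda>_. False" "\<lambda>_. True"]]) (simp_all add: cf_const)

lemma cf_conj [cf_intros]: "cf a \<Longrightarrow> cf b \<Longrightarrow> cf (\<lambda>x. a x \<and> b x)"
  by (rule cf_cong[OF cf_if[of a b "\<lambda>_. False"]]) (simp_all add: cf_const)

lemma cf_disj [cf_intros]: "cf a \<Longrightarrow> cf b \<Longrightarrow> cf (\<lambda>x. a x \<or> b x)"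
  by (rule cf_cong[OF cf_if[of a "\<lambda>_. True" b]]) (simp_all add: cf_const)

lemma cf_imp [cf_intros]: "cf a \<Longrightarrow> cf b \<Longrightarrow> cf (\<lambda>x. a x \<longrightarrow> b x)"
  by (rule cf_cong[OF cf_if[of a b "\<lambda>_. True"]]) (simp_all add: cf_const)

lemma cf_add [cf_intros]: "cf a \<Longrightarrow> cf b \<Longrightarrow> cf (\<lambda>x. a x + b x :: nat)"
proof -
  assume "cf a" "cf b"
  then have "cf (\<lambda>x. rec_nat (a x) (\<lambda>_ y. Suc y) (b x))" by (intro cf_intros)
  moreover have "rec_nat a (\<lambda>_ y. Suc y) b = a + b" for a b by (induction b) auto
  ultimately show ?thesis by simp
qed

lemma cf_mult [cf_intros]: "cf a \<Longrightarrow> cf b \<Longrightarrow> cf (\<lambda>x. a x * b x :: nat)"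
proof -
  assume a: "cf a" and b: "cf b"
  then have "cf (\<lambda>x. rec_nat 0 (\<lambda>_ y. y + a x) (b x))"
    by (intro cf_intros cf_comp[OF a])
  moreover have "rec_nat 0 (\<lambda>_ y. y + a) b = a * b" for a b :: nat by (induction b) auto
  ultimately show ?thesis by simp
qed

lemma cf_pred [cf_intros]: "cf a \<Longrightarrow> cf (\<lambda>x. a x - Suc 0)"
proof -
  assume "cf a"
  then have "cf (\<lambda>x. rec_nat 0 (\<lambda>i _. i) (a x))" by (intro cf_intros)
  moreover have "rec_nat 0 (\<lambda>i _. i) a = a - Suc 0" for a :: nat by (cases a) auto
  ultimately show ?thesis by simp
qed

lemma cf_diff [cf_intros]: "cf a \<Longrightarrow> cf b \<Longrightarrow> cf (\<lambda>x. a x - b x :: nat)"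
proof -
  assume "cf a" "cf b"
  then have "cf (\<lambda>x. rec_nat (a x) (\<lambda>_ y. y - Suc 0) (b x))" by (intro cf_intros)
  moreover have "rec_nat a (\<lambda>_ y. y - Suc 0) b = a - b" for a b :: nat by (induction b) auto
  ultimately show ?thesis by simp
qed

lemma cf_is_zero: "cf a \<Longrightarrow> cf (\<lambda>x. a x = (0 :: nat))"
proof -
  assume "cf a"
  then have "cf (\<lambda>x. rec_nat True (\<lambda>_ _. False) (a x))" by (intro cf_intros)
  moreover have "rec_nat True (\<lambda>_ _. False) a = (a = 0)" for a :: nat by (cases a) auto
  ultimately show ?thesis by simp
qed

lemma cf_le [cf_intros]: "cf a \<Longrightarrow> cf b \<Longrightarrow> cf (\<lambda>x. a x \<le> (b x :: nat))"
  using cf_is_zero[OF cf_diff, of a b] by simp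

lemma cf_less [cf_intros]: "cf a \<Longrightarrow> cf b \<Longrightarrow> cf (\<lambda>x. a x < (b x :: nat))"
  using cf_le[OF cf_Suc, of a b] by (simp add: Suc_le_eq)

lemma cf_eq [cf_intros]: "cf a \<Longrightarrow> cf b \<Longrightarrow> cf (\<lambda>x. a x = b x)"
proof -
  assume "cf a" "cf b"
  then have "cf (\<lambda>x. enc (a x) \<le> enc (b x) \<and> enc (b x) \<le> enc (a x))" by (intro cf_intros)
  then show ?thesis by (simp flip: order_eq_iff)
qed

section \<open>Bounded quantifiers and search\<close>

lemma cf_Ex_less [cf_intros]:
  fixes b :: "_ \<Rightarrow> nat"
  assumes "cf b" "cf (\<lambda>p. P (fst p) (snd p))"
  shows "cf (\<lambda>x. \<exists>n<b x. P x n)"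
proof -
  have "cf (\<lambda>p. P (fst p) (fst (snd p)))"
    using cf_comp2[OF assms(2), of fst "\<lambda>p. fst (snd p)"] by (simp add: cf_intros)
  with assms(1) have "cf (\<lambda>x. rec_nat False (\<lambda>i y. y \<or> P x i) (b x))"
    by (intro cf_intros)
  moreover have "rec_nat False (\<lambda>i y. y \<or> P x i) b \<longleftrightarrow> (\<exists>n<b. P x n)" for x b
    by (induction b) (auto simp: less_Suc_eq)
  ultimately show ?thesis by simp
qed

lemma cf_Ex_le [cf_intros]:
  "cf b \<Longrightarrow> cf (\<lambda>p. P (fst p) (snd p)) \<Longrightarrow> cf (\<lambda>x. \<exists>n\<le>b x :: nat. P x n)"
  using cf_Ex_less[of "\<lambda>x. Suc (b x)" P] by (simp add: cf_Suc less_Suc_eq_le)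

lemma cf_All_less [cf_intros]:
  "cf b \<Longrightarrow> cf (\<lambda>p. P (fst p) (snd p)) \<Longrightarrow> cf (\<lambda>x. \<forall>n<b x :: nat. P x n)"
  using cf_not[OF cf_Ex_less, of b "\<lambda>x n. \<not> P x n"] by (simp add: cf_not)

text \<open>The candidate moves up by one as long as it fails, so after \<open>m\<close> steps it is
  the minimum of \<open>m\<close> and the true value; \<open>b x\<close> steps are enough.\<close>

lemma cf_bounded_Least:
  fixes b :: "_ \<Rightarrow> nat"
  assumes P: "cf (\<lambda>p. P (fst p) (snd p))" and b: "cf b" and ex: "\<And>x. \<exists>n\<le>b x. P x n"
  shows "cf (\<lambda>x. LEAST n. P x n)"
proof (rule cf_cong)
  have "cf (\<lambda>p. P (fst p) (snd (snd p)))"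
    using cf_comp2[OF P, of fst "\<lambda>p. snd (snd p)"] by (simp add: cf_intros)
  with b show "cf (\<lambda>x. rec_nat 0 (\<lambda>_ y. if P x y then y else Suc y) (b x))"
    by (intro cf_intros)
next
  fix x
  define L where "L = (LEAST n. P x n)"
  have "L \<le> b x" "P x L" and less: "\<And>n. n < L \<Longrightarrow> \<not> P x n"
    using ex[of x] unfolding L_def by (auto intro: LeastI order.trans[OF Least_le] dest: not_less_Least)
  have "rec_nat 0 (\<lambda>_ y. if P x y then y else Suc y) m = min m L" for m
  proof (induction m)
    case (Suc m)
    then show ?case using \<open>P x L\<close> less[of m] by (cases m L rule: linorder_cases) auto
  qed simp
  with \<open>L \<le> b x\<close> show "rec_nat 0 (\<lambda>_ y. if P x y then y else Suc y) (b x) = (LEAST n. P x n)"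
    by (simp add: L_def)
qed

text \<open>\<open>C_mu\<close> asks for a witness at every number, also at those that are not of
  the form \<open>enc x\<close>. Decoding the argument first supplies one, which is why
  \<open>dec\<close> has to be in the class.\<close>

lemma cf_Least:
  fixes P :: "'a :: enc \<Rightarrow> nat \<Rightarrow> bool"
  assumes P: "cf (\<lambda>p. P (fst p) (snd p))" and dec: "cf (dec :: nat \<Rightarrow> 'a)" and ex: "\<And>x. \<exists>n. P x n"
  shows "cf (\<lambda>x. LEAST n. P x n)"
proof -
  have "cf (\<lambda>p. P (dec (fst p)) (snd p))"
    using cf_comp2[OF P, of "\<lambda>p. dec (fst p)" snd] by (simp add: cf_intros cf_comp[OF dec])
  then have "cf (\<lambda>p. if P (dec (fst p)) (snd p) then 0 else Suc 0)"
    by (intro cf_intros)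
  then obtain g where g: "g \<in> C"
    "\<And>x n. g (prod_encode (x, n)) = (if P (dec x) n then 0 else Suc 0)"
    by (auto simp: cf_def enc_prod_def)
  have "(\<lambda>x. LEAST n. g (prod_encode (x, n)) = 0) \<in> C"
    using ex by (intro C_mu g(1)) (simp add: g(2))
  then show ?thesis unfolding cf_def
    by (rule bexI[rotated]) (simp add: g(2))
qed

subsection \<open>Lists\<close>

lemma cf_dec_nat [cf_intros]: "cf (dec :: nat \<Rightarrow> nat)"
  unfolding dec_nat_def by (rule cf_id)

lemma cf_dec_prod [cf_intros]:
  "cf (dec :: nat \<Rightarrow> 'a) \<Longrightarrow> cf (dec :: nat \<Rightarrow> 'b) \<Longrightarrow> cf (dec :: nat \<Rightarrow> 'a :: enc \<times> 'b :: enc)"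
  unfolding dec_prod_def
  by (intro cf_Pair cf_comp[of dec "\<lambda>n. \<pi>\<^sub>1 n"] cf_comp[of dec "\<lambda>n. \<pi>\<^sub>2 n"] cf_intros)

lemma funpow_eq_rec_nat: "(f ^^ n) z = rec_nat z (\<lambda>_. f) n"
  by (induction n) auto

lemma cf_funpow [cf_intros]:
  fixes g :: "'a :: enc \<Rightarrow> 'b :: enc \<Rightarrow> 'b"
  assumes "cf (\<lambda>p. g (fst p) (snd p))" "cf n" "cf f"
  shows "cf (\<lambda>x. (g x ^^ n x) (f x))"
proof -
  have "cf (\<lambda>p. g (fst p) (snd (snd p)))"
    using cf_comp2[OF assms(1), of fst "\<lambda>p. snd (snd p)"] by (simp add: cf_intros)
  from cf_rec_nat[where g = "\<lambda>x _. g x", OF assms(3) this assms(2)]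
  show ?thesis unfolding funpow_eq_rec_nat .
qed

lemma length_le_list_encode: "length xs \<le> list_encode xs"
proof (induction xs)
  case (Cons x xs)
  then show ?case using le_prod_encode_2[of "list_encode xs" x] by simp
qed simp

text \<open>The list is consumed by iterating a step on pairs of remaining code and accumulator. The
  code itself serves as the number of iterations: it is at least the length of the list, and further
  steps at the empty list change nothing.\<close>

lemma cf_foldl [cf_intros]:
  assumes g: "cf (\<lambda>p. g (fst p) (fst (snd p)) (snd (snd p)))" and a: "cf a" and xs: "cf xs"
  shows "cf (\<lambda>x. foldl (g x) (a x) (xs x))"
proof -
  obtain g' where g': "g' \<in> C"
      "\<And>x s y. g' (prod_encode (enc x, prod_encode (enc s, enc y))) = enc (g x s y)"
    using g by (fastforce simp: cf_def enc_prod_def)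
  define step where "step x t = (if fst t = 0 then t else
      (\<pi>\<^sub>2 (fst t - Suc 0), g' (prod_encode (x, prod_encode (snd t, \<pi>\<^sub>1 (fst t - Suc 0))))))" for x t
  have run: "length ys \<le> n \<Longrightarrow>
      (step (enc x) ^^ n) (list_encode (map enc ys), enc s) = (0, enc (foldl (g x) s ys))" for x ys n s
  proof (induction n arbitrary: ys s)
    case (Suc n)
    have "step (enc x) (0, enc s) = (0, enc s)" by (simp add: step_def)
    moreover have "step (enc x) (list_encode (map enc (z # zs)), enc s)
        = (list_encode (map enc zs), enc (g x s z))" for z zs
      by (simp add: step_def g')
    ultimately show ?case
      using Suc.prems Suc.IH[of "tl ys"] Suc.IH[of "[]"]
      by (cases ys) (simp_all del: funpow.simps list_encode.simps(2) add: funpow_Suc_right)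
  qed simp
  have "cf (\<lambda>p. step (fst p) (snd p))"
    unfolding step_def by (intro cf_intros cf_comp[OF cf_natI[OF g'(1)]])
  note step = cf_comp2[of step, OF this]
  have "cf (\<lambda>p. snd ((step (fst p) ^^ snd (snd p)) (snd (snd p), fst (snd p))))"
    by (intro cf_intros step)
  then obtain f where f: "f \<in> C" "\<And>x s l. f (prod_encode (x, prod_encode (s, l))) = snd ((step x ^^ l) (l, s))"
    by (fastforce simp: cf_def enc_prod_def)
  have "cf (\<lambda>p. foldl (g (fst p)) (fst (snd p)) (snd (snd p)))"
    unfolding cf_def
    by (rule bexI[OF _ f(1)])
      (simp add: enc_prod_def enc_list_def f(2) run order.trans[OF _ length_le_list_encode])
  from cf_comp3[of "\<lambda>x. foldl (g x)", OF this cf_id a xs] show ?thesis .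
qed

lemma cf_Cons [cf_intros]: "cf a \<Longrightarrow> cf xs \<Longrightarrow> cf (\<lambda>x. a x # xs x)"
  using cf_Suc[OF cf_prod_encode[OF cf_enc cf_enc], of a xs] by (simp add: cf_def enc_list_def)

lemma foldl_Cons: "foldl (\<lambda>acc y. y # acc) ys xs = rev xs @ ys"
  by (induction xs arbitrary: ys) auto

lemma cf_rev [cf_intros]: "cf xs \<Longrightarrow> cf (\<lambda>x. rev (xs x))"
  by (rule cf_cong[where f = "\<lambda>x. foldl (\<lambda>acc y. y # acc) [] (xs x)"])
    (intro cf_intros, assumption, simp add: foldl_Cons)

lemma cf_append [cf_intros]: "cf xs \<Longrightarrow> cf ys \<Longrightarrow> cf (\<lambda>x. xs x @ ys x)"
  by (rule cf_cong[where f = "\<lambda>x. foldl (\<lambda>acc y. y # acc) (ys x) (rev (xs x))"])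
    (intro cf_intros, assumption+, simp add: foldl_Cons)

lemma foldl_Suc: "foldl (\<lambda>n y. Suc n) n xs = n + length xs"
  by (induction xs arbitrary: n) auto

lemma cf_length [cf_intros]: "cf xs \<Longrightarrow> cf (\<lambda>x. length (xs x))"
  by (rule cf_cong[where f = "\<lambda>x. foldl (\<lambda>n y. Suc n) 0 (xs x)"])
    (intro cf_intros, assumption, simp add: foldl_Suc)

lemma cf_Ex_list [cf_intros]:
  assumes xs: "cf xs" and P: "cf (\<lambda>p. P (fst p) (snd p))"
  shows "cf (\<lambda>x. \<exists>y\<in>set (xs x). P x y)"
proof -
  have "cf (\<lambda>p. P (fst p) (snd (snd p)))"
    using cf_comp2[OF P, of fst "\<lambda>p. snd (snd p)"] by (simp add: cf_intros)
  with xs have "cf (\<lambda>x. foldl (\<lambda>b y. b \<or> P x y) False (xs x))" by (intro cf_intros)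
  moreover have "foldl (\<lambda>b y. b \<or> P x y) b xs \<longleftrightarrow> b \<or> (\<exists>y\<in>set xs. P x y)" for x b xs
    by (induction xs arbitrary: b) auto
  ultimately show ?thesis by simp
qed

lemma cf_All_list [cf_intros]:
  "cf xs \<Longrightarrow> cf (\<lambda>p. P (fst p) (snd p)) \<Longrightarrow> cf (\<lambda>x. \<forall>y\<in>set (xs x). P x y)"
  using cf_not[OF cf_Ex_list, of xs "\<lambda>x y. \<not> P x y"] by (simp add: cf_not)

lemma cf_member [cf_intros]: "cf a \<Longrightarrow> cf xs \<Longrightarrow> cf (\<lambda>x. a x \<in> set (xs x))"
proof -
  assume a: "cf a" and xs: "cf xs"
  have "cf (\<lambda>x. \<exists>y\<in>set (xs x). a x = y)" by (intro cf_intros a xs cf_comp[OF a])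
  then show ?thesis by (simp add: eq_commute)
qed

lemma foldl_append: "foldl (@) ys xs = ys @ concat xs"
  by (induction xs arbitrary: ys) auto

lemma cf_concat [cf_intros]: "cf xs \<Longrightarrow> cf (\<lambda>x. concat (xs x))"
  by (rule cf_cong[where f = "\<lambda>x. foldl (@) [] (xs x)"])
    (intro cf_intros, assumption, simp add: foldl_append)

lemma cf_map [cf_intros]:
  assumes f: "cf (\<lambda>p. f (fst p) (snd p))" and xs: "cf xs"
  shows "cf (\<lambda>x. map (f x) (xs x))"
proof -
  have "cf (\<lambda>p. f (fst p) (snd (snd p)))"
    using cf_comp2[OF f, of fst "\<lambda>p. snd (snd p)"] by (simp add: cf_intros)
  with xs have "cf (\<lambda>x. foldl (\<lambda>acc y. acc @ [f x y]) [] (xs x))" by (intro cf_intros)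
  moreover have "foldl (\<lambda>acc y. acc @ [f x y]) ys xs = ys @ map (f x) xs" for x ys xs
    by (induction xs arbitrary: ys) auto
  ultimately show ?thesis by simp
qed

lemma cf_hd [cf_intros]: "cf xs \<Longrightarrow> cf (\<lambda>x. hd (xs x :: 'c :: enc list))"
proof (rule cf_comp[of hd])
  have "cf (\<lambda>n. if n = 0 then enc (hd [] :: 'c) else \<pi>\<^sub>1 (n - Suc 0))" by (intro cf_intros)
  from cf_natD[OF this] show "cf (hd :: 'c list \<Rightarrow> 'c)"
    unfolding cf_def
  proof (rule bexI[rotated], intro allI)
    fix xs :: "'c list"
    show "(if enc xs = 0 then enc (hd [] :: 'c) else \<pi>\<^sub>1 (enc xs - Suc 0)) = enc (hd xs)"
      by (cases xs) (simp_all add: enc_list_def)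
  qed
qed

lemma cf_tl [cf_intros]: "cf xs \<Longrightarrow> cf (\<lambda>x. tl (xs x :: 'c :: enc list))"
proof (rule cf_comp[of tl])
  have "cf (\<lambda>n. if n = 0 then 0 else \<pi>\<^sub>2 (n - Suc 0))" by (intro cf_intros)
  from cf_natD[OF this] show "cf (tl :: 'c list \<Rightarrow> 'c list)"
    unfolding cf_def
  proof (rule bexI[rotated], intro allI)
    fix xs :: "'c list"
    show "(if enc xs = 0 then 0 else \<pi>\<^sub>2 (enc xs - Suc 0)) = enc (tl xs)"
      by (cases xs) (simp_all add: enc_list_def)
  qed
qed

lemma funpow_tl: "(tl ^^ n) xs = drop n xs"
  by (induction n) (simp_all add: drop_Suc tl_drop)

lemma cf_drop [cf_intros]: "cf n \<Longrightarrow> cf xs \<Longrightarrow> cf (\<lambda>x. drop (n x) (xs x))"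
  by (rule cf_cong[where f = "\<lambda>x. (tl ^^ n x) (xs x)"])
    (intro cf_intros, assumption+, simp add: funpow_tl)

lemma cf_take [cf_intros]: "cf n \<Longrightarrow> cf xs \<Longrightarrow> cf (\<lambda>x. take (n x) (xs x :: 'b :: enc list))"
proof -
  assume "cf n" "cf xs"
  then have "cf (\<lambda>x. rev (drop (length (xs x) - n x) (rev (xs x))))" by (intro cf_intros)
  moreover have "rev (drop (length xs - n) (rev xs)) = take n xs" for n and xs :: "'b list"
    by (cases "n \<le> length xs") (simp_all add: rev_drop)
  ultimately show ?thesis by simp
qed

end

context rec_class
begin

subsection \<open>Integers and rationals\<close>

lemma cf_dec_list [cf_intros]:
  assumes "cf (dec :: nat \<Rightarrow> 'a :: enc)"
  shows "cf (dec :: nat \<Rightarrow> 'a list)"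
proof -
  have "cf list_decode"
    unfolding cf_def by (rule bexI[OF _ C_id]) (simp add: enc_list_def map_idI)
  then show ?thesis
    unfolding dec_list_def using cf_comp[OF assms cf_snd[OF cf_id]] by (intro cf_map)
qed

lemma cf_nat [cf_intros]: "cf k \<Longrightarrow> cf (\<lambda>x. nat (k x))"
  and cf_nat_minus [cf_intros]: "cf k \<Longrightarrow> cf (\<lambda>x. nat (- k x))"
proof -
  assume "cf k"
  then have "cf (\<lambda>x. \<pi>\<^sub>1 (enc (k x)))" "cf (\<lambda>x. \<pi>\<^sub>2 (enc (k x)))" by (intro cf_intros; assumption)+
  then show "cf (\<lambda>x. nat (k x))" "cf (\<lambda>x. nat (- k x))" by (simp_all add: enc_int_def)
qed

lemma cf_int_diff: "cf m \<Longrightarrow> cf n \<Longrightarrow> cf (\<lambda>x. int (m x) - int (n x))"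
proof -
  assume "cf m" "cf n"
  then have "cf (\<lambda>x. prod_encode (m x - n x, n x - m x))" by (intro cf_intros)
  then show ?thesis by (simp add: cf_def enc_int_def nat_minus_as_int)
qed

lemma cf_dec_int [cf_intros]: "cf (dec :: nat \<Rightarrow> int)"
  unfolding dec_int_def by (intro cf_int_diff cf_intros)

lemma cf_int_less [cf_intros]: "cf k \<Longrightarrow> cf l \<Longrightarrow> cf (\<lambda>x. k x < (l x :: int))"
proof -
  assume "cf k" "cf l"
  then have "cf (\<lambda>x. nat (k x) + nat (- l x) < nat (l x) + nat (- k x))" by (intro cf_intros)
  moreover have "nat a + nat (- b) < nat b + nat (- a) \<longleftrightarrow> a < b" for a b :: int by arith
  ultimately show ?thesis by simp
qed

lemma cf_int_le [cf_intros]: "cf k \<Longrightarrow> cf l \<Longrightarrow> cf (\<lambda>x. k x \<le> (l x :: int))"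
  using cf_not[OF cf_int_less, of l k] by (simp add: not_less)

lemma cf_int_add1 [cf_intros]: "cf k \<Longrightarrow> cf (\<lambda>x. k x + 1 :: int)"
proof -
  assume "cf k"
  then have "cf (\<lambda>x. int (Suc (nat (k x))) - int (nat (- k x)))" by (intro cf_int_diff cf_intros)
  moreover have "int (Suc (nat a)) - int (nat (- a)) = a + 1" for a by arith
  ultimately show ?thesis by (simp only:)
qed

lemma cf_int_sub1 [cf_intros]: "cf k \<Longrightarrow> cf (\<lambda>x. k x - 1 :: int)"
proof -
  assume "cf k"
  then have "cf (\<lambda>x. int (nat (k x)) - int (Suc (nat (- k x))))" by (intro cf_int_diff cf_intros)
  moreover have "int (nat a) - int (Suc (nat (- a))) = a - 1" for a by arith
  ultimately show ?thesis by (simp only:)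
qed

text \<open>Cross-multiplied, with subtracted terms moved to the other side, so that only arithmetic
  of naturals remains.\<close>

lemma rat_val_less_iff: "rat_val m < rat_val n \<longleftrightarrow>
    \<pi>\<^sub>1 m * Suc (\<pi>\<^sub>2 (\<pi>\<^sub>2 n)) + \<pi>\<^sub>1 (\<pi>\<^sub>2 n) * Suc (\<pi>\<^sub>2 (\<pi>\<^sub>2 m))
      < \<pi>\<^sub>1 n * Suc (\<pi>\<^sub>2 (\<pi>\<^sub>2 m)) + \<pi>\<^sub>1 (\<pi>\<^sub>2 m) * Suc (\<pi>\<^sub>2 (\<pi>\<^sub>2 n))"
proof -
  have "(a - b) / c < (a' - b') / c' \<longleftrightarrow> a * c' + b' * c < a' * c + b * c'"
    if "c > 0" "c' > 0" for a b c a' b' c' :: rat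
    using that by (simp add: divide_simps algebra_simps)
  from this[of "of_nat (Suc (\<pi>\<^sub>2 (\<pi>\<^sub>2 m)))" "of_nat (Suc (\<pi>\<^sub>2 (\<pi>\<^sub>2 n)))"] show ?thesis
    unfolding rat_val_def of_nat_less_iff[where 'a = rat, symmetric] of_nat_add of_nat_mult
    by (simp only: of_nat_0_less_iff zero_less_Suc)
qed

lemma cf_rat_val_less: "cf m \<Longrightarrow> cf n \<Longrightarrow> cf (\<lambda>x. rat_val (m x) < rat_val (n x))"
  unfolding rat_val_less_iff by (intro cf_intros)

lemma cf_rat_less [cf_intros]: "cf q \<Longrightarrow> cf r \<Longrightarrow> cf (\<lambda>x. q x < (r x :: rat))"
  using cf_rat_val_less[OF cf_enc cf_enc, of q r] dec_enc[where 'a = rat] by (simp add: dec_rat_def)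

text \<open>Decoding has to replace a code by the least one of the same value; the given code bounds
  the search, and equality is tested by two strict comparisons.\<close>

lemma cf_dec_rat [cf_intros]: "cf (dec :: nat \<Rightarrow> rat)"
proof -
  have "cf (\<lambda>n. LEAST m. \<not> rat_val m < rat_val n \<and> \<not> rat_val n < rat_val m)"
  proof (rule cf_bounded_Least[where b = "\<lambda>n. n"])
    show "cf (\<lambda>p. \<not> rat_val (snd p) < rat_val (fst p) \<and> \<not> rat_val (fst p) < rat_val (snd p))"
      by (intro cf_intros cf_rat_val_less)
  qed (auto intro: cf_intros)
  moreover have "(LEAST m. \<not> rat_val m < rat_val n \<and> \<not> rat_val n < rat_val m) = enc (rat_val n)" for n
    unfolding enc_rat_def by (rule arg_cong[where f = Least]) auto
  ultimately show ?thesis by (simp add: cf_def dec_rat_def)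
qed

end

section \<open>Limit computable functions\<close>

text \<open>By the limit lemma these are the total functions computable relative to the halting
  problem.\<close>

definition limit_funs :: "(nat \<Rightarrow> nat) set" where
  "limit_funs = {f. \<exists>g. comp.cf (\<lambda>p. g (fst p) (snd p)) \<and> (\<forall>x. \<forall>\<^sub>F s in sequentially. g x s = f x)}"

lemma limit_funsI:
  "comp.cf (\<lambda>p. g (fst p) (snd p)) \<Longrightarrow> (\<And>x. \<forall>\<^sub>F s in sequentially. g x s = f x) \<Longrightarrow> f \<in> limit_funs"
  unfolding limit_funs_def by blast

lemma computable_funs_limit_funs: "f \<in> computable_funs \<Longrightarrow> f \<in> limit_funs"
  by (rule limit_funsI[where g = "\<lambda>x s. f x"])
    (simp_all add: comp.cf_comp[OF comp.cf_natI comp.cf_fst[OF comp.cf_id]])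

interpretation limit: rec_class limit_funs
proof
  show "(\<lambda>x. x) \<in> limit_funs" "(\<lambda>x. 0) \<in> limit_funs" "Suc \<in> limit_funs"
    "\<pi>\<^sub>1 \<in> limit_funs" "\<pi>\<^sub>2 \<in> limit_funs"
    by (intro computable_funs_limit_funs comp.C_id comp.C_zero comp.C_Suc comp.C_fst comp.C_snd)+
next
  fix f g assume "f \<in> limit_funs" and "g \<in> limit_funs"
  then obtain f' g' where
    f': "comp.cf (\<lambda>p. f' (fst p) (snd p))" "\<And>x. \<forall>\<^sub>F s in sequentially. f' x s = f x" and
    g': "comp.cf (\<lambda>p. g' (fst p) (snd p))" "\<And>x. \<forall>\<^sub>F s in sequentially. g' x s = g x"
    unfolding limit_funs_def by blast
  note comp_f' = comp.cf_comp2[of f', OF f'(1)] and comp_g' = comp.cf_comp2[of g', OF g'(1)]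
  have "\<forall>\<^sub>F s in sequentially. f' (g' x s) s = f (g x)" for x
    using g'(2)[of x] f'(2)[of "g x"] by eventually_elim simp
  then show "(\<lambda>x. f (g x)) \<in> limit_funs"
    by (rule limit_funsI[rotated]) (intro cf_intros comp_f' comp_g')
  have "\<forall>\<^sub>F s in sequentially. prod_encode (f' x s, g' x s) = prod_encode (f x, g x)" for x
    using g'(2)[of x] f'(2)[of x] by eventually_elim simp
  then show "(\<lambda>x. prod_encode (f x, g x)) \<in> limit_funs"
    by (rule limit_funsI[rotated]) (intro cf_intros comp_f' comp_g')
  have "\<forall>\<^sub>F s in sequentially. rec_nat (f' x s) (\<lambda>i y. g' (prod_encode (x, prod_encode (i, y))) s) n
      = rec_nat (f x) (\<lambda>i y. g (prod_encode (x, prod_encode (i, y)))) n" (is "\<forall>\<^sub>F s in _. ?L s n = ?R n") for x n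
  proof (induction n)
    case 0
    show ?case using f'(2)[of x] by simp
  next
    case (Suc n)
    from this g'(2)[of "prod_encode (x, prod_encode (n, ?R n))"] show ?case
      by eventually_elim simp
  qed
  then show "(\<lambda>p. rec_nat (f (\<pi>\<^sub>1 p)) (\<lambda>i y. g (prod_encode (\<pi>\<^sub>1 p, prod_encode (i, y)))) (\<pi>\<^sub>2 p)) \<in> limit_funs"
    by (rule limit_funsI[rotated]) (intro cf_intros comp_f' comp_g')
next
  fix f assume "f \<in> limit_funs" and ex: "\<And>x. \<exists>n. f (prod_encode (x, n)) = 0"
  then obtain f' where
    f': "comp.cf (\<lambda>p. f' (fst p) (snd p))" "\<And>x. \<forall>\<^sub>F s in sequentially. f' x s = f x"
    unfolding limit_funs_def by blast
  note comp_f' = comp.cf_comp2[of f', OF f'(1)]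
  show "(\<lambda>x. LEAST n. f (prod_encode (x, n)) = 0) \<in> limit_funs"
  \<comment> \<open>The alternative \<open>n = s\<close> keeps the search at stage \<open>s\<close>
    bounded. It does no harm once \<open>s\<close> exceeds the true value and the approximation has
    settled up to that value.\<close>
  proof (rule limit_funsI[where g = "\<lambda>x s. LEAST n. f' (prod_encode (x, n)) s = 0 \<or> n = s"])
    show "comp.cf (\<lambda>p. LEAST n. f' (prod_encode (fst p, n)) (snd p) = 0 \<or> n = snd p)"
    proof (rule comp.cf_bounded_Least[where b = snd])
      show "comp.cf (\<lambda>p. f' (prod_encode (fst (fst p), snd p)) (snd (fst p)) = 0 \<or> snd p = snd (fst p))"
        by (intro cf_intros comp_f')
    qed (auto intro: comp.cf_snd comp.cf_id)
  next
    fix x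
    define N where "N = (LEAST n. f (prod_encode (x, n)) = 0)"
    have N: "f (prod_encode (x, N)) = 0" "\<And>n. n < N \<Longrightarrow> f (prod_encode (x, n)) \<noteq> 0"
      using LeastI_ex[OF ex[of x]] not_less_Least unfolding N_def by blast+
    have "\<forall>\<^sub>F s in sequentially. \<forall>n\<in>{..N}. f' (prod_encode (x, n)) s = f (prod_encode (x, n))"
      by (intro eventually_ball_finite ballI f'(2)) simp
    then have "\<forall>\<^sub>F s in sequentially. (LEAST n. f' (prod_encode (x, n)) s = 0 \<or> n = s) = N"
      using eventually_gt_at_top[of N]
    proof eventually_elim
      case (elim s)
      show ?case
      proof (rule Least_equality)
        show "f' (prod_encode (x, N)) s = 0 \<or> N = s" using elim N by simp
        fix n assume "f' (prod_encode (x, n)) s = 0 \<or> n = s"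
        then show "N \<le> n" using elim N(2)[of n] by (cases "n < N") auto
      qed
    qed
    then show "\<forall>\<^sub>F s in sequentially. (LEAST n. f' (prod_encode (x, n)) s = 0 \<or> n = s)
        = (LEAST n. f (prod_encode (x, n)) = 0)" by (simp add: N_def)
  qed
qed

section \<open>Finite injury\<close>

text \<open>
  \<open>c\<close> is a strategy's commitment and \<open>h\<close> the object under construction, which is only ever extended.
  \<open>G c s\<close> is the guess, at stage \<open>s\<close>, about the question posed by \<open>c\<close>. The construction keeps a stack of
  commitments, each recorded with the guess on which it rests and the stage of its creation. A stage
  removes the commitments whose guess has changed, and searches for a \<open>Good\<close> new one on top.
\<close>

locale finite_injury = rec_class +
  fixes G :: "'c :: enc \<Rightarrow> nat \<Rightarrow> 'v :: enc"
    and Good :: "'c \<Rightarrow> 'v \<Rightarrow> 'h :: enc \<Rightarrow> 'c \<Rightarrow> 'h \<Rightarrow> bool"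
    and c\<^sub>0 :: 'c and h\<^sub>0 :: 'h
    and Inv :: "'c \<Rightarrow> 'h \<Rightarrow> bool"
    and le :: "'c \<Rightarrow> 'c \<Rightarrow> bool"
    and Tr :: "'c \<Rightarrow> bool"
  assumes cf_G: "cf (\<lambda>p. G (fst p) (snd p))"
    and cf_Good: "cf (\<lambda>p. Good (fst p) (fst (snd p)) (fst (snd (snd p))) (fst (snd (snd (snd p))))
      (snd (snd (snd (snd p)))))"
    and cf_dec_c: "cf (dec :: nat \<Rightarrow> 'c)" and cf_dec_h: "cf (dec :: nat \<Rightarrow> 'h)"
    and le_refl: "le c c"
    and le_trans: "le c d \<Longrightarrow> le d e \<Longrightarrow> le c e"
    and Inv_init: "Inv c\<^sub>0 h\<^sub>0"
    and Good_Inv: "Inv c h \<Longrightarrow> Good c v h c' h' \<Longrightarrow> Inv c' h'"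
    and Good_le: "Inv c h \<Longrightarrow> Good c v h c' h' \<Longrightarrow> le c c'"
    and le_Inv: "le d c \<Longrightarrow> Inv d h \<Longrightarrow> Inv c h \<Longrightarrow> Good c v h c' h' \<Longrightarrow> Inv d h'"
    and Tr_init: "Tr c\<^sub>0"
    and Tr_guess: "Tr c \<Longrightarrow> \<exists>v. (\<forall>\<^sub>F s in sequentially. G c s = v) \<and>
      (\<forall>h. Inv c h \<longrightarrow> (\<exists>c' h'. Good c v h c' h') \<and> (\<forall>c' h'. Good c v h c' h' \<longrightarrow> Tr c'))"
begin

section \<open>The stack and a single stage\<close>

definition current :: "('v \<times> 'c \<times> nat) list \<Rightarrow> 'c" where
  "current st = (if st = [] then c\<^sub>0 else fst (snd (hd st)))"

text \<open>An entry rests on the guess about the commitment directly below it, hence the shift by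
  one. Indexing by \<open>drop\<close> and \<open>hd\<close> stays within the computability
  rules.\<close>

definition ok :: "nat \<Rightarrow> ('v \<times> 'c \<times> nat) list \<Rightarrow> bool" where
  "ok s st \<longleftrightarrow> (\<forall>i<length st. G (current (drop (Suc i) st)) s = fst (hd (drop i st)))"

definition pop :: "nat \<Rightarrow> ('v \<times> 'c \<times> nat) list \<Rightarrow> ('v \<times> 'c \<times> nat) list" where
  "pop s st = drop (LEAST i. ok s (drop i st)) st"

definition cand :: "'c \<Rightarrow> 'v \<Rightarrow> 'h \<Rightarrow> nat \<Rightarrow> bool" where
  "cand c v h n \<longleftrightarrow> Good c v h (fst (dec n :: 'c \<times> 'h)) (snd (dec n :: 'c \<times> 'h))"

text \<open>The alternative \<open>n = s\<close> makes the search finite at each stage;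
  \<open>push\<close> therefore tests again whether the result is a candidate.\<close>

definition least_cand :: "'c \<Rightarrow> 'v \<Rightarrow> 'h \<Rightarrow> nat \<Rightarrow> nat" where
  "least_cand c v h s = (LEAST n. cand c v h n \<or> n = s)"

definition push :: "nat \<Rightarrow> 'c \<Rightarrow> 'v \<Rightarrow> ('v \<times> 'c \<times> nat) list \<Rightarrow> 'h \<Rightarrow> nat \<Rightarrow> ('v \<times> 'c \<times> nat) list \<times> 'h" where
  "push s c v st h n = (if cand c v h n then ((v, fst (dec n :: 'c \<times> 'h), s) # st, snd (dec n :: 'c \<times> 'h)) else (st, h))"

definition act :: "nat \<Rightarrow> ('v \<times> 'c \<times> nat) list \<Rightarrow> 'h \<Rightarrow> ('v \<times> 'c \<times> nat) list \<times> 'h" where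
  "act s st h = push s (current st) (G (current st) s) st h (least_cand (current st) (G (current st) s) h s)"

definition state :: "nat \<Rightarrow> ('v \<times> 'c \<times> nat) list \<times> 'h" where
  "state = rec_nat ([], h\<^sub>0) (\<lambda>s x. act s (pop s (fst x)) (snd x))"

abbreviation S :: "nat \<Rightarrow> ('v \<times> 'c \<times> nat) list" where "S s \<equiv> fst (state s)"

definition H :: "nat \<Rightarrow> 'h" where "H s = snd (state s)"

lemma cf_current: "cf st \<Longrightarrow> cf (\<lambda>x. current (st x))"
  unfolding current_def by (intro cf_intros)

lemma cf_ok: "cf s \<Longrightarrow> cf st \<Longrightarrow> cf (\<lambda>x. ok (s x) (st x))"
proof (rule cf_comp2[of ok])
  show "cf (\<lambda>p. ok (fst p) (snd p))"
    unfolding ok_def by (intro cf_intros cf_comp2[of G, OF cf_G] cf_current)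
qed

lemma ok_Nil: "ok s []"
  by (simp add: ok_def)

lemma cf_pop: "cf s \<Longrightarrow> cf st \<Longrightarrow> cf (\<lambda>x. pop (s x) (st x))"
proof (rule cf_comp2[of pop])
  have "cf (\<lambda>p. LEAST i. ok (fst p) (drop i (snd p)))"
  proof (rule cf_bounded_Least[where b = "\<lambda>p. length (snd p)"])
    show "cf (\<lambda>p. ok (fst (fst p)) (drop (snd p) (snd (fst p))))" by (intro cf_intros cf_ok)
    show "cf (\<lambda>p. length (snd p))" by (intro cf_intros)
    show "\<exists>n\<le>length (snd p). ok (fst p) (drop n (snd p))" for p
      by (rule exI[of _ "length (snd p)"]) (simp add: ok_Nil)
  qed
  then show "cf (\<lambda>p. pop (fst p) (snd p))"
    unfolding pop_def by (intro cf_intros)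
qed

lemma cf_Good5: "cf c \<Longrightarrow> cf v \<Longrightarrow> cf h \<Longrightarrow> cf c' \<Longrightarrow> cf h' \<Longrightarrow> cf (\<lambda>x. Good (c x) (v x) (h x) (c' x) (h' x))"
  using cf_comp[OF cf_Good, of "\<lambda>x. (c x, v x, h x, c' x, h' x)"] by (simp add: cf_Pair)

lemma cf_dec_ch: "cf n \<Longrightarrow> cf (\<lambda>x. dec (n x) :: 'c \<times> 'h)"
  by (rule cf_comp[OF cf_dec_prod[OF cf_dec_c cf_dec_h]])

lemma cf_cand: "cf c \<Longrightarrow> cf v \<Longrightarrow> cf h \<Longrightarrow> cf n \<Longrightarrow> cf (\<lambda>x. cand (c x) (v x) (h x) (n x))"
  unfolding cand_def by (intro cf_Good5 cf_fst cf_snd cf_dec_ch)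

lemma cf_least_cand: "cf c \<Longrightarrow> cf v \<Longrightarrow> cf h \<Longrightarrow> cf s \<Longrightarrow> cf (\<lambda>x. least_cand (c x) (v x) (h x) (s x))"
proof -
  have "cf (\<lambda>p :: 'c \<times> 'v \<times> 'h \<times> nat. LEAST n. cand (fst p) (fst (snd p)) (fst (snd (snd p))) n \<or> n = snd (snd (snd p)))"
  proof (rule cf_bounded_Least[where b = "\<lambda>p. snd (snd (snd p))"])
    show "cf (\<lambda>p :: ('c \<times> 'v \<times> 'h \<times> nat) \<times> nat. cand (fst (fst p)) (fst (snd (fst p)))
        (fst (snd (snd (fst p)))) (snd p) \<or> snd p = snd (snd (snd (fst p))))"
      by (intro cf_intros cf_cand)
  qed (auto intro!: cf_intros)
  moreover assume "cf c" "cf v" "cf h" "cf s"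
  then have "cf (\<lambda>x. (c x, v x, h x, s x))" by (intro cf_intros)
  ultimately show ?thesis
    using cf_comp unfolding least_cand_def by fastforce
qed

lemma cf_push: "cf s \<Longrightarrow> cf c \<Longrightarrow> cf v \<Longrightarrow> cf st \<Longrightarrow> cf h \<Longrightarrow> cf n \<Longrightarrow>
    cf (\<lambda>x. push (s x) (c x) (v x) (st x) (h x) (n x))"
  unfolding push_def by (intro cf_intros cf_cand cf_dec_ch)

lemma cf_act: "cf s \<Longrightarrow> cf st \<Longrightarrow> cf h \<Longrightarrow> cf (\<lambda>x. act (s x) (st x) (h x))"
  unfolding act_def by (intro cf_push cf_least_cand cf_current cf_comp2[of G, OF cf_G])

lemma cf_state: "cf state"
proof -
  have "cf (\<lambda>s. rec_nat ([], h\<^sub>0) (\<lambda>s x. act s (pop s (fst x)) (snd x)) s)"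
    by (intro cf_intros cf_act cf_pop)
  then show ?thesis by (simp add: state_def)
qed

lemma cf_H: "cf H"
  unfolding H_def using cf_snd[OF cf_state] .

lemma state_0: "S 0 = []" "H 0 = h\<^sub>0"
  by (simp_all add: state_def H_def)

lemma state_Suc: "state (Suc s) = act s (pop s (S s)) (H s)"
  by (simp add: state_def H_def)

text \<open>The waiting case records that no good pair has a code up to \<open>s\<close>. As this
  bound grows with the stages, waiting forever is impossible when a good pair exists for a fixed
  object.\<close>

lemma stage_cases:
  obtains (wait) "S (Suc s) = pop s (S s)" "H (Suc s) = H s"
      "\<And>c' h'. enc (c', h') \<le> s \<Longrightarrow> \<not> Good (current (pop s (S s))) (G (current (pop s (S s))) s) (H s) c' h'"
  | (push) c' where "S (Suc s) = (G (current (pop s (S s))) s, c', s) # pop s (S s)"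
      "Good (current (pop s (S s))) (G (current (pop s (S s))) s) (H s) c' (H (Suc s))"
proof -
  let ?st = "pop s (S s)"
  let ?c = "current ?st"
  let ?v = "G ?c s"
  let ?n = "least_cand ?c ?v (H s) s"
  show thesis
  proof (cases "cand ?c ?v (H s) ?n")
    case True
    then have "state (Suc s) = ((?v, fst (dec ?n :: 'c \<times> 'h), s) # ?st, snd (dec ?n :: 'c \<times> 'h))"
      by (simp add: state_Suc act_def push_def)
    with True show thesis by (intro push[of "fst (dec ?n :: 'c \<times> 'h)"]) (simp_all add: H_def cand_def)
  next
    case False
    then have "state (Suc s) = (?st, H s)" by (simp add: state_Suc act_def push_def)
    moreover have "\<not> Good ?c ?v (H s) c' h'" if "enc (c', h') \<le> s" for c' h'
    proof
      assume "Good ?c ?v (H s) c' h'"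
      then have "cand ?c ?v (H s) (enc (c', h'))" by (simp add: cand_def)
      then have "cand ?c ?v (H s) ?n"
        unfolding least_cand_def
        by (smt (verit) LeastI Least_le le_antisym that)
      with False show False by simp
    qed
    ultimately show thesis by (intro wait) (simp_all add: H_def)
  qed
qed

lemma ok_pop: "ok s (pop s st)"
  unfolding pop_def by (rule LeastI[of _ "length st"]) (simp add: ok_Nil)

lemma suffix_pop: "suffix (pop s st) st"
  by (simp add: pop_def suffix_drop)

lemma pop_maximal: "suffix \<sigma> st \<Longrightarrow> ok s \<sigma> \<Longrightarrow> suffix \<sigma> (pop s st)"
proof -
  assume "suffix \<sigma> st" and ok: "ok s \<sigma>"
  then obtain i where i: "\<sigma> = drop i st" by (metis append_eq_conv_conj suffixE)
  then have "(LEAST i. ok s (drop i st)) \<le> i" using ok by (intro Least_le) simp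
  then show ?thesis
    unfolding i pop_def by (metis add.commute drop_drop le_iff_add suffix_drop)
qed

lemma ok_Cons: "ok s ((v, c, r) # st) \<longleftrightarrow> ok s st \<and> G (current st) s = v"
  unfolding ok_def by (auto simp: less_Suc_eq_0_disj)

lemma ok_suffix: "suffix \<sigma> st \<Longrightarrow> ok s st \<Longrightarrow> ok s \<sigma>"
proof (induction st)
  case (Cons e st)
  then show ?case by (cases e) (auto simp: suffix_Cons ok_Cons)
qed simp

text \<open>The stage stored in an entry recovers the object before and after its creation, so that
  \<open>Good\<close> can still be stated when \<open>H\<close> has grown further.\<close>

primrec wf_stack :: "('v \<times> 'c \<times> nat) list \<Rightarrow> bool" where
  "wf_stack [] = True"
| "wf_stack (e # st) \<longleftrightarrow> wf_stack st \<and> (\<forall>e'\<in>set st. snd (snd e') < snd (snd e)) \<and>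
    Inv (current st) (H (snd (snd e))) \<and>
    Good (current st) (fst e) (H (snd (snd e))) (fst (snd e)) (H (Suc (snd (snd e))))"

lemma wf_stack_suffix: "suffix \<sigma> st \<Longrightarrow> wf_stack st \<Longrightarrow> wf_stack \<sigma>"
  by (induction st) (auto simp: suffix_Cons)

lemma current_Cons [simp]: "current (e # st) = fst (snd e)"
  by (simp add: current_def)

lemma wf_stack_le: "suffix \<sigma> st \<Longrightarrow> wf_stack st \<Longrightarrow> le (current \<sigma>) (current st)"
proof (induction st)
  case (Cons e st)
  show ?case
  proof (cases "\<sigma> = e # st")
    case False
    with Cons.prems have "suffix \<sigma> st" by (auto simp: suffix_Cons)
    with Cons show ?thesis by (auto intro: le_trans Good_le)
  qed (simp add: le_refl)
qed (simp add: le_refl)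

text \<open>The invariant is needed for every suffix and not only for the top, because each suffix
  may become the whole stack again. \<open>le_Inv\<close> carries it through the actions of
  commitments further up.\<close>

lemma stack_inv:
  "wf_stack (S s) \<and> (\<forall>e\<in>set (S s). snd (snd e) < s) \<and> (\<forall>\<sigma>. suffix \<sigma> (S s) \<longrightarrow> Inv (current \<sigma>) (H s))"
proof (induction s)
  case 0
  then show ?case by (simp add: state_0 current_def Inv_init)
next
  case (Suc s)
  define st where "st = pop s (S s)"
  have suf: "suffix st (S s)" by (simp add: st_def suffix_pop)
  have wf: "wf_stack st" using suf Suc wf_stack_suffix by blast
  have less: "\<forall>e\<in>set st. snd (snd e) < s" using suf Suc by (auto simp: suffix_def)
  have inv: "Inv (current \<sigma>) (H s)" if "suffix \<sigma> st" for \<sigma>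
    using Suc suf that suffix_order.trans by blast
  show ?case
  proof (cases rule: stage_cases[of s])
    case wait
    then show ?thesis using wf less inv by (auto simp flip: st_def)
  next
    case (push c')
    have "Inv (current \<sigma>) (H (Suc s))" if "suffix \<sigma> (S (Suc s))" for \<sigma>
    proof (cases "suffix \<sigma> st")
      case True
      from le_Inv[OF wf_stack_le[OF True wf] inv[OF True] inv[OF suffix_order.refl]] push(2)
      show ?thesis by (simp add: st_def)
    next
      case False
      then have "\<sigma> = S (Suc s)" using that push(1) by (auto simp: st_def suffix_Cons)
      then show ?thesis
        using push Good_Inv[OF inv[OF suffix_order.refl]] by (auto simp: st_def)
    qed
    then show ?thesis
      using push wf less inv[OF suffix_order.refl] by (auto simp: st_def)
  qed
qed

section \<open>The true path\<close>

definition settled :: "('v \<times> 'c \<times> nat) list \<Rightarrow> nat \<Rightarrow> bool" where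
  "settled \<sigma> t \<longleftrightarrow> wf_stack \<sigma> \<and> Tr (current \<sigma>) \<and> (\<forall>s\<ge>t. suffix \<sigma> (S s))"

text \<open>This is what the creation stages are for: a suffix present before and after a stage
  cannot have been popped and rebuilt in between, since a rebuilt entry would bear the stage
  \<open>s\<close>, while those of \<open>\<sigma>\<close> bear smaller ones.\<close>

lemma settled_pop:
  assumes "settled \<sigma> t" "s \<ge> t"
  shows "suffix \<sigma> (pop s (S s))"
proof -
  have Suc: "suffix \<sigma> (S (Suc s))" and s: "suffix \<sigma> (S s)"
    using assms by (auto simp: settled_def)
  show ?thesis
  proof (cases rule: stage_cases[of s])
    case wait
    then show ?thesis using Suc by simp
  next
    case (push c')
    have "\<forall>e\<in>set \<sigma>. snd (snd e) < s" using s stack_inv[of s] by (auto simp: suffix_def)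
    with Suc push(1) show ?thesis by (auto simp: suffix_Cons)
  qed
qed

text \<open>Once the guess about \<open>\<sigma>\<close> has settled on \<open>v\<close>, an entry
  directly above \<open>\<sigma>\<close> survives a pop only if it rests on \<open>v\<close>, and
  then it survives forever. If none ever appeared, every pop would leave exactly
  \<open>\<sigma>\<close>, the object would be frozen, and the growing search would reach a good
  extension of it.\<close>

lemma settled_Cons:
  assumes \<sigma>: "settled \<sigma> t"
  shows "\<exists>v c r t'. (\<forall>\<^sub>F s in sequentially. G (current \<sigma>) s = v) \<and> settled ((v, c, r) # \<sigma>) t'"
proof -
  have "Tr (current \<sigma>)" using \<sigma> by (simp add: settled_def)
  then obtain v where v: "\<forall>\<^sub>F s in sequentially. G (current \<sigma>) s = v"
    and good: "\<And>h. Inv (current \<sigma>) h \<Longrightarrow> \<exists>c' h'. Good (current \<sigma>) v h c' h'"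
    and true: "\<And>h c' h'. Inv (current \<sigma>) h \<Longrightarrow> Good (current \<sigma>) v h c' h' \<Longrightarrow> Tr c'"
    using Tr_guess by blast
  obtain s\<^sub>0 where s\<^sub>0: "\<And>s. s \<ge> s\<^sub>0 \<Longrightarrow> G (current \<sigma>) s = v"
    using v by (auto simp: eventually_sequentially)
  define t\<^sub>1 where "t\<^sub>1 = max t s\<^sub>0"
  have t\<^sub>1: "suffix \<sigma> (S s)" "suffix \<sigma> (pop s (S s))" "ok s \<sigma>" "G (current \<sigma>) s = v" if "s \<ge> t\<^sub>1" for s
  proof -
    have s: "s \<ge> t" "s \<ge> s\<^sub>0" using that by (auto simp: t\<^sub>1_def)
    show "suffix \<sigma> (S s)" using \<sigma> s by (simp add: settled_def)
    show "suffix \<sigma> (pop s (S s))" using settled_pop \<sigma> s by simp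
    then show "ok s \<sigma>" using ok_pop ok_suffix by blast
    show "G (current \<sigma>) s = v" using s\<^sub>0 s by simp
  qed
  have "\<exists>s\<ge>t\<^sub>1. \<exists>c r. suffix ((v, c, r) # \<sigma>) (S s)"
  proof (rule ccontr)
    assume none: "\<not> ?thesis"
    have pop: "pop s (S s) = \<sigma>" if "s \<ge> t\<^sub>1" for s
    proof (rule ccontr)
      assume "pop s (S s) \<noteq> \<sigma>"
      with t\<^sub>1(2)[OF that] obtain zs where "pop s (S s) = zs @ \<sigma>" "zs \<noteq> []" by (auto simp: suffix_def)
      then obtain e where e: "suffix (e # \<sigma>) (pop s (S s))"
        by (metis append.assoc append_Cons append_Nil append_butlast_last_id suffixI)
      obtain v' c r where [simp]: "e = (v', c, r)" by (cases e)
      have "ok s (e # \<sigma>)" using e ok_pop ok_suffix by blast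
      then have "v' = v" using t\<^sub>1(4)[OF that] by (simp add: ok_Cons)
      moreover have "suffix (e # \<sigma>) (S s)" using e suffix_pop suffix_order.trans by blast
      ultimately show False using none that by auto
    qed
    have wait: "H (Suc s) = H s" "enc (c', h') \<le> s \<Longrightarrow> \<not> Good (current \<sigma>) v (H s) c' h'" if "s \<ge> t\<^sub>1" for s c' h'
      using stage_cases[of s "H (Suc s) = H s \<and> (enc (c', h') \<le> s \<longrightarrow> \<not> Good (current \<sigma>) v (H s) c' h')"]
        none that pop[OF that] t\<^sub>1(4)[OF that] suffix_order.refl le_SucI by metis+
    have const: "H s = H t\<^sub>1" if "s \<ge> t\<^sub>1" for s
      using that by (induction rule: dec_induct) (simp_all add: wait)
    have "Inv (current \<sigma>) (H t\<^sub>1)" using stack_inv t\<^sub>1(1) by blast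
    then obtain c' h' where "Good (current \<sigma>) v (H t\<^sub>1) c' h'" using good by blast
    then show False
      using wait(2)[of "max t\<^sub>1 (enc (c', h'))" c' h'] const[of "max t\<^sub>1 (enc (c', h'))"] by simp
  qed
  then obtain t' c r where t': "t' \<ge> t\<^sub>1" "suffix ((v, c, r) # \<sigma>) (S t')" by blast
  have "suffix ((v, c, r) # \<sigma>) (S s)" if "s \<ge> t'" for s
    using that
  proof (induction rule: dec_induct)
    case base
    show ?case by (rule t'(2))
  next
    case (step s)
    then have "s \<ge> t\<^sub>1" using t' by simp
    then have "ok s ((v, c, r) # \<sigma>)" using t\<^sub>1 by (simp add: ok_Cons)
    then have "suffix ((v, c, r) # \<sigma>) (pop s (S s))" using pop_maximal step.IH by blast
    then show ?case
      by (cases rule: stage_cases[of s]) (auto intro: suffix_ConsI)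
  qed
  moreover have "wf_stack ((v, c, r) # \<sigma>)" using stack_inv t'(2) wf_stack_suffix by blast
  \<comment> \<open>The entry may be older than \<open>t\<^sub>1\<close>; its recorded stage
    \<open>r\<close> supplies the good step that produced it.\<close>
  moreover from this have "Tr c" using true[of "H r" c "H (Suc r)"] by simp
  ultimately have "settled ((v, c, r) # \<sigma>) t'" by (simp add: settled_def)
  with v show ?thesis by blast
qed

text \<open>Iterating \<open>settled_Cons\<close> from the empty stack yields the commitments that
  are never removed. Their creation stages increase because every entry is younger than those below
  it.\<close>

theorem true_path:
  obtains cs :: "nat \<Rightarrow> 'c" and vs :: "nat \<Rightarrow> 'v" and r :: "nat \<Rightarrow> nat"
  where "cs 0 = c\<^sub>0" "strict_mono r"
    "\<And>j. \<forall>\<^sub>F s in sequentially. G (cs j) s = vs j"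
    "\<And>j. Good (cs j) (vs j) (H (r j)) (cs (Suc j)) (H (Suc (r j)))"
    "\<And>j. Inv (cs j) (H (r j))" "\<And>j. Tr (cs j)" "\<And>j. \<forall>\<^sub>F s in sequentially. Inv (cs j) (H s)"
proof -
  have "\<exists>f. \<forall>j. (length (f j) = j \<and> (\<exists>t. settled (f j) t)) \<and>
      (\<exists>v c r. (\<forall>\<^sub>F s in sequentially. G (current (f j)) s = v) \<and> f (Suc j) = (v, c, r) # f j)"
  proof (rule dependent_nat_choice)
    have "settled [] 0" by (simp add: settled_def current_def Tr_init)
    then show "\<exists>\<sigma>. length \<sigma> = 0 \<and> (\<exists>t. settled \<sigma> t)" by blast
  next
    fix \<sigma> :: "('v \<times> 'c \<times> nat) list" and j
    assume "length \<sigma> = j \<and> (\<exists>t. settled \<sigma> t)"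
    then show "\<exists>\<sigma>'. (length \<sigma>' = Suc j \<and> (\<exists>t. settled \<sigma>' t)) \<and>
        (\<exists>v c r. (\<forall>\<^sub>F s in sequentially. G (current \<sigma>) s = v) \<and> \<sigma>' = (v, c, r) # \<sigma>)"
      using settled_Cons by (metis length_Cons)
  qed
  then obtain f where f: "\<forall>j. (length (f j) = j \<and> (\<exists>t. settled (f j) t)) \<and>
      (\<exists>v c r. (\<forall>\<^sub>F s in sequentially. G (current (f j)) s = v) \<and> f (Suc j) = (v, c, r) # f j)" ..
  have len: "length (f j) = j" and settled: "\<exists>t. settled (f j) t"
    and step: "\<exists>v c r. (\<forall>\<^sub>F s in sequentially. G (current (f j)) s = v) \<and> f (Suc j) = (v, c, r) # f j" for j
    using f by blast+
  have hd: "f (Suc j) = hd (f (Suc j)) # f j" "\<forall>\<^sub>F s in sequentially. G (current (f j)) s = fst (hd (f (Suc j)))" for j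
    using step[of j] by auto
  define r where "r j = snd (snd (hd (f (Suc j))))" for j
  have wf: "wf_stack (f j)" "Tr (current (f j))" for j
    using settled[of j] by (auto simp: settled_def)
  have current: "current (f (Suc j)) = fst (snd (hd (f (Suc j))))" for j
    using hd(1)[of j] by (metis current_Cons)
  have good: "Inv (current (f j)) (H (r j))"
    "Good (current (f j)) (fst (hd (f (Suc j)))) (H (r j)) (current (f (Suc j))) (H (Suc (r j)))"
    "\<forall>e\<in>set (f j). snd (snd e) < r j" for j
    using wf(1)[of "Suc j"] hd(1)[of j] unfolding r_def current by (metis wf_stack.simps(2))+
  have "r j < r (Suc j)" for j
  proof -
    have "hd (f (Suc j)) \<in> set (f (Suc j))" using hd(1)[of j] by (metis list.set_intros(1))
    with good(3)[of "Suc j"] show ?thesis unfolding r_def by blast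
  qed
  then have "strict_mono r" by (simp add: strict_mono_Suc_iff)
  moreover have "\<forall>\<^sub>F s in sequentially. Inv (current (f j)) (H s)" for j
    using settled[of j] stack_inv unfolding settled_def eventually_sequentially by blast
  moreover have "current (f 0) = c\<^sub>0" using len[of 0] by (simp add: current_def)
  ultimately show thesis
    using that[of "\<lambda>j. current (f j)" r "\<lambda>j. fst (hd (f (Suc j)))"] hd(2) good wf by blast
qed

lemma H_Suc: "H (Suc s) = H s \<or> (\<exists>c v c'. Inv c (H s) \<and> Good c v (H s) c' (H (Suc s)))"
proof (cases rule: stage_cases[of s])
  case (push c')
  then show ?thesis using stack_inv[of s] suffix_pop by blast
qed simp

end

section \<open>From a limit computable list of labels to a computable order\<close>

text \<open>A label names a block by a rational and a place in it by an integer; \<open>0\<close> is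
  the place of the base point.\<close>

definition label_less :: "rat \<times> int \<Rightarrow> rat \<times> int \<Rightarrow> bool" where
  "label_less x y \<longleftrightarrow> fst x < fst y \<or> fst x = fst y \<and> snd x < snd y"

lemma label_less_irrefl [simp]: "\<not> label_less x x"
  by (simp add: label_less_def)

lemma label_less_total: "label_less x y \<or> x = y \<or> label_less y x"
  by (auto simp: label_less_def prod_eq_iff)

lemma label_less_trans: "label_less x y \<Longrightarrow> label_less y z \<Longrightarrow> label_less x z"
  by (auto simp: label_less_def)

lemma label_less_asym: "label_less x y \<Longrightarrow> \<not> label_less y x"
  by (auto simp: label_less_def)

text \<open>The choices of rationals in both constructions come down to this: an open interval is
  infinite, so a finite set \<open>Z\<close> can be avoided, and an empty side imposes no
  bound.\<close>

lemma finite_sets_separated: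
  fixes X Y Z :: "rat set"
  assumes fin: "finite X" "finite Y" "finite Z" and less: "\<And>x y. x \<in> X \<Longrightarrow> y \<in> Y \<Longrightarrow> x < y"
  shows "\<exists>q. (\<forall>x\<in>X. x < q) \<and> (\<forall>y\<in>Y. q < y) \<and> q \<notin> Z"
proof -
  define a where "a = (if X = {} then (if Y = {} then 0 else Min Y - 1) else Max X)"
  define b where "b = (if Y = {} then a + 1 else Min Y)"
  have "a < b"
  proof (cases "Y = {}")
    case False
    have "Min Y - 1 < Min Y" by linarith
    then show ?thesis using False fin less by (simp only: a_def b_def if_False split: if_splits) auto
  qed (simp add: b_def)
  then have "infinite ({a<..<b} - Z)"
    using fin by (simp add: infinite_Ioo)
  then obtain q where "q \<in> {a<..<b} - Z"
    by (metis ex_in_conv finite.emptyI)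
  moreover have "x \<le> a" if "x \<in> X" for x
    using that fin by (auto simp: a_def)
  moreover have "b \<le> y" if "y \<in> Y" for y
    using that fin by (auto simp: b_def)
  ultimately show ?thesis by (intro exI[of _ q]) fastforce
qed

lemma finite_set_right_gap:
  fixes a :: rat
  assumes "finite Y" "finite Z"
  shows "\<exists>k. a < k \<and> (\<forall>b\<in>Y. a < b \<longrightarrow> k < b) \<and> k \<notin> Z"
proof -
  have "\<exists>k. (\<forall>x\<in>{a}. x < k) \<and> (\<forall>b\<in>{b \<in> Y. a < b}. k < b) \<and> k \<notin> Z"
    by (rule finite_sets_separated) (use assms in auto)
  then obtain k where "\<forall>x\<in>{a}. x < k" "\<forall>b\<in>{b \<in> Y. a < b}. k < b" "k \<notin> Z" by blast
  then show ?thesis by (intro exI[of _ k]) simp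
qed

lemma finite_set_left_gap:
  fixes a :: rat
  assumes "finite Y" "finite Z"
  shows "\<exists>k. k < a \<and> (\<forall>b\<in>Y. b < a \<longrightarrow> b < k) \<and> k \<notin> Z"
proof -
  have "\<exists>k. (\<forall>b\<in>{b \<in> Y. b < a}. b < k) \<and> (\<forall>x\<in>{a}. k < x) \<and> k \<notin> Z"
    by (rule finite_sets_separated) (use assms in auto)
  then obtain k where "\<forall>b\<in>{b \<in> Y. b < a}. b < k" "\<forall>x\<in>{a}. k < x" "k \<notin> Z" by blast
  then show ?thesis by (intro exI[of _ k]) simp
qed

section \<open>Finite labellings of points, and cuts between them\<close>

type_synonym assoc = "(rat \<times> rat \<times> int) list"

text \<open>An entry \<open>(p, q, k)\<close> gives the point \<open>p\<close> the label
  \<open>(q, k)\<close>.\<close>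

definition order_iso :: "assoc \<Rightarrow> bool" where
  "order_iso A \<longleftrightarrow> (\<forall>x\<in>set A. \<forall>y\<in>set A. fst x < fst y \<longleftrightarrow> label_less (snd x) (snd y))"

definition separated :: "rat list \<Rightarrow> rat \<Rightarrow> rat \<Rightarrow> bool" where
  "separated K a b \<longleftrightarrow> (\<exists>k\<in>set K. a < k \<and> k < b)"

definition cuts :: "assoc \<Rightarrow> rat list \<Rightarrow> bool" where
  "cuts A K \<longleftrightarrow> (\<forall>x\<in>set A. \<forall>y\<in>set A. fst x < fst y \<longrightarrow>
     (separated K (fst x) (fst y) \<longleftrightarrow> fst (snd x) \<noteq> fst (snd y)))"

text \<open>The half of \<open>cuts\<close> that survives while points are being added: new points
  may still lack cuts towards their neighbours, and \<open>add_cuts\<close> supplies them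
  afterwards.\<close>

definition no_cuts :: "assoc \<Rightarrow> rat list \<Rightarrow> bool" where
  "no_cuts A K \<longleftrightarrow> (\<forall>x\<in>set A. \<forall>y\<in>set A. fst (snd x) = fst (snd y) \<longrightarrow> \<not> separated K (fst x) (fst y))"

text \<open>With a label, the whole stretch from it to the base point is present. Hence adding a
  label never inserts a point between two points of one block.\<close>

definition down_closed :: "assoc \<Rightarrow> bool" where
  "down_closed A \<longleftrightarrow> (\<forall>x\<in>set A.
     (0 < snd (snd x) \<longrightarrow> (fst (snd x), snd (snd x) - 1) \<in> set (map snd A)) \<and>
     (snd (snd x) < 0 \<longrightarrow> (fst (snd x), snd (snd x) + 1) \<in> set (map snd A)))"

text \<open>A foreign point inside a block of \<open>A\<close> would have no label compatible with
  the order except one of that block, and so could not be cut off after losing its own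
  label.\<close>

definition contiguous :: "assoc \<Rightarrow> rat list \<Rightarrow> bool" where
  "contiguous A P \<longleftrightarrow> (\<forall>x\<in>set A. \<forall>y\<in>set A. fst (snd x) = fst (snd y) \<longrightarrow>
     (\<forall>p\<in>set P. fst x < p \<and> p < fst y \<longrightarrow> p \<in> set (map fst A)))"

lemma order_iso_eq: "order_iso A \<Longrightarrow> x \<in> set A \<Longrightarrow> y \<in> set A \<Longrightarrow> fst x = fst y \<longleftrightarrow> snd x = snd y"
  unfolding order_iso_def by (metis label_less_irrefl label_less_total less_irrefl linorder_neqE)

lemma order_iso_group_mono:
  "order_iso A \<Longrightarrow> x \<in> set A \<Longrightarrow> y \<in> set A \<Longrightarrow> fst x < fst y \<Longrightarrow> fst (snd x) \<le> fst (snd y)"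
  unfolding order_iso_def label_less_def by fastforce

lemma order_iso_snoc:
  assumes "order_iso A" and "\<And>x. x \<in> set A \<Longrightarrow> fst x < p \<longleftrightarrow> label_less (snd x) w"
    and "\<And>x. x \<in> set A \<Longrightarrow> p < fst x \<longleftrightarrow> label_less w (snd x)"
  shows "order_iso (A @ [(p, w)])"
  using assms by (auto simp: order_iso_def)

lemma down_closed_pos:
  assumes A: "down_closed A" and "(q, k) \<in> snd ` set A" "0 \<le> j" "j \<le> k"
  shows "(q, j) \<in> snd ` set A"
proof -
  have "(q, k - int n) \<in> snd ` set A" if "int n \<le> k" for n
    using that
  proof (induction n)
    case (Suc n)
    then obtain x where "x \<in> set A" "snd x = (q, k - int n)" by force
    with A Suc.prems show ?case unfolding down_closed_def
      by (force simp: algebra_simps)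
  qed (use assms in simp)
  from this[of "nat (k - j)"] assms show ?thesis by simp
qed

lemma down_closed_neg:
  assumes A: "down_closed A" and "(q, k) \<in> snd ` set A" "j \<le> 0" "k \<le> j"
  shows "(q, j) \<in> snd ` set A"
proof -
  have "(q, k + int n) \<in> snd ` set A" if "k + int n \<le> 0" for n
    using that
  proof (induction n)
    case (Suc n)
    then obtain x where "x \<in> set A" "snd x = (q, k + int n)" by force
    with A Suc.prems show ?case unfolding down_closed_def
      by (force simp: algebra_simps)
  qed (use assms in simp)
  from this[of "nat (j - k)"] assms show ?thesis by simp
qed

lemma down_closed_between:
  assumes "down_closed A" "(q, k) \<in> snd ` set A" "(q, l) \<in> snd ` set A" "k \<le> j" "j \<le> l"
  shows "(q, j) \<in> snd ` set A"
  using assms down_closed_pos[of A q l j] down_closed_neg[of A q k j] by (cases "0 \<le> j") auto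

text \<open>A commitment consists of the number of labels read and a labelling; the object consists
  of points and cuts. Each good step labels all points in existence. Apart from \<open>v\<close> it
  introduces only base labels, which are correct for every rational. The last conjunct is
  distinctness of the points in a form covered by the computability rules.\<close>

definition good :: "nat \<times> assoc \<Rightarrow> rat \<times> int \<Rightarrow> rat list \<times> rat list \<Rightarrow> nat \<times> assoc \<Rightarrow> rat list \<times> rat list \<Rightarrow> bool" where
  "good c v h c' h' \<longleftrightarrow> fst c' = Suc (fst c) \<and>
     prefix (snd c) (snd c') \<and> prefix (fst h) (fst h') \<and> (\<forall>k\<in>set (snd h). k \<in> set (snd h')) \<and>
     map fst (snd c') = fst h' \<and> (\<forall>p\<in>set (fst h'). p \<notin> set (snd h')) \<and>
     order_iso (snd c') \<and> cuts (snd c') (snd h') \<and> down_closed (snd c') \<and>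
     v \<in> set (map snd (snd c')) \<and>
     (\<forall>x\<in>set (snd c'). x \<in> set (snd c) \<or> snd x = v \<or> snd (snd x) = 0) \<and>
     (\<forall>i<length (fst h'). hd (drop i (fst h')) \<notin> set (take i (fst h')))"

text \<open>In contrast to \<open>good\<close>, only a prefix of the points is labelled: the others
  were created by commitments above \<open>c\<close>, and stay when these are removed.\<close>

definition inv2 :: "nat \<times> assoc \<Rightarrow> rat list \<times> rat list \<Rightarrow> bool" where
  "inv2 c h \<longleftrightarrow> prefix (map fst (snd c)) (fst h) \<and> distinct (fst h) \<and> set (fst h) \<inter> set (snd h) = {} \<and>
     order_iso (snd c) \<and> cuts (snd c) (snd h) \<and> down_closed (snd c) \<and> contiguous (snd c) (fst h)"

lemma distinct_iff_take: "distinct xs \<longleftrightarrow> (\<forall>i<length xs. hd (drop i xs) \<notin> set (take i xs))"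
proof (induction xs rule: rev_induct)
  case (snoc x xs)
  show ?case by (auto simp: snoc all_conj_distrib less_Suc_eq hd_append)
qed simp

section \<open>Extending a labelling\<close>

lemma order_isoD:
  "order_iso A \<Longrightarrow> x \<in> set A \<Longrightarrow> y \<in> set A \<Longrightarrow> fst x < fst y \<longleftrightarrow> label_less (snd x) (snd y)"
  by (simp add: order_iso_def)

text \<open>This treats the points left behind by removed commitments. By contiguity such a point is
  not inside a block, so the blocks to its left have smaller rationals than those to its right. A
  new rational between them names a block of which the point becomes the base point.\<close>

lemma extend_to_all_positions:
  assumes A: "order_iso A" "contiguous A P" "down_closed A" "no_cuts A K" "prefix (map fst A) P"
    and "distinct P" and n: "length A \<le> n" "n \<le> length P"
  shows "\<exists>A'. prefix A A' \<and> map fst A' = take n P \<and> order_iso A' \<and> contiguous A' P \<and> down_closed A' \<and>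
    no_cuts A' K \<and> (\<forall>x\<in>set A'. x \<in> set A \<or> snd (snd x) = 0 \<and> fst (snd x) \<noteq> fst v)"
  using n
proof (induction n rule: dec_induct)
  case base
  have "map fst A = take (length A) P"
    using A(5) by (auto simp: prefix_def)
  with A show ?case by (intro exI[of _ A]) auto
next
  case (step n)
  then obtain A' where A': "prefix A A'" "map fst A' = take n P" "order_iso A'" "contiguous A' P"
    "down_closed A'" "no_cuts A' K" "\<forall>x\<in>set A'. x \<in> set A \<or> snd (snd x) = 0 \<and> fst (snd x) \<noteq> fst v"
    by auto
  define p where "p = P ! n"
  have n: "n < length P" using step by simp
  have take: "take (Suc n) P = take n P @ [p]" using n by (simp add: p_def take_Suc_conv_app_nth)
  have new: "p \<notin> fst ` set A'"
  proof -
    have "distinct (take (Suc n) P)" using \<open>distinct P\<close> by simp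
    then have "p \<notin> set (map fst A')" unfolding take A'(2) by simp
    then show ?thesis by simp
  qed
  obtain q where q: "\<And>x. x \<in> set A' \<Longrightarrow> fst x < p \<Longrightarrow> fst (snd x) < q"
    "\<And>y. y \<in> set A' \<Longrightarrow> p < fst y \<Longrightarrow> q < fst (snd y)" "q \<noteq> fst v"
  proof -
    have "\<exists>q. (\<forall>x\<in>(fst \<circ> snd) ` {x \<in> set A'. fst x < p}. x < q) \<and>
        (\<forall>y\<in>(fst \<circ> snd) ` {y \<in> set A'. p < fst y}. q < y) \<and> q \<notin> {fst v}"
    proof (rule finite_sets_separated; (elim imageE CollectE conjE)?)
      fix a b x y
      assume ab: "a = (fst \<circ> snd) x" "b = (fst \<circ> snd) y" and xy: "x \<in> set A'" "fst x < p" "y \<in> set A'" "p < fst y"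
      have "fst (snd x) \<le> fst (snd y)" using order_iso_group_mono[OF A'(3) xy(1,3)] xy by simp
      moreover have "fst (snd x) \<noteq> fst (snd y)"
        using A'(4) xy new n unfolding contiguous_def p_def by (metis list.set_map nth_mem)
      ultimately show "a < b" using ab by simp
    qed auto
    then obtain q where q: "\<forall>x\<in>(fst \<circ> snd) ` {x \<in> set A'. fst x < p}. x < q"
        "\<forall>y\<in>(fst \<circ> snd) ` {y \<in> set A'. p < fst y}. q < y" "q \<notin> {fst v}" by blast
    show ?thesis
    proof (rule that)
      show "fst (snd x) < q" if "x \<in> set A'" "fst x < p" for x
        using bspec[OF q(1), of "(fst \<circ> snd) x"] that by simp
      show "q < fst (snd y)" if "y \<in> set A'" "p < fst y" for y
        using bspec[OF q(2), of "(fst \<circ> snd) y"] that by simp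
    qed (use q in simp)
  qed
  have neq: "fst x < p \<or> p < fst x" if "x \<in> set A'" for x
    using that new by (metis image_eqI linorder_neqE)
  have other: "fst (snd x) \<noteq> q" if "x \<in> set A'" for x
    using neq[OF that] q(1,2)[OF that] by auto
  define A2 where "A2 = A' @ [(p, (q, 0))]"
  have iff: "fst x < p \<longleftrightarrow> label_less (snd x) (q, 0)" "p < fst x \<longleftrightarrow> label_less (q, 0) (snd x)" if "x \<in> set A'" for x
    using neq[OF that] q(1,2)[OF that] by (auto simp: label_less_def)
  have "order_iso A2"
    unfolding A2_def using order_iso_snoc[OF A'(3)] iff by blast
  moreover have "contiguous A2 P"
    using A'(4) other unfolding A2_def contiguous_def by (auto dest!: other)
  moreover have "down_closed A2"
    using A'(5) unfolding A2_def down_closed_def by auto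
  moreover have "no_cuts A2 K"
  proof -
    have "(a, q, b) \<notin> set A'" for a b using other by force
    with A'(6) show ?thesis unfolding A2_def no_cuts_def separated_def by auto
  qed
  moreover have "prefix A A2" "map fst A2 = take (Suc n) P"
    using A'(1,2) take by (auto simp: A2_def)
  moreover have "\<forall>x\<in>set A2. x \<in> set A \<or> snd (snd x) = 0 \<and> fst (snd x) \<noteq> fst v"
    using A'(7) q(3) by (auto simp: A2_def)
  ultimately show ?case by blast
qed

text \<open>For \<open>k = 0\<close> down-closure shows that the block \<open>q\<close> has no point
  yet, so any place in the right gap will do. Otherwise the point goes next to its neighbour
  \<open>p\<^sub>0\<close> towards the base, nearer than any other point or cut on that side, so
  that no existing cut separates it from its block.\<close>

lemma insert_position:
  assumes A: "order_iso A" "down_closed A" "no_cuts A K" and new: "(q, k) \<notin> snd ` set A"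
    and disj: "fst ` set A \<inter> set K = {}"
    and v: "k = 0 \<or> 0 < k \<and> (q, k - 1) \<in> snd ` set A \<or> k < 0 \<and> (q, k + 1) \<in> snd ` set A"
  shows "\<exists>p. p \<notin> set K \<and> (\<forall>x\<in>set A. (fst x < p \<longleftrightarrow> label_less (snd x) (q, k)) \<and> (p < fst x \<longleftrightarrow> label_less (q, k) (snd x)) \<and>
    (fst (snd x) = q \<longrightarrow> \<not> separated K (fst x) p \<and> \<not> separated K p (fst x)))"
  using v
proof (elim disjE conjE)
  assume k: "k = 0"
  have noq: "fst (snd x) \<noteq> q" if "x \<in> set A" for x
    using down_closed_between[OF A(2), of q "snd (snd x)" "snd (snd x)" 0]
      down_closed_pos[OF A(2), of q "snd (snd x)" 0] down_closed_neg[OF A(2), of q "snd (snd x)" 0] that new k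
    by (metis image_eqI linear order.refl prod.collapse)
  obtain p where p: "\<And>x. x \<in> set A \<Longrightarrow> label_less (snd x) (q, k) \<Longrightarrow> fst x < p"
    "\<And>y. y \<in> set A \<Longrightarrow> label_less (q, k) (snd y) \<Longrightarrow> p < fst y" "p \<notin> set K"
  proof -
    have "\<exists>p. (\<forall>a\<in>fst ` {x \<in> set A. label_less (snd x) (q, k)}. a < p) \<and>
        (\<forall>b\<in>fst ` {y \<in> set A. label_less (q, k) (snd y)}. p < b) \<and> p \<notin> set K"
      by (rule finite_sets_separated) (auto simp: order_isoD[OF A(1)] dest: label_less_trans intro: order_isoD[OF A(1), THEN iffD2])
    then obtain p where "\<forall>a\<in>fst ` {x \<in> set A. label_less (snd x) (q, k)}. a < p"
      "\<forall>b\<in>fst ` {y \<in> set A. label_less (q, k) (snd y)}. p < b" "p \<notin> set K" by blast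
    then show ?thesis using that[of p] by blast
  qed
  have "label_less (snd x) (q, k) \<or> label_less (q, k) (snd x)" if "x \<in> set A" for x
    using label_less_total[of "snd x" "(q, k)"] noq[OF that] by auto
  then show ?thesis
    using p noq by (intro exI[of _ p]) (metis label_less_asym order_less_imp_not_less)
next
  assume k: "0 < k" "(q, k - 1) \<in> snd ` set A"
  then obtain p\<^sub>0 where p\<^sub>0: "(p\<^sub>0, q, k - 1) \<in> set A" by force
  obtain p where p: "p\<^sub>0 < p" "\<And>b. b \<in> fst ` set A \<union> set K \<Longrightarrow> p\<^sub>0 < b \<Longrightarrow> p < b" "p \<notin> set K"
    using finite_set_right_gap[of "fst ` set A \<union> set K" "set K" p\<^sub>0] by blast
  have notless: "\<not> label_less (q, k) (snd x) \<or> fst (snd x) \<noteq> q" if "x \<in> set A" for x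
    using down_closed_pos[OF A(2), of q "snd (snd x)" k] k that new
    by (auto simp: label_less_def)
  have less_iff: "p < fst x \<longleftrightarrow> p\<^sub>0 < fst x" "fst x < p \<longleftrightarrow> fst x \<le> p\<^sub>0" if "x \<in> set A" for x
    using p(1) p(2)[of "fst x"] that by (force, force)
  have "p\<^sub>0 < fst x \<longleftrightarrow> label_less (q, k - 1) (snd x)" if "x \<in> set A" for x
    using order_isoD[OF A(1) p\<^sub>0 that] by simp
  moreover have "label_less (q, k - 1) (snd x) \<longleftrightarrow> label_less (q, k) (snd x)" "\<not> label_less (q, k) (snd x) \<longleftrightarrow> label_less (snd x) (q, k)"
    if "x \<in> set A" for x
    using notless[OF that] new that by (auto simp: label_less_def)
      (metis image_eqI prod.collapse zle_diff1_eq linorder_not_less nless_le linorder_neqE)+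
  moreover have "\<not> separated K (fst x) p \<and> \<not> separated K p (fst x)" if x: "x \<in> set A" "fst (snd x) = q" for x
  proof -
    have le: "fst x \<le> p\<^sub>0"
      using calculation[OF x(1)] notless[OF x(1)] x by auto
    have "\<not> separated K (fst x) p\<^sub>0" using A(3) x p\<^sub>0 unfolding no_cuts_def by fastforce
    moreover have "p\<^sub>0 \<notin> set K" using p\<^sub>0 disj by force
    ultimately show ?thesis using p le unfolding separated_def
      by (metis Un_iff linorder_neqE order.strict_trans order_less_le_trans order.asym)
  qed
  ultimately show ?thesis
    using less_iff p(3) by (intro exI[of _ p]) (metis linorder_not_less)
next
  assume k: "k < 0" "(q, k + 1) \<in> snd ` set A"
  then obtain p\<^sub>0 where p\<^sub>0: "(p\<^sub>0, q, k + 1) \<in> set A" by force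
  obtain p where p: "p < p\<^sub>0" "\<And>b. b \<in> fst ` set A \<union> set K \<Longrightarrow> b < p\<^sub>0 \<Longrightarrow> b < p" "p \<notin> set K"
    using finite_set_left_gap[of "fst ` set A \<union> set K" "set K" p\<^sub>0] by blast
  have notless: "\<not> label_less (snd x) (q, k) \<or> fst (snd x) \<noteq> q" if "x \<in> set A" for x
    using down_closed_neg[OF A(2), of q "snd (snd x)" k] k that new
    by (auto simp: label_less_def)
  have less_iff: "fst x < p \<longleftrightarrow> fst x < p\<^sub>0" "p < fst x \<longleftrightarrow> p\<^sub>0 \<le> fst x" if "x \<in> set A" for x
    using p(1) p(2)[of "fst x"] that by (force, force)
  have "fst x < p\<^sub>0 \<longleftrightarrow> label_less (snd x) (q, k + 1)" if "x \<in> set A" for x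
    using order_isoD[OF A(1) that p\<^sub>0] by simp
  moreover have "label_less (snd x) (q, k + 1) \<longleftrightarrow> label_less (snd x) (q, k)" "\<not> label_less (snd x) (q, k) \<longleftrightarrow> label_less (q, k) (snd x)"
    if "x \<in> set A" for x
    using notless[OF that] new that by (auto simp: label_less_def)
      (metis image_eqI prod.collapse zless_add1_eq linorder_not_less nless_le linorder_neqE)+
  moreover have "\<not> separated K (fst x) p \<and> \<not> separated K p (fst x)" if x: "x \<in> set A" "fst (snd x) = q" for x
  proof -
    have le: "p\<^sub>0 \<le> fst x"
      using calculation[OF x(1)] notless[OF x(1)] x by auto
    have "\<not> separated K p\<^sub>0 (fst x)" using A(3) x p\<^sub>0 unfolding no_cuts_def by fastforce
    moreover have "p\<^sub>0 \<notin> set K" using p\<^sub>0 disj by force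
    ultimately show ?thesis using p le unfolding separated_def
      by (metis Un_iff linorder_neqE order.strict_trans order_le_less_trans order.asym)
  qed
  ultimately show ?thesis
    using less_iff p(3) by (intro exI[of _ p]) (metis linorder_not_less)
qed

text \<open>One cut just behind the last point of each block is enough. It lies in front of the next
  point and hence never inside a block.\<close>

lemma add_cuts:
  assumes A: "order_iso A" "no_cuts A K"
  shows "\<exists>K'. cuts A (K @ K') \<and> set K' \<inter> fst ` set A = {}"
proof -
  have "\<exists>k. a < k \<and> (\<forall>b\<in>fst ` set A. a < b \<longrightarrow> k < b) \<and> k \<notin> fst ` set A" for a
    by (rule finite_set_right_gap) auto
  then obtain \<kappa> where \<kappa>: "\<And>a. a < \<kappa> a" "\<And>a b. b \<in> fst ` set A \<Longrightarrow> a < b \<Longrightarrow> \<kappa> a < b" "\<And>a. \<kappa> a \<notin> fst ` set A"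
    by metis
  define last where "last x \<longleftrightarrow> (\<forall>y\<in>set A. fst (snd y) = fst (snd x) \<longrightarrow> fst y \<le> fst x)" for x :: "rat \<times> rat \<times> int"
  define K' where "K' = map (\<lambda>x. \<kappa> (fst x)) (filter last A)"
  have sep: "separated (K @ K') (fst x) (fst y) \<longleftrightarrow> fst (snd x) \<noteq> fst (snd y)"
    if xy: "x \<in> set A" "y \<in> set A" "fst x < fst y" for x y
  proof
    assume neq: "fst (snd x) \<noteq> fst (snd y)"
    define X where "X = {z \<in> set A. fst (snd z) = fst (snd x)}"
    have "x \<in> X" using xy by (simp add: X_def)
    moreover have "finite X" by (simp add: X_def)
    ultimately have X: "finite (fst ` X)" "fst ` X \<noteq> {}" by blast+
    then obtain z where z: "z \<in> X" "fst z = Max (fst ` X)" by (metis Max_in imageE)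
    have "last z" unfolding last_def using z X by (auto simp: X_def)
    have "fst x \<le> fst z" using z X xy by (auto simp: X_def)
    have "fst (snd z) < fst (snd y)"
      using order_iso_group_mono[OF A(1) xy] neq z by (auto simp: X_def)
    then have "fst z < fst y" using order_isoD[OF A(1), of z y] z xy by (auto simp: X_def label_less_def)
    then have "fst x < \<kappa> (fst z)" "\<kappa> (fst z) < fst y" using \<kappa>(1)[of "fst z"] \<kappa>(2) \<open>fst x \<le> fst z\<close> xy by auto
    moreover have "z \<in> set A" using z by (simp add: X_def)
    then have "\<kappa> (fst z) \<in> set K'" using \<open>last z\<close> unfolding K'_def set_map set_filter by blast
    ultimately show "separated (K @ K') (fst x) (fst y)" unfolding separated_def by auto
  next
    assume "separated (K @ K') (fst x) (fst y)"
    then obtain k where k: "k \<in> set K \<or> k \<in> set K'" "fst x < k" "k < fst y" by (auto simp: separated_def)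
    show "fst (snd x) \<noteq> fst (snd y)"
    proof
      assume eq: "fst (snd x) = fst (snd y)"
      then have "k \<notin> set K" using A(2) xy k unfolding no_cuts_def separated_def by blast
      then obtain z where z: "z \<in> set A" "last z" "k = \<kappa> (fst z)" using k by (auto simp: K'_def)
      have "fst z < fst y" using z k \<kappa>(1)[of "fst z"] by simp
      have "fst x \<le> fst z" using z k \<kappa>(2)[of "fst x" "fst z"] xy by (meson image_eqI linorder_not_less order.asym)
      then have "fst (snd x) \<le> fst (snd z)"
        using order_iso_group_mono[OF A(1) xy(1) z(1)] order_iso_eq[OF A(1) xy(1) z(1)] by (cases "fst x = fst z") auto
      moreover have "fst (snd z) \<le> fst (snd y)"
        using order_iso_group_mono[OF A(1) z(1) xy(2)] \<open>fst z < fst y\<close> by simp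
      ultimately show False using \<open>last z\<close> eq xy \<open>fst z < fst y\<close> unfolding last_def by fastforce
    qed
  qed
  have "set K' \<inter> fst ` set A = {}" using \<kappa>(3) by (auto simp: K'_def)
  with sep show ?thesis unfolding cuts_def by blast
qed

text \<open>Stray points are labelled before \<open>v\<close> is placed, so that the point for
  \<open>v\<close> can be put next to its block with no stray in between.\<close>

lemma good_exists:
  assumes inv: "inv2 (j, A) (P, K)" and v: "(q, k) \<in> snd ` set A \<or> k = 0 \<or>
    0 < k \<and> (q, k - 1) \<in> snd ` set A \<or> k < 0 \<and> (q, k + 1) \<in> snd ` set A"
  shows "\<exists>c' h'. good (j, A) (q, k) (P, K) c' h'"
proof -
  have "prefix (map fst A) P" "distinct P" and disj: "set P \<inter> set K = {}" and "order_iso A" "cuts A K"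
    "down_closed A" "contiguous A P"
    using inv by (auto simp: inv2_def)
  have "no_cuts A K"
    using \<open>cuts A K\<close> unfolding cuts_def no_cuts_def separated_def by (meson order.strict_trans)
  have "length A \<le> length P" using \<open>prefix (map fst A) P\<close> prefix_length_le by fastforce
  then obtain B where B: "prefix A B" "map fst B = P" "order_iso B" "down_closed B" "no_cuts B K"
      "\<And>x. x \<in> set B \<Longrightarrow> x \<in> set A \<or> snd (snd x) = 0 \<and> fst (snd x) \<noteq> q"
    using extend_to_all_positions[of A P K "length P" "(q, k)"] \<open>prefix (map fst A) P\<close> \<open>distinct P\<close>
      \<open>order_iso A\<close> \<open>no_cuts A K\<close> \<open>down_closed A\<close> \<open>contiguous A P\<close> by auto
  have AB: "set A \<subseteq> set B" using B(1) by (auto simp: prefix_def)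
  have PB: "fst ` set B = set P" using B(2) by (metis list.set_map)
  have "\<exists>D. prefix B D \<and> distinct (map fst D) \<and> order_iso D \<and> down_closed D \<and> no_cuts D K \<and>
      (q, k) \<in> snd ` set D \<and> fst ` set D \<inter> set K = {} \<and> (\<forall>x\<in>set D. x \<in> set B \<or> snd x = (q, k))"
  proof (cases "(q, k) \<in> snd ` set B")
    case True
    then show ?thesis using B PB disj \<open>distinct P\<close> by (intro exI[of _ B]) auto
  next
    case False
    have v': "k = 0 \<or> 0 < k \<and> (q, k - 1) \<in> snd ` set B \<or> k < 0 \<and> (q, k + 1) \<in> snd ` set B"
      using v False AB by blast
    obtain p where p: "p \<notin> set K" "\<And>x. x \<in> set B \<Longrightarrow> fst x < p \<longleftrightarrow> label_less (snd x) (q, k)"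
      "\<And>x. x \<in> set B \<Longrightarrow> p < fst x \<longleftrightarrow> label_less (q, k) (snd x)"
      "\<And>x. x \<in> set B \<Longrightarrow> fst (snd x) = q \<Longrightarrow> \<not> separated K (fst x) p \<and> \<not> separated K p (fst x)"
      using insert_position[OF B(3,4,5) False _ v'] disj PB by blast
    define D where "D = B @ [(p, q, k)]"
    have "p \<notin> fst ` set B"
    proof
      assume "p \<in> fst ` set B"
      then obtain x where x: "x \<in> set B" "fst x = p" by blast
      then have "snd x = (q, k)" using p(2,3)[OF x(1)] label_less_total[of "snd x" "(q, k)"] by auto
      with False x show False by force
    qed
    then have "distinct (map fst D)" using \<open>distinct P\<close> B(2) PB by (simp add: D_def)
    moreover have "order_iso D" unfolding D_def using order_iso_snoc[OF B(3)] p(2,3) by blast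
    moreover have "down_closed D"
      using B(4) v' unfolding D_def down_closed_def by auto
    moreover have "no_cuts D K"
      using B(5) p(4) unfolding D_def no_cuts_def by (auto simp: separated_def)
    moreover have "fst ` set D \<inter> set K = {}" using p(1) disj PB by (auto simp: D_def)
    ultimately show ?thesis by (intro exI[of _ D]) (auto simp: D_def)
  qed
  then obtain D where D: "prefix B D" "distinct (map fst D)" "order_iso D" "down_closed D" "no_cuts D K"
      "(q, k) \<in> snd ` set D" "fst ` set D \<inter> set K = {}" "\<And>x. x \<in> set D \<Longrightarrow> x \<in> set B \<or> snd x = (q, k)"
    by blast
  obtain K' where K': "cuts D (K @ K')" "set K' \<inter> fst ` set D = {}" using add_cuts[OF D(3,5)] by blast
  have "prefix A D" using B(1) D(1) by (rule prefix_order.trans)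
  moreover have "prefix P (map fst D)" using D(1) B(2) by (metis map_mono_prefix)
  moreover have "\<forall>i<length (map fst D). hd (drop i (map fst D)) \<notin> set (take i (map fst D))"
    using D(2) distinct_iff_take by blast
  moreover have "\<forall>x\<in>set D. x \<in> set A \<or> snd x = (q, k) \<or> snd (snd x) = 0"
    using D(8) B(6) by blast
  ultimately have "good (j, A) (q, k) (P, K) (Suc j, D) (map fst D, K @ K')"
    unfolding good_def fst_conv snd_conv using D K' by (intro conjI) (simp_all, blast+)
  then show ?thesis by blast
qed


text \<open>After a good step all points are labelled, which makes contiguity immediate.\<close>

lemma good_inv2:
  assumes "inv2 c h" "good c v h c' h'"
  shows "inv2 c' h'"
  using assms unfolding good_def inv2_def contiguous_def
  by (auto simp: distinct_iff_take[symmetric])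

text \<open>A point between two points of one block of \<open>d\<close> carries, by the
  lexicographic order, an intermediate label of the same block. Down-closure puts that label into
  \<open>d\<close>, so by \<open>order_iso\<close> the point belongs to \<open>d\<close> already.
  Thus later commitments never split the blocks of an earlier one.\<close>

lemma good_inv2_below:
  assumes d: "prefix (snd d) (snd c)" "inv2 d h" and good: "inv2 c h" "good c v h c' h'"
  shows "inv2 d h'"
proof -
  have dc': "prefix (snd d) (snd c')"
    using d(1) good(2) by (auto simp: good_def intro: prefix_order.trans)
  then have sub: "set (snd d) \<subseteq> set (snd c')" by (auto simp: prefix_def)
  have c': "inv2 c' h'" using good_inv2 good by blast
  have P: "fst ` set (snd c') = set (fst h')" using good(2) unfolding good_def by (metis list.set_map)
  have "prefix (map fst (snd d)) (fst h')"
    using d(2) good(2) by (auto simp: good_def inv2_def intro: prefix_order.trans)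
  moreover have "order_iso (snd d)" "cuts (snd d) (snd h')"
    using c' sub unfolding inv2_def order_iso_def cuts_def by blast+
  moreover have "contiguous (snd d) (fst h')"
    unfolding contiguous_def
  proof (intro ballI impI, elim conjE)
    fix x y p
    assume xy: "x \<in> set (snd d)" "y \<in> set (snd d)" "fst (snd x) = fst (snd y)"
      and p: "p \<in> set (fst h')" "fst x < p" "p < fst y"
    have "p \<in> fst ` set (snd c')" using p(1) P by simp
    then obtain z where z: "z \<in> set (snd c')" "fst z = p" by (metis imageE)
    have iso: "order_iso (snd c')" using c' by (simp add: inv2_def)
    have "label_less (snd x) (snd z)" "label_less (snd z) (snd y)"
      using order_isoD[OF iso subsetD[OF sub xy(1)] z(1)] order_isoD[OF iso z(1) subsetD[OF sub xy(2)]] z(2) p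
      by simp_all
    then have "fst (snd z) = fst (snd x)" "snd (snd x) \<le> snd (snd z)" "snd (snd z) \<le> snd (snd y)"
      using xy(3) unfolding label_less_def by linarith+
    moreover have "down_closed (snd d)" using d(2) by (simp add: inv2_def)
    ultimately have "snd z \<in> snd ` set (snd d)"
      using down_closed_between[of "snd d" "fst (snd x)" "snd (snd x)" "snd (snd y)" "snd (snd z)"] xy
      by (metis image_eqI prod.collapse)
    then obtain z' where "z' \<in> set (snd d)" "snd z' = snd z" by auto
    moreover from this have "fst z' = fst z" using order_iso_eq[OF iso, of z' z] z(1) sub by auto
    ultimately show "p \<in> set (map fst (snd d))" using z(2) image_eqI[of p fst z'] by simp
  qed
  ultimately show ?thesis
    using d(2) c' by (auto simp: inv2_def)
qed

section \<open>The second construction and its limit\<close>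

lemma (in rec_class) cf_prefix [cf_intros]: "cf xs \<Longrightarrow> cf ys \<Longrightarrow> cf (\<lambda>x. prefix (xs x) (ys x))"
proof -
  assume "cf xs" "cf ys"
  then have "cf (\<lambda>x. take (length (xs x)) (ys x) = xs x)" by (intro cf_intros)
  moreover have "prefix xs ys \<longleftrightarrow> take (length xs) ys = xs" for xs ys :: "'b list"
    by (auto simp: prefix_def append_eq_conv_conj) (metis append_take_drop_id)
  ultimately show ?thesis by simp
qed

lemma (in rec_class) cf_label_less [cf_intros]: "cf x \<Longrightarrow> cf y \<Longrightarrow> cf (\<lambda>e. label_less (x e) (y e))"
  unfolding label_less_def by (intro cf_intros)

lemma (in rec_class) cf_good:
  "cf (\<lambda>p. good (fst p) (fst (snd p)) (fst (snd (snd p))) (fst (snd (snd (snd p))))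
      (snd (snd (snd (snd p)))))"
  unfolding good_def order_iso_def cuts_def separated_def down_closed_def by (intro cf_intros)

locale limit_labels = rec_class +
  fixes e :: "nat \<Rightarrow> rat \<times> int" and e' :: "nat \<Rightarrow> nat \<Rightarrow> rat \<times> int"
  assumes cf_e': "cf (\<lambda>p. e' (fst p) (snd p))"
    and lim_e': "\<And>j. \<forall>\<^sub>F s in sequentially. e' j s = e j"
    and e_zero: "\<And>q. (q, 0) \<in> range e"
    and e_pos: "\<And>j. 0 < snd (e j) \<Longrightarrow> (fst (e j), snd (e j) - 1) \<in> e ` {..<j}"
    and e_neg: "\<And>j. snd (e j) < 0 \<Longrightarrow> (fst (e j), snd (e j) + 1) \<in> e ` {..<j}"
begin

text \<open>The labels used on the true path are those read so far and some base labels; the latter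
  are correct by \<open>e_zero\<close>.\<close>

definition tr2 :: "nat \<times> assoc \<Rightarrow> bool" where
  "tr2 c \<longleftrightarrow> e ` {..<fst c} \<subseteq> snd ` set (snd c) \<and> snd ` set (snd c) \<subseteq> e ` {..<fst c} \<union> UNIV \<times> {0}"

sublocale finite_injury C "\<lambda>c. e' (fst c)" good "(0, [])" "([], [])" inv2 "\<lambda>c d. prefix (snd c) (snd d)" tr2
proof
  show "cf (\<lambda>p :: (nat \<times> assoc) \<times> nat. e' (fst (fst p)) (snd p))"
    using cf_comp2[of e', OF cf_e', of "\<lambda>p. fst (fst p)" snd] by (simp add: cf_intros)
  show "cf (dec :: nat \<Rightarrow> nat \<times> assoc)" "cf (dec :: nat \<Rightarrow> rat list \<times> rat list)"
    by (intro cf_intros)+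
  show "inv2 (0, []) ([], [])"
    by (simp add: inv2_def order_iso_def cuts_def down_closed_def contiguous_def)
  show "tr2 (0, [])" by (simp add: tr2_def)
next
  fix c assume tr: "tr2 c"
  obtain j A where c: "c = (j, A)" by (cases c)
  have A: "e ` {..<j} \<subseteq> snd ` set A" "snd ` set A \<subseteq> e ` {..<j} \<union> UNIV \<times> {0}"
    using tr by (simp_all add: tr2_def c)
  show "\<exists>v. (\<forall>\<^sub>F s in sequentially. e' (fst c) s = v) \<and>
      (\<forall>h. inv2 c h \<longrightarrow> (\<exists>c' h'. good c v h c' h') \<and> (\<forall>c' h'. good c v h c' h' \<longrightarrow> tr2 c'))"
  proof (intro exI[of _ "e j"] conjI allI impI)
    show "\<forall>\<^sub>F s in sequentially. e' (fst c) s = e j" using lim_e' by (simp add: c)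
  next
    fix h assume inv: "inv2 c h"
    show "\<exists>c' h'. good c (e j) h c' h'"
    proof -
      have "snd (e j) = 0 \<or> 0 < snd (e j) \<and> (fst (e j), snd (e j) - 1) \<in> snd ` set A \<or>
          snd (e j) < 0 \<and> (fst (e j), snd (e j) + 1) \<in> snd ` set A"
        using A(1) e_pos[of j] e_neg[of j] by (meson linorder_neqE subsetD)
      then show ?thesis
        using good_exists[of j A "fst h" "snd h" "fst (e j)" "snd (e j)"] inv unfolding c by simp
    qed
    fix c' h' assume "good c (e j) h c' h'"
    then have *: "fst c' = Suc j" "set A \<subseteq> set (snd c')" "e j \<in> snd ` set (snd c')"
      "\<And>x. x \<in> set (snd c') \<Longrightarrow> x \<in> set A \<or> snd x = e j \<or> snd (snd x) = 0"
      by (auto simp: good_def c prefix_def)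
    have "e ` {..<Suc j} \<subseteq> snd ` set (snd c')"
      using A(1) *(2,3) by (auto simp: lessThan_Suc)
    moreover have "snd x \<in> e ` {..<Suc j} \<union> UNIV \<times> {0}" if "x \<in> set (snd c')" for x
      using *(4)[OF that] A(2) by (cases x) (auto simp: lessThan_Suc)
    ultimately show "tr2 c'" unfolding tr2_def *(1) by blast
  qed
next
  fix c d :: "nat \<times> assoc" and v h c' h'
  show "good c v h c' h' \<Longrightarrow> prefix (snd c) (snd c')" by (simp add: good_def)
  show "inv2 c h \<Longrightarrow> good c v h c' h' \<Longrightarrow> inv2 c' h'" by (rule good_inv2)
  show "prefix (snd d) (snd c) \<Longrightarrow> inv2 d h \<Longrightarrow> inv2 c h \<Longrightarrow> good c v h c' h' \<Longrightarrow> inv2 d h'"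
    by (rule good_inv2_below)
qed (auto intro: cf_good prefix_order.trans)

text \<open>Points are never moved or withdrawn, so the \<open>n\<close>-th point \<open>p n\<close>
  is found by waiting for it, whereas its final label \<open>F n\<close> is read off the true path.
  Every point gets a label there, because good steps label all points in existence.\<close>

theorem computable_order:
  obtains p :: "nat \<Rightarrow> rat" and F :: "nat \<Rightarrow> rat \<times> int" and K :: "nat \<Rightarrow> rat list"
  where "cf p" "cf K" "bij_betw F UNIV (range e)" "\<And>i j. p i < p j \<longleftrightarrow> label_less (F i) (F j)"
    "\<And>i j. p i < p j \<Longrightarrow> fst (F i) \<noteq> fst (F j) \<longleftrightarrow> (\<exists>s. separated (K s) (p i) (p j))"
proof -
  obtain cs vs r where cs: "cs 0 = (0, [])" "strict_mono r"
    "\<And>j. \<forall>\<^sub>F s in sequentially. e' (fst (cs j)) s = vs j"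
    "\<And>j. good (cs j) (vs j) (H (r j)) (cs (Suc j)) (H (Suc (r j)))"
    "\<And>j. inv2 (cs j) (H (r j))" "\<And>j. tr2 (cs j)" "\<And>j. \<forall>\<^sub>F s in sequentially. inv2 (cs j) (H s)"
    by (rule true_path, rule that)
  define P where "P s = fst (H s)" for s
  define K where "K s = snd (H s)" for s
  define A where "A j = snd (cs j)" for j
  define R where "R j = Suc (r j)" for j
  have fst_cs: "fst (cs j) = j" for j
    by (induction j) (use cs(1,4) in \<open>auto simp: good_def\<close>)
  have pre_A: "prefix (A i) (A j)" if "i \<le> j" for i j
    using that
  proof (induction rule: dec_induct)
    case (step j)
    then show ?case using cs(4)[of j] unfolding A_def good_def by (meson prefix_order.trans)
  qed simp
  have step: "prefix (P s) (P (Suc s))" "set (K s) \<subseteq> set (K (Suc s))" "distinct (P s) \<Longrightarrow> distinct (P (Suc s))" for s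
  proof -
    consider "H (Suc s) = H s"
      | c v c' where "inv2 c (H s)" "good c v (H s) c' (H (Suc s))" using H_Suc[of s] by blast
    then have "prefix (P s) (P (Suc s)) \<and> set (K s) \<subseteq> set (K (Suc s)) \<and> (distinct (P s) \<longrightarrow> distinct (P (Suc s)))"
    proof cases
      case 2
      then have "inv2 c' (H (Suc s))" by (rule good_inv2)
      with 2 show ?thesis unfolding P_def K_def good_def inv2_def by blast
    qed (simp add: P_def K_def)
    then show "prefix (P s) (P (Suc s))" "set (K s) \<subseteq> set (K (Suc s))" "distinct (P s) \<Longrightarrow> distinct (P (Suc s))"
      by blast+
  qed
  have pre_P: "prefix (P s) (P t)" if "s \<le> t" for s t
    using that by (induction rule: dec_induct) (auto intro: step(1) prefix_order.trans)
  have mono_K: "set (K s) \<subseteq> set (K t)" if "s \<le> t" for s t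
    using that by (induction rule: dec_induct) (use step(2) in auto)
  have dist: "distinct (P s)" for s
  proof (induction s)
    case 0
    show ?case by (simp add: P_def state_0)
  qed (rule step(3))
  have A_P: "map fst (A (Suc j)) = P (R j)" "order_iso (A j)" "cuts (A (Suc j)) (K (R j))" for j
    using cs(4)[of j] cs(5)[of j] by (auto simp: good_def inv2_def A_def P_def K_def R_def)
  have lab: "e ` {..<j} \<subseteq> snd ` set (A j)" "snd ` set (A j) \<subseteq> range e" for j
    using cs(6)[of j] e_zero fst_cs[of j] unfolding tr2_def A_def by auto
  have inf: "infinite (range e)"
  proof
    assume "finite (range e)"
    then have "finite ((\<lambda>q :: rat. (q, 0 :: int)) ` UNIV)" by (rule finite_subset[rotated]) (use e_zero in auto)
    then have "finite (UNIV :: rat set)" by (rule finite_imageD) (auto simp: inj_on_def)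
    then show False using infinite_UNIV_char_0 by blast
  qed
  \<comment> \<open>The list \<open>e\<close> has infinitely many values, and all of them have to
    appear in the labellings of the true path.\<close>
  have long: "\<exists>j. n < length (A j)" for n
  proof (rule ccontr)
    assume short: "\<not> ?thesis"
    have "card (e ` {..<j}) \<le> n" for j
    proof -
      have "card (e ` {..<j}) \<le> card (snd ` set (A j))" by (rule card_mono[OF _ lab(1)]) simp
      also have "\<dots> \<le> card (set (A j))" by (rule card_image_le) simp
      also have "\<dots> \<le> length (A j)" by (rule card_length)
      also have "\<dots> \<le> n" using short by (simp add: not_less)
      finally show ?thesis .
    qed
    obtain X where X: "finite X" "card X = Suc n" "X \<subseteq> range e"
      using infinite_arbitrarily_large[OF inf] by blast
    then obtain Y where Y: "X = e ` Y" "finite Y" by (metis finite_subset_image)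
    then obtain j where "\<forall>y\<in>Y. y < j" unfolding finite_nat_set_iff_bounded by (elim exE)
    then have "Y \<subseteq> {..<j}" by (simp add: subset_iff)
    then have "card X \<le> card (e ` {..<j})" unfolding Y by (intro card_mono) auto
    then show False using X(2) \<open>\<And>j. card (e ` {..<j}) \<le> n\<close>[of j] by simp
  qed
  have long': "\<exists>j\<ge>i. n < length (A (Suc j))" for i n
  proof -
    obtain j where "n < length (A j)" using long by blast
    moreover have "length (A j) \<le> length (A (Suc (max i j)))" using pre_A by (simp add: prefix_length_le)
    ultimately show ?thesis by (intro exI[of _ "max i j"]) auto
  qed
  have exP: "\<exists>s. n < length (P s)" for n
    using long'[of 0 n] A_P(1) by (metis length_map)
  define p where "p n = hd (drop n (P (LEAST s. n < length (P s))))" for n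
  define F where "F n = snd (A (LEAST j. n < length (A j)) ! n)" for n
  have nth_pre: "xs ! n = ys ! n" if "prefix xs ys \<or> prefix ys xs" "n < length xs" "n < length ys"
    for xs ys :: "'x list" and n
    using that by (auto simp: prefix_def nth_append)
  have p_eq: "p n = P s ! n" if "n < length (P s)" for n s
  proof -
    define t where "t = (LEAST s. n < length (P s))"
    have t: "n < length (P t)" unfolding t_def using that by (rule LeastI)
    have "P s ! n = P t ! n" using pre_P[of s t] pre_P[of t s] that t by (intro nth_pre) (cases "s \<le> t", auto)
    then show ?thesis using t by (simp add: p_def t_def[symmetric] hd_drop_conv_nth)
  qed
  have F_eq: "F n = snd (A j ! n)" if "n < length (A j)" for n j
  proof -
    define t where "t = (LEAST j. n < length (A j))"
    have t: "n < length (A t)" unfolding t_def using that by (rule LeastI)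
    have "A j ! n = A t ! n" using pre_A[of j t] pre_A[of t j] that t by (intro nth_pre) (cases "j \<le> t", auto)
    then show ?thesis by (simp add: F_def t_def[symmetric])
  qed
  have nth: "A (Suc j) ! n = (p n, F n)" if "n < length (A (Suc j))" for n j
    using F_eq[OF that] p_eq[of n "R j"] that A_P(1)[of j, symmetric] by (simp add: prod_eq_iff)
  have both: "\<exists>j\<ge>k. (p m, F m) \<in> set (A (Suc j)) \<and> (p n, F n) \<in> set (A (Suc j))" for k m n
  proof -
    obtain j where "j \<ge> k" "max m n < length (A (Suc j))" using long' by blast
    then show ?thesis using nth by (metis max_less_iff_conj nth_mem)
  qed
  have p_iff: "p m < p n \<longleftrightarrow> label_less (F m) (F n)" for m n
    using both[of 0 m n] order_isoD[OF A_P(2)] by (metis fst_conv snd_conv)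
  have p_inj: "p m \<noteq> p n" if "m \<noteq> n" for m n
  proof -
    obtain j where "max m n < length (A (Suc j))" using long' by blast
    then have "m < length (P (R j))" "n < length (P (R j))" using A_P(1)[of j, symmetric] by auto
    then show ?thesis using p_eq dist that by (metis nth_eq_iff_index_eq)
  qed
  have "bij_betw F UNIV (range e)"
    unfolding bij_betw_def
  proof (intro conjI injI equalityI subsetI)
    show "m = n" if "F m = F n" for m n
      using that p_inj[of m n] p_iff[of m n] p_iff[of n m] by (metis label_less_irrefl linorder_neqE)
    show "x \<in> range e" if "x \<in> range F" for x
      using that both[of 0] lab(2) by (metis image_eqI imageE snd_conv subsetD)
    fix x assume "x \<in> range e"
    then obtain i where "x = e i" by blast
    then have "x \<in> snd ` set (A (Suc i))" using lab(1)[of "Suc i"] by blast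
    then obtain n where "n < length (A (Suc i))" "x = snd (A (Suc i) ! n)" by (metis imageE in_set_conv_nth)
    then have "x = F n" by (simp add: F_eq)
    then show "x \<in> range F" by simp
  qed
  moreover have "fst (F m) \<noteq> fst (F n) \<longleftrightarrow> (\<exists>s. separated (K s) (p m) (p n))" if "p m < p n" for m n
  proof
    obtain j where "(p m, F m) \<in> set (A (Suc j))" "(p n, F n) \<in> set (A (Suc j))" using both by blast
    moreover assume "fst (F m) \<noteq> fst (F n)"
    ultimately show "\<exists>s. separated (K s) (p m) (p n)"
      using A_P(3)[of j] that unfolding cuts_def by fastforce
  next
    assume "\<exists>s. separated (K s) (p m) (p n)"
    then obtain s where s: "separated (K s) (p m) (p n)" ..
    \<comment> \<open>A cut made at stage \<open>s\<close> is still there at a later stage of the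
      true path whose labelling contains both points, and there the cuts agree with the
      blocks.\<close>
    obtain j where j: "j \<ge> s" "(p m, F m) \<in> set (A (Suc j))" "(p n, F n) \<in> set (A (Suc j))" using both by blast
    have "s \<le> R j" using j(1) strict_mono_imp_increasing[OF cs(2), of j] by (simp add: R_def)
    then have "separated (K (R j)) (p m) (p n)" using s mono_K unfolding separated_def by blast
    then show "fst (F m) \<noteq> fst (F n)"
      using A_P(3)[of j] that j unfolding cuts_def by fastforce
  qed
  moreover have "cf p"
  proof -
    have cf_P: "cf s \<Longrightarrow> cf (\<lambda>x. P (s x))" for s :: "'x :: enc \<Rightarrow> nat"
      unfolding P_def by (intro cf_fst cf_comp[OF cf_H])
    have "cf (\<lambda>n. LEAST s. n < length (P s))"
      by (rule cf_Least[OF _ cf_dec_nat exP]) (intro cf_intros cf_P)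
    then show ?thesis unfolding p_def by (intro cf_intros cf_P)
  qed
  moreover have "cf K" unfolding K_def by (rule cf_snd[OF cf_H])
  ultimately show thesis using that p_iff by blast
qed

end

section \<open>Blocks of the given order\<close>

text \<open>The map \<open>y / (1 + \<bar>y\<bar>)\<close> is increasing from the rationals onto the
  open interval from \<open>-1\<close> to \<open>1\<close>, with the rational inverse
  \<open>t / (1 - \<bar>t\<bar>)\<close>; an affine map does the rest.\<close>

lemma rat_interval_iso:
  fixes a b :: rat
  assumes "a < b"
  obtains \<theta> :: "rat \<Rightarrow> rat" where "strict_mono \<theta>" "range \<theta> = {a<..<b}"
proof -
  define \<tau> :: "rat \<Rightarrow> rat" where "\<tau> y = y / (1 + \<bar>y\<bar>)" for y
  have pos: "0 < 1 + \<bar>y\<bar>" for y :: rat by linarith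
  have mono: "\<tau> x < \<tau> y" if "x < y" for x y
  proof -
    have "x * (1 + \<bar>y\<bar>) < y * (1 + \<bar>x\<bar>)"
    proof (cases "0 \<le> x \<or> y \<le> 0")
      case True
      then show ?thesis using that by (auto simp: algebra_simps abs_if)
    next
      case False
      then have "x * (1 + \<bar>y\<bar>) < 0" "0 < y * (1 + \<bar>x\<bar>)" using pos by (auto simp: mult_neg_pos)
      then show ?thesis by simp
    qed
    then show ?thesis using pos by (simp add: \<tau>_def divide_less_eq less_divide_eq mult.commute pos_less_divide_eq pos_divide_less_eq)
  qed
  have range: "- 1 < \<tau> y" "\<tau> y < 1" for y
    using pos[of y] by (simp_all add: \<tau>_def pos_less_divide_eq pos_divide_less_eq)
  have surj: "\<exists>y. \<tau> y = t" if "- 1 < t" "t < 1" for t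
  proof -
    have p: "0 < 1 - \<bar>t\<bar>" using that by linarith
    have "1 + \<bar>t / (1 - \<bar>t\<bar>)\<bar> = 1 / (1 - \<bar>t\<bar>)"
      using p by (simp add: abs_divide field_simps)
    then have "\<tau> (t / (1 - \<bar>t\<bar>)) = t" using p by (simp add: \<tau>_def)
    then show ?thesis ..
  qed
  define \<theta> where "\<theta> y = (a + b) / 2 + (b - a) / 2 * \<tau> y" for y
  have "strict_mono \<theta>"
    using mono assms by (auto simp: strict_mono_def \<theta>_def)
  moreover have "range \<theta> = {a<..<b}"
  proof (intro equalityI subsetI)
    fix x assume "x \<in> range \<theta>"
    then obtain y where x: "x = \<theta> y" by blast
    have "(b - a) / 2 * (- 1) < (b - a) / 2 * \<tau> y" "(b - a) / 2 * \<tau> y < (b - a) / 2 * 1"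
      using assms range[of y] by (intro mult_strict_left_mono; simp)+
    then show "x \<in> {a<..<b}" by (simp add: x \<theta>_def field_simps)
  next
    fix x assume "x \<in> {a<..<b}"
    then have "- 1 < (2 * x - a - b) / (b - a)" "(2 * x - a - b) / (b - a) < 1"
      using assms by (simp_all add: field_simps)
    then obtain y where "\<tau> y = (2 * x - a - b) / (b - a)" using surj by blast
    then have "\<theta> y = x" using assms by (simp add: \<theta>_def field_simps)
    then show "x \<in> range \<theta>" by blast
  qed
  ultimately show thesis using that by blast
qed

section \<open>Immediate successors, blocks and places in a block\<close>

locale linear_order =
  fixes L :: "nat rel"
  assumes lin: "strict_linear_order_on UNIV L"
begin

lemma L_trans: "(x, y) \<in> L \<Longrightarrow> (y, z) \<in> L \<Longrightarrow> (x, z) \<in> L"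
  using lin unfolding strict_linear_order_on_def trans_def by blast

lemma L_irrefl [simp]: "(x, x) \<notin> L"
  using lin unfolding strict_linear_order_on_def irrefl_def by blast

lemma L_total: "(x, y) \<in> L \<or> x = y \<or> (y, x) \<in> L"
  using lin unfolding strict_linear_order_on_def total_on_def by blast

lemma L_asym: "(x, y) \<in> L \<Longrightarrow> (y, x) \<notin> L"
  using L_trans L_irrefl by blast

definition succ :: "nat rel" where
  "succ = {(x, y). (x, y) \<in> L \<and> \<not> (\<exists>z. (x, z) \<in> L \<and> (z, y) \<in> L)}"

lemma succ_right_unique: "(x, y) \<in> succ \<Longrightarrow> (x, z) \<in> succ \<Longrightarrow> y = z"
  using L_total unfolding succ_def by blast

lemma succ_left_unique: "(y, x) \<in> succ \<Longrightarrow> (z, x) \<in> succ \<Longrightarrow> y = z"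
  using L_total unfolding succ_def by blast

lemma relpow_succ_less: "(x, y) \<in> succ ^^ n \<Longrightarrow> 0 < n \<Longrightarrow> (x, y) \<in> L"
proof (induction n arbitrary: y)
  case (Suc n)
  then obtain z where z: "(x, z) \<in> succ ^^ n" "(z, y) \<in> succ" by (meson relpow_Suc_E)
  have "(z, y) \<in> L" using z(2) by (simp add: succ_def)
  then show ?case using Suc.IH[OF z(1)] z(1) L_trans by (cases "n = 0") auto
qed simp

lemma relpow_succ_le: "(x, y) \<in> succ ^^ n \<Longrightarrow> (x, y) \<in> L\<^sup>="
  using relpow_succ_less by (cases "n = 0") auto

lemma relpow_succ_right_unique: "(x, y) \<in> succ ^^ n \<Longrightarrow> (x, z) \<in> succ ^^ n \<Longrightarrow> y = z"
proof (induction n arbitrary: y z)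
  case (Suc n)
  obtain y' z' where "(x, y') \<in> succ ^^ n" "(y', y) \<in> succ" "(x, z') \<in> succ ^^ n" "(z', z) \<in> succ"
    using Suc.prems by (meson relpow_Suc_E)
  then show ?case using Suc.IH[of y' z'] succ_right_unique by blast
qed simp

lemma relpow_succ_left_unique: "(y, x) \<in> succ ^^ n \<Longrightarrow> (z, x) \<in> succ ^^ n \<Longrightarrow> y = z"
proof (induction n arbitrary: x)
  case (Suc n)
  obtain y' z' where "(y, y') \<in> succ ^^ n" "(y', x) \<in> succ" "(z, z') \<in> succ ^^ n" "(z', x) \<in> succ"
    using Suc.prems by (meson relpow_Suc_E)
  then show ?case using Suc.IH[of y'] succ_left_unique by blast
qed simp

lemma finite_has_least:
  assumes "finite Y" "Y \<noteq> {}"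
  shows "\<exists>y\<in>Y. \<forall>z\<in>Y. (y, z) \<in> L\<^sup>="
  using assms
proof (induction Y rule: finite_ne_induct)
  case (insert x Y)
  then obtain y where "y \<in> Y" "\<forall>z\<in>Y. (y, z) \<in> L\<^sup>=" by blast
  show ?case
  proof (cases "(x, y) \<in> L")
    case True
    then have "\<forall>z\<in>Y. (x, z) \<in> L\<^sup>=" using \<open>\<forall>z\<in>Y. (y, z) \<in> L\<^sup>=\<close> L_trans by blast
    then show ?thesis by simp
  next
    case False
    then have "(y, x) \<in> L\<^sup>=" using L_total[of x y] by auto
    then show ?thesis using \<open>y \<in> Y\<close> \<open>\<forall>z\<in>Y. (y, z) \<in> L\<^sup>=\<close> by blast
  qed
qed simp

text \<open>Induction on the size of the interval, whose least element is the immediate successor of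
  \<open>x\<close>.\<close>

lemma finite_interval_relpow:
  assumes "finite {z. (x, z) \<in> L \<and> (z, y) \<in> L\<^sup>=}" "(x, y) \<in> L\<^sup>="
  shows "\<exists>n. (x, y) \<in> succ ^^ n"
  using assms
proof (induction "card {z. (x, z) \<in> L \<and> (z, y) \<in> L\<^sup>=}" arbitrary: x rule: less_induct)
  case less
  show ?case
  proof (cases "x = y")
    case True
    then show ?thesis by (intro exI[of _ 0]) simp
  next
    case False
    let ?I = "\<lambda>x. {z. (x, z) \<in> L \<and> (z, y) \<in> L\<^sup>=}"
    have "y \<in> ?I x" using False less.prems by auto
    then obtain w where w: "w \<in> ?I x" "\<forall>z\<in>?I x. (w, z) \<in> L\<^sup>="
      using finite_has_least[OF less.prems(1)] by blast
    have "(x, w) \<in> succ"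
      unfolding succ_def
    proof (clarify, intro conjI notI)
      show "(x, w) \<in> L" using w(1) by simp
      assume "\<exists>z. (x, z) \<in> L \<and> (z, w) \<in> L"
      then obtain z where z: "(x, z) \<in> L" "(z, w) \<in> L" by blast
      then have "(z, y) \<in> L" using w(1) by (auto intro: L_trans)
      then have "(w, z) \<in> L\<^sup>=" using w(2) z(1) by simp
      then show False using z(2) L_asym by auto
    qed
    have "?I w \<subset> ?I x" using w(1) L_trans L_irrefl by blast
    then have "card (?I w) < card (?I x)" "finite (?I w)"
      using less.prems(1) by (auto intro: psubset_card_mono finite_subset)
    then obtain n where "(w, y) \<in> succ ^^ n" using less.hyps[of w] w(1) by auto
    then show ?thesis using relpow_Suc_I2[OF \<open>(x, w) \<in> succ\<close>] by blast
  qed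
qed

lemma relpow_finite_interval:
  "(x, y) \<in> succ ^^ n \<Longrightarrow> finite {z. (x, z) \<in> L\<^sup>= \<and> (z, y) \<in> L\<^sup>=}"
proof (induction n arbitrary: x)
  case 0
  then have "{z. (x, z) \<in> L\<^sup>= \<and> (z, y) \<in> L\<^sup>=} \<subseteq> {x}" using L_asym by auto
  then show ?case by (rule finite_subset) simp
next
  case (Suc n)
  then obtain w where w: "(x, w) \<in> succ" "(w, y) \<in> succ ^^ n" by (meson relpow_Suc_D2)
  have "{z. (x, z) \<in> L\<^sup>= \<and> (z, y) \<in> L\<^sup>=} \<subseteq> insert x {z. (w, z) \<in> L\<^sup>= \<and> (z, y) \<in> L\<^sup>=}"
    using w(1) L_total unfolding succ_def by blast
  then show ?case using Suc.IH[OF w(2)] by (meson finite_insert finite_subset)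
qed

definition B :: "nat \<Rightarrow> nat \<Rightarrow> bool" where
  "B x y \<longleftrightarrow> (x, y) \<in> block_rel UNIV L"

text \<open>An existential form of the block relation, which makes it enumerable as soon as
  \<open>succ\<close> is decidable.\<close>

lemma B_iff_relpow: "B x y \<longleftrightarrow> (\<exists>n. (x, y) \<in> succ ^^ n \<or> (y, x) \<in> succ ^^ n)"
proof
  assume "B x y"
  then have fin: "finite (closed_interval UNIV L x y)" by (simp add: B_def block_rel_def)
  consider "(x, y) \<in> L\<^sup>=" | "(y, x) \<in> L\<^sup>=" using L_total by blast
  then show "\<exists>n. (x, y) \<in> succ ^^ n \<or> (y, x) \<in> succ ^^ n"
  proof cases
    case 1
    have "finite {z. (x, z) \<in> L \<and> (z, y) \<in> L\<^sup>=}"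
      by (rule finite_subset[OF _ fin]) (auto simp: closed_interval_def)
    then show ?thesis using finite_interval_relpow 1 by blast
  next
    case 2
    have "finite {z. (y, z) \<in> L \<and> (z, x) \<in> L\<^sup>=}"
      by (rule finite_subset[OF _ fin]) (auto simp: closed_interval_def)
    then show ?thesis using finite_interval_relpow 2 by blast
  qed
next
  have *: "finite (closed_interval UNIV L x y)" if "(x, y) \<in> succ ^^ n" for x y n
  proof -
    have "closed_interval UNIV L x y \<subseteq> {z. (x, z) \<in> L\<^sup>= \<and> (z, y) \<in> L\<^sup>=}"
      using relpow_succ_le[OF that] L_trans L_irrefl unfolding closed_interval_def by auto
    then show ?thesis using relpow_finite_interval[OF that] by (rule finite_subset)
  qed
  have "closed_interval UNIV L x y = closed_interval UNIV L y x"
    by (auto simp: closed_interval_def)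
  moreover assume "\<exists>n. (x, y) \<in> succ ^^ n \<or> (y, x) \<in> succ ^^ n"
  ultimately have "finite (closed_interval UNIV L x y)" using * by metis
  then show "B x y" by (simp add: B_def block_rel_def)
qed

definition shift :: "nat \<Rightarrow> int \<Rightarrow> nat \<Rightarrow> bool" where
  "shift l k m \<longleftrightarrow> (if 0 \<le> k then (l, m) \<in> succ ^^ nat k else (m, l) \<in> succ ^^ nat (- k))"

lemma shift_0: "shift l 0 m \<longleftrightarrow> m = l"
  by (auto simp: shift_def)

lemma shift_unique: "shift l k m \<Longrightarrow> shift l k m' \<Longrightarrow> m = m'"
  unfolding shift_def
  by (cases "0 \<le> k") (simp_all add: relpow_succ_right_unique relpow_succ_left_unique)

lemma relpow_split:
  assumes "(x, y) \<in> succ ^^ n" "m \<le> n"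
  shows "\<exists>z. (x, z) \<in> succ ^^ m \<and> (z, y) \<in> succ ^^ (n - m)"
proof -
  have "(x, y) \<in> succ ^^ m O succ ^^ (n - m)" using assms by (simp flip: relpow_add)
  then show ?thesis by blast
qed

lemma shift_less:
  assumes "shift l k m" "shift l k' m'" "k < k'"
  shows "(m, m') \<in> L"
proof -
  consider "0 \<le> k" | "k < 0" "0 \<le> k'" | "k' < 0" by linarith
  then show ?thesis
  proof cases
    case 1
    then have lm: "(l, m) \<in> succ ^^ nat k" "(l, m') \<in> succ ^^ nat k'" and less: "nat k < nat k'"
      using assms by (auto simp: shift_def)
    obtain z where z: "(l, z) \<in> succ ^^ nat k" "(z, m') \<in> succ ^^ (nat k' - nat k)"
      using relpow_split[OF lm(2), of "nat k"] less by auto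
    have "z = m" using relpow_succ_right_unique[OF z(1) lm(1)] .
    then show ?thesis using relpow_succ_less[OF z(2)] less by simp
  next
    case 2
    then have "(m, l) \<in> L" "(l, m') \<in> L\<^sup>="
      using assms relpow_succ_less[of m l "nat (- k)"] relpow_succ_le[of l m' "nat k'"] by (simp_all add: shift_def)
    then show ?thesis using L_trans by auto
  next
    case 3
    then have lm: "(m, l) \<in> succ ^^ nat (- k)" "(m', l) \<in> succ ^^ nat (- k')" and less: "nat (- k') < nat (- k)"
      using assms by (auto simp: shift_def)
    obtain z where z: "(m, z) \<in> succ ^^ (nat (- k) - nat (- k'))" "(z, l) \<in> succ ^^ nat (- k')"
      using relpow_split[OF lm(1), of "nat (- k) - nat (- k')"] less by auto
    have "z = m'" using relpow_succ_left_unique[OF z(2) lm(2)] .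
    then show ?thesis using relpow_succ_less[OF z(1)] less by simp
  qed
qed

lemma shift_B: "shift l k m \<Longrightarrow> B l m"
  unfolding B_iff_relpow shift_def by (auto split: if_splits)

lemma B_shift: "B l m \<Longrightarrow> \<exists>k. shift l k m"
proof -
  assume "B l m"
  then obtain n where "(l, m) \<in> succ ^^ n \<or> (m, l) \<in> succ ^^ n" unfolding B_iff_relpow by blast
  then show ?thesis
  proof
    assume "(l, m) \<in> succ ^^ n"
    then have "shift l (int n) m" by (simp add: shift_def)
    then show ?thesis ..
  next
    assume "(m, l) \<in> succ ^^ n"
    then have "shift l (- int n) m" by (cases "n = 0") (auto simp: shift_def)
    then show ?thesis ..
  qed
qed

lemma shift_exists_bounded:
  assumes "(u, l) \<in> succ ^^ n" "(l, v) \<in> succ ^^ n" "\<bar>k\<bar> \<le> int n"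
  shows "\<exists>m. shift l k m"
proof (cases "0 \<le> k")
  case True
  then have "nat k \<le> n" using assms(3) by linarith
  then show ?thesis using relpow_split[OF assms(2), of "nat k"] True unfolding shift_def by auto
next
  case False
  then have "n - (n - nat (- k)) = nat (- k)" using assms(3) by auto
  then show ?thesis using relpow_split[OF assms(1), of "n - nat (- k)"] False assms(3) by (auto simp: shift_def)
qed

end

text \<open>\<open>\<beta>\<close> sends an element to the rational of its block, so that blocks are
  compared as rationals instead of as sets.\<close>

locale eta_order = linear_order +
  fixes \<beta> :: "nat \<Rightarrow> rat"
  assumes \<beta>_eq_iff: "\<beta> x = \<beta> y \<longleftrightarrow> B x y"
    and \<beta>_less_iff: "\<beta> x < \<beta> y \<longleftrightarrow> \<not> B x y \<and> (x, y) \<in> L"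
    and \<beta>_surj: "surj \<beta>"
    and no_eta_like: "\<not> (\<exists>I. order_interval UNIV L I \<and> infinite I \<and> strongly_eta_like I L)"
begin

lemma \<beta>_mono: "(x, y) \<in> L \<Longrightarrow> \<beta> x \<le> \<beta> y"
  using \<beta>_eq_iff \<beta>_less_iff by (metis order.order_iff_strict)

lemma \<beta>_lessD: "\<beta> x < \<beta> y \<Longrightarrow> (x, y) \<in> L"
  by (simp add: \<beta>_less_iff)

text \<open>The preimage of a rational interval is convex and a union of blocks of \<open>L\<close>.
  Closed intervals between its elements are the same in \<open>I\<close> as in \<open>L\<close>, so
  its blocks are those of \<open>L\<close>, and their order is that of an open rational
  interval.\<close>

lemma interval_blocks:
  assumes ab: "a < b"
  defines "I \<equiv> {x. a < \<beta> x \<and> \<beta> x < b}"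
  shows "blocks I L = (\<lambda>q. \<beta> -` {q}) ` {a<..<b}" and "condensation_type_eta I L"
proof -
  have conv: "closed_interval I L x y = closed_interval UNIV L x y" if "x \<in> I" "y \<in> I" for x y
    using that \<beta>_mono unfolding closed_interval_def I_def
    by (auto intro: less_le_trans le_less_trans dest: \<beta>_mono)
  have rel: "block_rel I L = {(x, y). x \<in> I \<and> y \<in> I \<and> \<beta> x = \<beta> y}"
    unfolding \<beta>_eq_iff B_def block_rel_def by (auto simp: conv)
  have class_eq: "block_rel I L `` {x} = \<beta> -` {\<beta> x}" if "x \<in> I" for x
    using that unfolding rel by (auto simp: I_def)
  show blocks: "blocks I L = (\<lambda>q. \<beta> -` {q}) ` {a<..<b}"
  proof (intro equalityI subsetI)
    fix X assume "X \<in> blocks I L"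
    then obtain x where x: "x \<in> I" "X = \<beta> -` {\<beta> x}"
      unfolding blocks_def by (metis class_eq quotientE)
    then have "\<beta> x \<in> {a<..<b}" by (simp add: I_def)
    with x(2) show "X \<in> (\<lambda>q. \<beta> -` {q}) ` {a<..<b}" by blast
  next
    fix X assume "X \<in> (\<lambda>q. \<beta> -` {q}) ` {a<..<b}"
    then obtain q where q: "q \<in> {a<..<b}" "X = \<beta> -` {q}" by blast
    obtain x where x: "\<beta> x = q" using \<beta>_surj by (metis surjD)
    then have "x \<in> I" using q by (simp add: I_def)
    with class_eq[OF this] x q show "X \<in> blocks I L"
      unfolding blocks_def by (metis quotientI)
  qed
  obtain \<theta> :: "rat \<Rightarrow> rat" where \<theta>: "strict_mono \<theta>" "range \<theta> = {a<..<b}" using rat_interval_iso[OF ab] .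
  define g where "g p = \<beta> -` {\<theta> p}" for p
  have inj: "inj g"
  proof (rule injI)
    fix p q assume eq: "g p = g q"
    obtain x where "\<beta> x = \<theta> p" using \<beta>_surj by (metis surjD)
    then have "\<theta> p = \<theta> q" using eq by (auto simp: g_def)
    then show "p = q" using \<theta>(1) strict_mono_eq by blast
  qed
  have "range g = blocks I L" unfolding blocks g_def \<theta>(2)[symmetric] by (simp add: image_image)
  with inj have bij: "bij_betw g UNIV (blocks I L)" by (simp add: bij_betw_def)
  have less: "(g p, g q) \<in> condensation_rel I L \<longleftrightarrow> p < q" for p q
  proof
    assume "p < q"
    then have "\<theta> p < \<theta> q" using \<theta>(1) by (simp add: strict_mono_less)
    obtain x y where "\<beta> x = \<theta> p" "\<beta> y = \<theta> q" using \<beta>_surj by (metis surjD)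
    moreover from this have "(x, y) \<in> L" using \<open>\<theta> p < \<theta> q\<close> \<beta>_lessD by simp
    moreover have "g p \<noteq> g q" using \<open>p < q\<close> inj by (auto dest: injD)
    moreover have "g p \<in> blocks I L" "g q \<in> blocks I L" using \<open>range g = blocks I L\<close> by blast+
    ultimately show "(g p, g q) \<in> condensation_rel I L" unfolding condensation_rel_def g_def by blast
  next
    assume "(g p, g q) \<in> condensation_rel I L"
    then obtain x y where "\<beta> x = \<theta> p" "\<beta> y = \<theta> q" "(x, y) \<in> L" "g p \<noteq> g q"
      by (auto simp: condensation_rel_def g_def)
    then have "\<theta> p \<le> \<theta> q" "p \<noteq> q" using \<beta>_mono by fastforce+
    then show "p < q" using \<theta>(1) by (simp add: strict_mono_less_eq)
  qed
  show "condensation_type_eta I L"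
    unfolding condensation_type_eta_def order_isomorphic_def
  proof (intro exI[of _ "inv_into UNIV g"] conjI ballI)
    show "bij_betw (inv_into UNIV g) (blocks I L) UNIV" using bij by (rule bij_betw_inv_into)
    fix X Y assume "X \<in> blocks I L" "Y \<in> blocks I L"
    then obtain p q where "X = g p" "Y = g q" unfolding \<open>range g = blocks I L\<close>[symmetric] by (elim imageE)
    then show "(X, Y) \<in> condensation_rel I L \<longleftrightarrow> (inv_into UNIV g X, inv_into UNIV g Y) \<in> {(p, q). p < q}"
      using less inj by simp
  qed
qed

text \<open>Here the hypothesis on strongly eta-like intervals enters: the part of \<open>L\<close>
  over \<open>(a, b)\<close> must contain a block that is infinite or has at least
  \<open>2 * n + 1\<close> elements. The element \<open>n\<close> steps after the least of
  \<open>2 * n + 1\<close> chosen ones has room for \<open>n\<close> places on both sides.\<close>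

lemma large_block:
  assumes ab: "a < b"
  shows "\<exists>l u v. a < \<beta> l \<and> \<beta> l < b \<and> (u, l) \<in> succ ^^ n \<and> (l, v) \<in> succ ^^ n"
proof -
  define I where "I = {x. a < \<beta> x \<and> \<beta> x < b}"
  have "order_interval UNIV L I"
    unfolding order_interval_def I_def by (auto dest!: \<beta>_mono)
  moreover have "infinite I"
  proof
    assume "finite I"
    moreover have "{a<..<b} \<subseteq> \<beta> ` I" using \<beta>_surj unfolding I_def by (force simp: surj_def)
    ultimately have "finite {a<..<b}" by (meson finite_imageI finite_subset)
    then show False using ab infinite_Ioo by blast
  qed
  ultimately have "\<not> strongly_eta_like I L" using no_eta_like by blast
  then obtain X where X: "X \<in> blocks I L" "finite X \<Longrightarrow> Suc (2 * n) \<le> card X"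
    using interval_blocks(2)[OF ab] unfolding strongly_eta_like_def I_def by (metis not_less)
  obtain Y where Y: "Y \<subseteq> X" "finite Y" "card Y = Suc (2 * n)"
    using X(2) infinite_arbitrarily_large[of X "Suc (2 * n)"] obtain_subset_with_card_n[of "Suc (2 * n)" X] by metis
  obtain q where q: "a < q" "q < b" "X = \<beta> -` {q}"
    using X(1) interval_blocks(1)[OF ab] unfolding I_def by auto
  have "Y \<noteq> {}" using Y(3) by auto
  then obtain y\<^sub>0 where y\<^sub>0: "y\<^sub>0 \<in> Y" "\<And>y. y \<in> Y \<Longrightarrow> (y\<^sub>0, y) \<in> L\<^sup>=" using finite_has_least[OF Y(2)] by blast
  have "\<exists>m. (y\<^sub>0, y) \<in> succ ^^ m" if "y \<in> Y" for y
  proof -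
    have "\<beta> y\<^sub>0 = \<beta> y" using that y\<^sub>0(1) Y(1) q(3) by auto
    then obtain m where m: "(y\<^sub>0, y) \<in> succ ^^ m \<or> (y, y\<^sub>0) \<in> succ ^^ m"
      unfolding \<beta>_eq_iff B_iff_relpow by blast
    show ?thesis
    proof (cases "(y\<^sub>0, y) \<in> succ ^^ m")
      case False
      then have "y\<^sub>0 = y" using m relpow_succ_le y\<^sub>0(2)[OF that] L_asym by blast
      then show ?thesis by (intro exI[of _ 0]) simp
    qed blast
  qed
  then obtain d where d: "\<And>y. y \<in> Y \<Longrightarrow> (y\<^sub>0, y) \<in> succ ^^ d y" by metis
  \<comment> \<open>The distances from \<open>y\<^sub>0\<close> are pairwise distinct, so among
    \<open>2 * n + 1\<close> of them one is at least \<open>2 * n\<close>.\<close>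
  have "inj_on d Y" using d relpow_succ_right_unique by (metis inj_onI)
  then have "card (d ` Y) = Suc (2 * n)" using Y(3) by (simp add: card_image)
  then have "\<not> d ` Y \<subseteq> {..<2 * n}" using card_mono[of "{..<2 * n}" "d ` Y"] by auto
  then obtain y where y: "y \<in> Y" "2 * n \<le> d y" by fastforce
  obtain l where l: "(y\<^sub>0, l) \<in> succ ^^ n" "(l, y) \<in> succ ^^ (d y - n)"
    using relpow_split[OF d[OF y(1)], of n] y(2) by auto
  obtain v where v: "(l, v) \<in> succ ^^ n" using relpow_split[OF l(2), of n] y(2)
    by (metis diff_le_mono diff_add_inverse mult_2)
  have "B y\<^sub>0 l" using l(1) B_iff_relpow by blast
  then have "\<beta> l = q" using \<beta>_eq_iff[of y\<^sub>0 l] y\<^sub>0(1) Y(1) q(3) by auto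
  then show ?thesis using q l v by blast
qed

end

lemma eta_order_exists:
  assumes L: "strict_linear_order_on UNIV L" "condensation_type_eta UNIV L"
    "\<not> (\<exists>I. order_interval UNIV L I \<and> infinite I \<and> strongly_eta_like I L)"
  obtains \<beta> where "eta_order L \<beta>"
proof -
  interpret linear_order L using L(1) by unfold_locales
  obtain g where g: "bij_betw g (blocks UNIV L) (UNIV :: rat set)"
    "\<And>X Y. X \<in> blocks UNIV L \<Longrightarrow> Y \<in> blocks UNIV L \<Longrightarrow> (X, Y) \<in> condensation_rel UNIV L \<longleftrightarrow> g X < g Y"
    using L(2) unfolding condensation_type_eta_def order_isomorphic_def by auto
  define cl where "cl x = block_rel UNIV L `` {x}" for x
  define \<beta> where "\<beta> x = g (cl x)" for x
  have equiv: "equiv UNIV (block_rel UNIV L)" using equiv_block_rel[OF L(1)] .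
  have blk: "cl x \<in> blocks UNIV L" for x unfolding blocks_def cl_def by (simp add: quotientI)
  have eq: "\<beta> x = \<beta> y \<longleftrightarrow> B x y" for x y
  proof -
    have "\<beta> x = \<beta> y \<longleftrightarrow> cl x = cl y"
      unfolding \<beta>_def by (rule inj_on_eq_iff[OF bij_betw_imp_inj_on[OF g(1)] blk blk])
    also have "\<dots> \<longleftrightarrow> B x y" unfolding cl_def B_def using eq_equiv_class_iff[OF equiv] by simp
    finally show ?thesis .
  qed
  have less: "\<beta> x < \<beta> y" if "\<not> B x y" "(x, y) \<in> L" for x y
  proof -
    have "cl x \<noteq> cl y" using that(1) eq[of x y] by (auto simp: \<beta>_def)
    moreover have "x \<in> cl x" "y \<in> cl y" unfolding cl_def using equiv_class_self[OF equiv] by simp_all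
    ultimately have "(cl x, cl y) \<in> condensation_rel UNIV L"
      using blk that(2) unfolding condensation_rel_def by blast
    then show ?thesis using g(2)[OF blk blk] by (simp add: \<beta>_def)
  qed
  have "eta_order L \<beta>"
  proof
    show "\<beta> x = \<beta> y \<longleftrightarrow> B x y" for x y by (rule eq)
    show "\<beta> x < \<beta> y \<longleftrightarrow> \<not> B x y \<and> (x, y) \<in> L" for x y
    proof
      assume lt: "\<beta> x < \<beta> y"
      then have "\<not> B x y" "\<not> B y x" using eq[of x y] eq[of y x] by simp_all
      moreover have "x \<noteq> y" "\<not> \<beta> y < \<beta> x" using lt by auto
      ultimately show "\<not> B x y \<and> (x, y) \<in> L" using less[of y x] L_total[of x y] by blast
    qed (use less in simp)
    show "surj \<beta>"
    proof -
      have "\<exists>x. q = \<beta> x" for q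
      proof -
        obtain X where "X \<in> blocks UNIV L" "q = g X" using g(1) unfolding bij_betw_def by blast
        then show ?thesis unfolding blocks_def \<beta>_def cl_def by (metis quotientE)
      qed
      then show ?thesis by (simp add: surj_def)
    qed
  qed (rule L(3))
  then show thesis by (rule that)
qed

section \<open>A limit computable list of labels\<close>

lemma (in rec_class) cf_even [cf_intros]: "cf n \<Longrightarrow> cf (\<lambda>x. even (n x :: nat))"
proof -
  assume n: "cf n"
  have "cf (\<lambda>x. \<exists>m\<le>n x. n x = m + m)" by (intro cf_intros n cf_comp[OF n])
  moreover have "(\<exists>m\<le>k. k = m + m) \<longleftrightarrow> even k" for k :: nat
    by (auto elim!: evenE intro!: exI[of _ "k div 2"])
  ultimately show ?thesis by simp
qed

text \<open>The condition \<open>\<forall>s. P s n\<close> is co-enumerable: each of the finitely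
  many candidates below the least true one is refuted at some stage and stays refuted.\<close>

lemma Least_stabilises:
  fixes P :: "nat \<Rightarrow> nat \<Rightarrow> bool"
  assumes anti: "\<And>s t n. s \<le> t \<Longrightarrow> P t n \<Longrightarrow> P s n" and ex: "\<exists>n. \<forall>s. P s n"
  shows "\<forall>\<^sub>F s in sequentially. (LEAST n. P s n \<or> n = s) = (LEAST n. \<forall>s. P s n)"
proof -
  define N where "N = (LEAST n. \<forall>s. P s n)"
  have N: "\<forall>s. P s N" "\<And>n. n < N \<Longrightarrow> \<exists>s. \<not> P s n"
    using LeastI_ex[OF ex] not_less_Least unfolding N_def by blast+
  have "\<forall>\<^sub>F s in sequentially. \<not> P s n" if "n < N" for n
    using N(2)[OF that] anti unfolding eventually_sequentially by blast
  then have "\<forall>\<^sub>F s in sequentially. \<forall>n\<in>{..<N}. \<not> P s n"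
    by (intro eventually_ball_finite) auto
  then have "\<forall>\<^sub>F s in sequentially. (LEAST n. P s n \<or> n = s) = N"
    using eventually_gt_at_top[of N]
  proof eventually_elim
    case (elim s)
    show ?case
    proof (rule Least_equality)
      show "P s N \<or> N = s" using N(1) by blast
      fix n assume "P s n \<or> n = s"
      then show "N \<le> n" using elim by (cases "n < N") auto
    qed
  qed
  then show ?thesis by (simp add: N_def)
qed

locale label_construction = rec_class C + eta_order L \<beta> for C L \<beta> +
  assumes cf_L0: "cf (\<lambda>p. p \<in> L)" and cf_succ0: "cf (\<lambda>p. p \<in> succ)"
begin

lemma cf_L [cf_intros]: "cf x \<Longrightarrow> cf y \<Longrightarrow> cf (\<lambda>e. (x e, y e) \<in> L)"
  by (rule cf_comp[OF cf_L0 cf_Pair])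

lemma cf_succ [cf_intros]: "cf x \<Longrightarrow> cf y \<Longrightarrow> cf (\<lambda>e. (x e, y e) \<in> succ)"
  by (rule cf_comp[OF cf_succ0 cf_Pair])

section \<open>Enumerating blocks and places by chains of successors\<close>

definition chain :: "nat list \<Rightarrow> nat \<Rightarrow> nat \<Rightarrow> nat \<Rightarrow> bool" where
  "chain xs x n y \<longleftrightarrow> length xs = Suc n \<and> hd xs = x \<and> hd (drop n xs) = y \<and>
     (\<forall>i<n. (hd (drop i xs), hd (drop (Suc i) xs)) \<in> succ)"

lemma relpow_iff_chain: "(x, y) \<in> succ ^^ n \<longleftrightarrow> (\<exists>xs. chain xs x n y)"
proof
  assume "(x, y) \<in> succ ^^ n"
  then obtain f where f: "f 0 = x" "f n = y" "\<And>i. i < n \<Longrightarrow> (f i, f (Suc i)) \<in> succ"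
    unfolding relpow_fun_conv by blast
  have "hd (drop i (map f [0..<Suc n])) = f i" if "i \<le> n" for i
    using that by (subst hd_drop_conv_nth) (simp_all del: upt_Suc)
  then have "chain (map f [0..<Suc n]) x n y"
    using f by (simp add: chain_def hd_map del: upt_Suc)
  then show "\<exists>xs. chain xs x n y" ..
next
  assume "\<exists>xs. chain xs x n y"
  then obtain xs where "chain xs x n y" ..
  then show "(x, y) \<in> succ ^^ n"
    unfolding relpow_fun_conv chain_def
    by (intro exI[of _ "\<lambda>i. hd (drop i xs)"]) simp
qed

definition B_at :: "nat \<Rightarrow> nat \<Rightarrow> nat \<Rightarrow> bool" where
  "B_at s x y \<longleftrightarrow> (\<exists>c\<le>s. \<exists>n\<le>s. chain (dec c) x n y \<or> chain (dec c) y n x)"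

definition shift_at :: "nat \<Rightarrow> nat \<Rightarrow> int \<Rightarrow> bool" where
  "shift_at s l k \<longleftrightarrow> (\<exists>c\<le>s. \<exists>m\<le>s. if 0 \<le> k then chain (dec c) l (nat k) m else chain (dec c) m (nat (- k)) l)"

lemma cf_chain: "cf xs \<Longrightarrow> cf x \<Longrightarrow> cf n \<Longrightarrow> cf y \<Longrightarrow> cf (\<lambda>e. chain (xs e) (x e) (n e) (y e))"
proof -
  assume "cf xs" "cf x" "cf n" "cf y"
  then have *: "cf (\<lambda>e. (xs e, x e, n e, y e))" by (intro cf_intros)
  have "cf (\<lambda>p. chain (fst p) (fst (snd p)) (fst (snd (snd p))) (snd (snd (snd p))))"
    unfolding chain_def by (intro cf_intros)
  from cf_comp[OF this *] show ?thesis by simp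
qed

lemma cf_dec_nat_list: "cf n \<Longrightarrow> cf (\<lambda>x. dec (n x) :: nat list)"
  by (rule cf_comp[OF cf_dec_list[OF cf_dec_nat]])

lemma cf_B_at: "cf s \<Longrightarrow> cf x \<Longrightarrow> cf y \<Longrightarrow> cf (\<lambda>e. B_at (s e) (x e) (y e))"
proof (rule cf_comp3[of B_at])
  show "cf (\<lambda>p. B_at (fst p) (fst (snd p)) (snd (snd p)))"
    unfolding B_at_def by (intro cf_intros cf_chain cf_dec_nat_list)
qed

lemma cf_shift_at: "cf s \<Longrightarrow> cf l \<Longrightarrow> cf k \<Longrightarrow> cf (\<lambda>e. shift_at (s e) (l e) (k e))"
proof (rule cf_comp3[of shift_at])
  show "cf (\<lambda>p. shift_at (fst p) (fst (snd p)) (snd (snd p)))"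
    unfolding shift_at_def by (intro cf_intros cf_chain cf_dec_nat_list)
qed

lemma B_at_mono: "s \<le> t \<Longrightarrow> B_at s x y \<Longrightarrow> B_at t x y"
  unfolding B_at_def by (meson le_trans)

lemma B_iff_B_at: "B x y \<longleftrightarrow> (\<exists>s. B_at s x y)"
proof
  assume "B x y"
  then obtain n xs where "chain xs x n y \<or> chain xs y n x"
    unfolding B_iff_relpow relpow_iff_chain by blast
  then have "B_at (max (enc xs) n) x y"
    unfolding B_at_def by (intro exI[of _ "enc xs"] exI[of _ n] conjI) simp_all
  then show "\<exists>s. B_at s x y" ..
qed (unfold B_at_def B_iff_relpow relpow_iff_chain, blast)

lemma shift_at_mono: "s \<le> t \<Longrightarrow> shift_at s l k \<Longrightarrow> shift_at t l k"
  unfolding shift_at_def by (meson le_trans)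

lemma shift_iff_shift_at: "(\<exists>m. shift l k m) \<longleftrightarrow> (\<exists>s. shift_at s l k)"
proof
  assume "\<exists>m. shift l k m"
  then obtain m xs where "if 0 \<le> k then chain xs l (nat k) m else chain xs m (nat (- k)) l"
    unfolding shift_def relpow_iff_chain by (metis (full_types))
  then have "shift_at (max (enc xs) m) l k"
    unfolding shift_at_def by (intro exI[of _ "enc xs"] exI[of _ m] conjI) simp_all
  then show "\<exists>s. shift_at s l k" ..
next
  assume "\<exists>s. shift_at s l k"
  then show "\<exists>m. shift l k m"
    unfolding shift_def relpow_iff_chain shift_at_def by (metis (full_types))
qed

lemma eventually_shift_at: "shift l k m \<Longrightarrow> \<forall>\<^sub>F s in sequentially. shift_at s l k"
  using shift_iff_shift_at shift_at_mono unfolding eventually_sequentially by metis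

text \<open>Taking the first rational without a base point, in the order of \<open>dec\<close>,
  guarantees that each rational has its turn.\<close>

definition fresh :: "(rat \<times> nat) list \<Rightarrow> rat" where
  "fresh A = dec (LEAST i. dec i \<notin> set (map fst A))"

lemma ex_fresh: "\<exists>i. (dec i :: rat) \<notin> set (map fst (A :: (rat \<times> nat) list))"
proof -
  obtain q :: rat where "q \<notin> set (map fst A)"
    using ex_new_if_finite[OF infinite_UNIV_char_0, of "set (map fst A)"] by auto
  then show ?thesis by (intro exI[of _ "enc q"]) simp
qed

lemma fresh_notin: "fresh A \<notin> fst ` set A"
  using LeastI_ex[OF ex_fresh[of A]] by (simp add: fresh_def)

lemma cf_fresh: "cf A \<Longrightarrow> cf (\<lambda>x. fresh (A x))"
proof (rule cf_comp[of fresh])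
  have "cf (\<lambda>p. (dec (snd p) :: rat) \<notin> set (map fst (fst p :: (rat \<times> nat) list)))"
    by (intro cf_intros cf_comp[OF cf_dec_rat])
  then have "cf (\<lambda>A :: (rat \<times> nat) list. LEAST i. (dec i :: rat) \<notin> set (map fst A))"
    by (rule cf_Least[OF _ _ ex_fresh]) (intro cf_intros)
  then show "cf fresh" unfolding fresh_def by (rule cf_comp[OF cf_dec_rat])
qed

text \<open>Labels are listed only outwards from the base, one place beyond a listed one. This puts
  each label behind its neighbour towards \<open>0\<close>, as the second construction
  requires.\<close>

definition grow :: "nat \<Rightarrow> (rat \<times> nat) list \<Rightarrow> (rat \<times> int) list \<Rightarrow> (rat \<times> int) list" where
  "grow s A h =
     concat (map (\<lambda>x. concat (map (\<lambda>y. if fst x = fst y \<and> 0 \<le> snd x \<and> shift_at s (snd y) (snd x + 1)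
       then [(fst x, snd x + 1)] else []) A)) h) @
     concat (map (\<lambda>x. concat (map (\<lambda>y. if fst x = fst y \<and> snd x \<le> 0 \<and> shift_at s (snd y) (snd x - 1)
       then [(fst x, snd x - 1)] else []) A)) h)"

lemma set_grow: "z \<in> set (grow s A h) \<longleftrightarrow>
    (\<exists>q k l. (q, k) \<in> set h \<and> (q, l) \<in> set A \<and>
      (0 \<le> k \<and> shift_at s l (k + 1) \<and> z = (q, k + 1) \<or> k \<le> 0 \<and> shift_at s l (k - 1) \<and> z = (q, k - 1)))"
  unfolding grow_def by (auto split: if_splits; force)

definition new :: "(rat \<times> nat) list \<Rightarrow> (rat \<times> nat) list \<Rightarrow> rat \<times> nat" where
  "new A A' = hd (drop (length A) A')"

text \<open>Even lengths serve to reach every block: the element \<open>fst v\<close> is put under a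
  rational for which nothing is listed. Odd lengths serve to reach every rational:
  \<open>fresh A\<close> gets a base point strictly between the guessed bounds, with all places
  already listed for it. Only order in \<open>L\<close> is demanded, not distinctness of blocks, so
  the condition is decidable in the class.\<close>

definition good_new :: "(rat \<times> nat) list \<Rightarrow> nat \<times> nat \<Rightarrow> (rat \<times> int) list \<Rightarrow> nat \<Rightarrow> rat \<times> nat \<Rightarrow> bool" where
  "good_new A v h w z \<longleftrightarrow>
     (\<forall>x\<in>set A. fst x < fst z \<and> (snd x, snd z) \<in> L \<or> fst z < fst x \<and> (snd z, snd x) \<in> L) \<and>
     (if even (length A) then snd z = fst v \<and> fst z \<notin> set (map fst h)
      else fst z = fresh A \<and> (fst v, snd z) \<in> L \<and> (snd z, snd v) \<in> L \<and>
        (\<forall>x\<in>set h. fst x = fst z \<longrightarrow> shift_at w (snd z) (snd x)))"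

text \<open>The first component of a commitment only bounds the search for the witnesses of \<open>shift_at\<close>.\<close>

definition good1 :: "nat \<times> (rat \<times> nat) list \<Rightarrow> nat \<times> nat \<Rightarrow> (rat \<times> int) list \<Rightarrow>
    nat \<times> (rat \<times> nat) list \<Rightarrow> (rat \<times> int) list \<Rightarrow> bool" where
  "good1 c v h c' h' \<longleftrightarrow> snd c' = snd c @ [new (snd c) (snd c')] \<and>
     good_new (snd c) v h (fst c') (new (snd c) (snd c')) \<and>
     h' = h @ (fst (new (snd c) (snd c')), 0) # grow (length (snd c)) (snd c') h"

text \<open>Distinctness of blocks is absent: a commitment that rests on a false guess may use one
  block twice. \<open>tr1\<close> adds it for the true ones.\<close>

definition inv1 :: "nat \<times> (rat \<times> nat) list \<Rightarrow> (rat \<times> int) list \<Rightarrow> bool" where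
  "inv1 c h \<longleftrightarrow>
     (\<forall>x\<in>set (snd c). \<forall>y\<in>set (snd c). (fst x < fst y \<longrightarrow> (snd x, snd y) \<in> L) \<and> (fst x = fst y \<longrightarrow> x = y)) \<and>
     (\<forall>q l k. (q, l) \<in> set (snd c) \<longrightarrow> (q, k) \<in> set h \<longrightarrow> (\<exists>m. shift l k m)) \<and>
     (\<forall>i<length h. (0 < snd (h ! i) \<longrightarrow> (fst (h ! i), snd (h ! i) - 1) \<in> set (take i h)) \<and>
       (snd (h ! i) < 0 \<longrightarrow> (fst (h ! i), snd (h ! i) + 1) \<in> set (take i h))) \<and>
     (\<forall>x\<in>set (snd c). (fst x, 0) \<in> set h)"

definition tr1 :: "nat \<times> (rat \<times> nat) list \<Rightarrow> bool" where
  "tr1 c \<longleftrightarrow> (\<forall>x\<in>set (snd c). \<forall>y\<in>set (snd c). B (snd x) (snd y) \<longrightarrow> x = y)"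

definition uncovered_at :: "(rat \<times> nat) list \<Rightarrow> nat \<Rightarrow> nat \<Rightarrow> bool" where
  "uncovered_at A s l \<longleftrightarrow> (\<forall>x\<in>set A. \<not> B_at s l (snd x))"

text \<open>\<open>n\<close> codes the two bounds between which a base point for
  \<open>fresh A\<close> is to be sought. Later stages can only refute it, by finding two of the
  blocks equal.\<close>

definition gap_at :: "(rat \<times> nat) list \<Rightarrow> nat \<Rightarrow> nat \<Rightarrow> bool" where
  "gap_at A s n \<longleftrightarrow> prod_decode n \<in> L \<and> \<not> B_at s (\<pi>\<^sub>1 n) (\<pi>\<^sub>2 n) \<and>
     (\<forall>x\<in>set A. (fst x < fresh A \<longrightarrow> (snd x, \<pi>\<^sub>1 n) \<in> L \<and> \<not> B_at s (snd x) (\<pi>\<^sub>1 n)) \<and>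
       (fresh A < fst x \<longrightarrow> (\<pi>\<^sub>2 n, snd x) \<in> L \<and> \<not> B_at s (\<pi>\<^sub>2 n) (snd x)))"

text \<open>In both cases the guess is the least number not yet refuted, with the stage
  \<open>s\<close> as default that bounds the search.\<close>

definition guess :: "nat \<times> (rat \<times> nat) list \<Rightarrow> nat \<Rightarrow> nat \<times> nat" where
  "guess c s = (if even (length (snd c)) then (LEAST l. uncovered_at (snd c) s l \<or> l = s, 0)
     else prod_decode (LEAST n. gap_at (snd c) s n \<or> n = s))"

lemma cf_uncovered_at: "cf A \<Longrightarrow> cf s \<Longrightarrow> cf l \<Longrightarrow> cf (\<lambda>e. uncovered_at (A e) (s e) (l e))"
proof (rule cf_comp3[of uncovered_at])
  show "cf (\<lambda>p. uncovered_at (fst p) (fst (snd p)) (snd (snd p)))"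
    unfolding uncovered_at_def by (intro cf_intros cf_B_at)
qed

lemma cf_gap_at: "cf A \<Longrightarrow> cf s \<Longrightarrow> cf n \<Longrightarrow> cf (\<lambda>e. gap_at (A e) (s e) (n e))"
proof (rule cf_comp3[of gap_at])
  show "cf (\<lambda>p. gap_at (fst p) (fst (snd p)) (snd (snd p)))"
    unfolding gap_at_def by (intro cf_intros cf_B_at cf_fresh cf_comp[OF cf_L0])
qed

lemma cf_guess: "cf (\<lambda>p. guess (fst p) (snd p))"
proof -
  have 1: "cf (\<lambda>p :: (nat \<times> (rat \<times> nat) list) \<times> nat. LEAST l. uncovered_at (snd (fst p)) (snd p) l \<or> l = snd p)"
  proof (rule cf_bounded_Least[where b = snd])
    show "cf (\<lambda>p :: ((nat \<times> (rat \<times> nat) list) \<times> nat) \<times> nat.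
        uncovered_at (snd (fst (fst p))) (snd (fst p)) (snd p) \<or> snd p = snd (fst p))"
      by (intro cf_intros cf_uncovered_at)
  qed (auto intro: cf_intros)
  have 2: "cf (\<lambda>p :: (nat \<times> (rat \<times> nat) list) \<times> nat. LEAST n. gap_at (snd (fst p)) (snd p) n \<or> n = snd p)"
  proof (rule cf_bounded_Least[where b = snd])
    show "cf (\<lambda>p :: ((nat \<times> (rat \<times> nat) list) \<times> nat) \<times> nat.
        gap_at (snd (fst (fst p))) (snd (fst p)) (snd p) \<or> snd p = snd (fst p))"
      by (intro cf_intros cf_gap_at)
  qed (auto intro: cf_intros)
  show ?thesis unfolding guess_def by (intro cf_intros 1 2)
qed

lemma cf_grow: "cf s \<Longrightarrow> cf A \<Longrightarrow> cf h \<Longrightarrow> cf (\<lambda>e. grow (s e) (A e) (h e))"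
proof (rule cf_comp3[of grow])
  show "cf (\<lambda>p. grow (fst p) (fst (snd p)) (snd (snd p)))"
    unfolding grow_def by (intro cf_intros cf_shift_at)
qed

lemma cf_new: "cf A \<Longrightarrow> cf A' \<Longrightarrow> cf (\<lambda>e. new (A e) (A' e))"
  unfolding new_def by (intro cf_intros)

lemma cf_good_new:
  assumes "cf A" "cf v" "cf h" "cf w" "cf z"
  shows "cf (\<lambda>e. good_new (A e) (v e) (h e) (w e) (z e))"
proof -
  have "cf (\<lambda>p. good_new (fst p) (fst (snd p)) (fst (snd (snd p))) (fst (snd (snd (snd p)))) (snd (snd (snd (snd p)))))"
    unfolding good_new_def by (intro cf_intros cf_fresh cf_shift_at)
  from cf_comp[OF this, of "\<lambda>e. (A e, v e, h e, w e, z e)"] show ?thesis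
    using assms by (simp add: cf_intros)
qed

lemma cf_good1: "cf (\<lambda>p. good1 (fst p) (fst (snd p)) (fst (snd (snd p))) (fst (snd (snd (snd p))))
      (snd (snd (snd (snd p)))))"
  unfolding good1_def by (intro cf_intros cf_good_new cf_new cf_grow)

end

context label_construction
begin

section \<open>Invariants, guesses and good steps of the first construction\<close>

lemma set_good1:
  assumes "good1 c v h c' h'"
  obtains q l where "snd c' = snd c @ [(q, l)]" "good_new (snd c) v h (fst c') (q, l)"
    "h' = h @ (q, 0) # grow (length (snd c)) (snd c') h"
proof -
  obtain q l where "new (snd c) (snd c') = (q, l)" by (cases "new (snd c) (snd c')")
  with assms that show thesis unfolding good1_def by (metis fst_conv)
qed

lemma good1I:
  assumes "good_new A v h w (q, l)"
  shows "good1 (w\<^sub>0, A) v h (w, A @ [(q, l)]) (h @ (q, 0) # grow (length A) (A @ [(q, l)]) h)"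
  using assms by (simp add: good1_def new_def)

lemma good1_inv1:
  assumes inv: "inv1 c h" and good: "good1 c v h c' h'"
  shows "inv1 c' h'"
proof -
  obtain q l where c': "snd c' = snd c @ [(q, l)]" and new: "good_new (snd c) v h (fst c') (q, l)"
    and h': "h' = h @ (q, 0) # grow (length (snd c)) (snd c') h"
    using set_good1[OF good] .
  define A where "A = snd c"
  define g where "g = grow (length A) (snd c') h"
  have less: "x \<in> set A \<Longrightarrow> fst x < q \<and> (snd x, l) \<in> L \<or> q < fst x \<and> (l, snd x) \<in> L" for x
    using new by (auto simp: good_new_def A_def)
  have inv': "\<And>x y. x \<in> set A \<Longrightarrow> y \<in> set A \<Longrightarrow> fst x < fst y \<Longrightarrow> (snd x, snd y) \<in> L"
    "\<And>x y. x \<in> set A \<Longrightarrow> y \<in> set A \<Longrightarrow> fst x = fst y \<Longrightarrow> x = y"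
    "\<And>q l k. (q, l) \<in> set A \<Longrightarrow> (q, k) \<in> set h \<Longrightarrow> \<exists>m. shift l k m"
    "\<And>i. i < length h \<Longrightarrow> 0 < snd (h ! i) \<Longrightarrow> (fst (h ! i), snd (h ! i) - 1) \<in> set (take i h)"
    "\<And>i. i < length h \<Longrightarrow> snd (h ! i) < 0 \<Longrightarrow> (fst (h ! i), snd (h ! i) + 1) \<in> set (take i h)"
    "\<And>x. x \<in> set A \<Longrightarrow> (fst x, 0) \<in> set h"
    using inv unfolding inv1_def A_def by blast+
  have ord: "(fst x < fst y \<longrightarrow> (snd x, snd y) \<in> L) \<and> (fst x = fst y \<longrightarrow> x = y)"
    if "x \<in> set (snd c')" "y \<in> set (snd c')" for x y
    using that less[of x] less[of y] inv'(1,2)[of x y] unfolding c' A_def[symmetric] by auto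
  have uniq: "l' = l''" if "(p, l') \<in> set (snd c')" "(p, l'') \<in> set (snd c')" for p l' l''
    using ord[OF that] by simp
  have sz: "\<exists>m. shift l' k m" if A': "(p, l') \<in> set (snd c')" and k: "(p, k) \<in> set h'" for p l' k
  proof -
    consider "(p, k) \<in> set h" | "k = 0" | "(p, k) \<in> set g" using k by (auto simp: h' g_def A_def)
    then show ?thesis
    proof cases
      case 1
      show ?thesis
      proof (cases "(p, l') \<in> set A")
        case False
        then have "p = q" "l' = l" using A' by (auto simp: c' A_def)
        have "q \<in> set (map fst h)" using 1 \<open>p = q\<close> image_eqI[of q fst "(q, k)"] by simp
        \<comment> \<open>In the even case \<open>q\<close> has no listed label at all, so only the
          odd case remains.\<close>
        then have "\<forall>x\<in>set h. fst x = q \<longrightarrow> shift_at (fst c') l (snd x)"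
          using new[unfolded good_new_def, THEN conjunct2] by (simp split: if_splits)
        then have "shift_at (fst c') l k" using 1 \<open>p = q\<close> by auto
        then show ?thesis using shift_iff_shift_at \<open>l' = l\<close> by blast
      qed (rule inv'(3)[OF _ 1])
    next
      case 2
      then show ?thesis by (simp add: shift_0)
    next
      case 3
      then obtain l'' where "(p, l'') \<in> set (snd c')" "shift_at (length A) l'' k"
        unfolding g_def set_grow by auto
      then show ?thesis using shift_iff_shift_at uniq[OF A'] by metis
    qed
  qed
  have prev: "(0 < snd (h' ! i) \<longrightarrow> (fst (h' ! i), snd (h' ! i) - 1) \<in> set (take i h')) \<and>
      (snd (h' ! i) < 0 \<longrightarrow> (fst (h' ! i), snd (h' ! i) + 1) \<in> set (take i h'))" if "i < length h'" for i
  proof (cases "i < length h")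
    case True
    then show ?thesis using inv'(4,5)[of i] by (simp add: h' nth_append)
  next
    case False
    then have sub: "set h \<subseteq> set (take i h')" by (auto simp: h')
    have "h' ! i \<in> set ((q, 0) # g)"
      using False that unfolding h' g_def A_def by (metis (no_types, lifting) length_append nat_add_left_cancel_less le_iff_add not_less nth_append_length_plus nth_mem)
    then consider "h' ! i = (q, 0)" | "h' ! i \<in> set g" by auto
    then show ?thesis
    proof cases
      case 2
      then show ?thesis unfolding g_def set_grow using sub by auto
    qed simp
  qed
  have "\<forall>x\<in>set (snd c'). (fst x, 0) \<in> set h'" using inv'(6) by (auto simp: c' h' A_def)
  then show ?thesis unfolding inv1_def using ord sz prev by blast
qed

lemma inv1_below: "prefix (snd d) (snd c) \<Longrightarrow> inv1 d h \<Longrightarrow> inv1 c h \<Longrightarrow> good1 c v h c' h' \<Longrightarrow> inv1 d h'"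
proof -
  assume "prefix (snd d) (snd c)" "inv1 d h" "inv1 c h" and good: "good1 c v h c' h'"
  have c': "inv1 c' h'" using good1_inv1 \<open>inv1 c h\<close> good by blast
  have sub: "set (snd d) \<subseteq> set (snd c')"
  proof -
    have "prefix (snd c) (snd c')" using good unfolding good1_def by (metis prefixI)
    with \<open>prefix (snd d) (snd c)\<close> show ?thesis by (meson prefix_order.trans set_mono_prefix)
  qed
  have "set h \<subseteq> set h'" using good unfolding good1_def by (metis prefixI set_mono_prefix)
  then show ?thesis using c' sub \<open>inv1 d h\<close> unfolding inv1_def by blast
qed

lemma uncovered_antimono: "s \<le> t \<Longrightarrow> uncovered_at A t l \<Longrightarrow> uncovered_at A s l"
  unfolding uncovered_at_def using B_at_mono by blast

lemma gap_antimono: "s \<le> t \<Longrightarrow> gap_at A t n \<Longrightarrow> gap_at A s n"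
  unfolding gap_at_def using B_at_mono by blast

lemma ex_uncovered: "\<exists>l. \<forall>s. uncovered_at A s l"
proof -
  obtain q where "q \<notin> (\<beta> \<circ> snd) ` set A"
    using ex_new_if_finite[OF infinite_UNIV_char_0, of "(\<beta> \<circ> snd) ` set A"] by auto
  moreover obtain l where "\<beta> l = q" using \<beta>_surj by (metis surjD)
  ultimately have "\<not> B l (snd x)" if "x \<in> set A" for x
    using that \<beta>_eq_iff[of l "snd x"] by (auto simp: image_iff)
  then show ?thesis unfolding uncovered_at_def B_iff_B_at by blast
qed

lemma \<beta>_less_of_ordered:
  assumes "inv1 c h" "tr1 c" "x \<in> set (snd c)" "y \<in> set (snd c)" "fst x < fst y"
  shows "\<beta> (snd x) < \<beta> (snd y)"
  using assms unfolding inv1_def tr1_def \<beta>_less_iff by blast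

text \<open>For a true commitment \<open>\<beta>\<close> is strictly increasing on base points, so
  density leaves room for two block values between those to the left and those to the right of the
  fresh rational.\<close>

lemma ex_gap:
  assumes inv: "inv1 c h" and tr: "tr1 c"
  shows "\<exists>n. \<forall>s. gap_at (snd c) s n"
proof -
  define A where "A = snd c"
  define q where "q = fresh A"
  define X where "X = (\<beta> \<circ> snd) ` {x \<in> set A. fst x < q}"
  define Y where "Y = (\<beta> \<circ> snd) ` {x \<in> set A. q < fst x}"
  have "\<exists>a. (\<forall>x\<in>X. x < a) \<and> (\<forall>y\<in>Y. a < y) \<and> a \<notin> {}"
  proof (rule finite_sets_separated)
    fix x y assume "x \<in> X" "y \<in> Y"
    then obtain x' y' where "x = \<beta> (snd x')" "y = \<beta> (snd y')" "x' \<in> set A" "y' \<in> set A" "fst x' < q" "q < fst y'"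
      unfolding X_def Y_def by auto
    then show "x < y" using \<beta>_less_of_ordered[OF inv tr] unfolding A_def by simp
  qed (simp_all add: X_def Y_def)
  then obtain a' where a': "\<And>x. x \<in> X \<Longrightarrow> x < a'" "\<And>y. y \<in> Y \<Longrightarrow> a' < y" by blast
  obtain b' where b': "a' < b'" "\<And>y. y \<in> Y \<Longrightarrow> a' < y \<Longrightarrow> b' < y"
  proof -
    have "finite Y" by (simp add: Y_def)
    then have "\<exists>k>a'. (\<forall>b\<in>Y. a' < b \<longrightarrow> k < b) \<and> k \<notin> {}" by (rule finite_set_right_gap) simp
    with that show ?thesis by blast
  qed
  obtain a b where ab: "\<beta> a = a'" "\<beta> b = b'" using \<beta>_surj by (metis surjD)
  have "gap_at A s (prod_encode (a, b))" for s
  proof -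
    have less: "\<beta> u < \<beta> v \<Longrightarrow> (u, v) \<in> L \<and> \<not> B_at s u v" for u v
      using \<beta>_less_iff B_iff_B_at by blast
    have "(a, b) \<in> L \<and> \<not> B_at s a b" using less ab b'(1) by simp
    moreover have "(snd x, a) \<in> L \<and> \<not> B_at s (snd x) a" if "x \<in> set A" "fst x < q" for x
      using a'(1)[of "\<beta> (snd x)"] that ab by (intro less) (auto simp: X_def)
    moreover have "(b, snd x) \<in> L \<and> \<not> B_at s b (snd x)" if "x \<in> set A" "q < fst x" for x
      using a'(2)[of "\<beta> (snd x)"] b'(2)[of "\<beta> (snd x)"] that ab by (intro less) (auto simp: Y_def)
    ultimately show ?thesis unfolding gap_at_def q_def[symmetric] by simp
  qed
  then show ?thesis unfolding A_def by blast
qed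

lemma fresh_label:
  assumes inv: "inv1 c h" and l: "\<And>x. x \<in> set (snd c) \<Longrightarrow> \<not> B l (snd x)"
  shows "\<exists>q. q \<notin> set (map fst h) \<and> (\<forall>x\<in>set (snd c). fst x < q \<and> (snd x, l) \<in> L \<or> q < fst x \<and> (l, snd x) \<in> L)"
proof -
  let ?A = "set (snd c)"
  have neq: "(snd x, l) \<in> L \<or> (l, snd x) \<in> L" if "x \<in> ?A" for x
    using l[OF that] L_total[of "snd x" l] \<beta>_eq_iff[of l "snd x"] by auto
  have "\<exists>q. (\<forall>a\<in>fst ` {x \<in> ?A. (snd x, l) \<in> L}. a < q) \<and> (\<forall>b\<in>fst ` {x \<in> ?A. (l, snd x) \<in> L}. q < b) \<and>
      q \<notin> set (map fst h)"
  proof (rule finite_sets_separated)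
    fix a b assume "a \<in> fst ` {x \<in> ?A. (snd x, l) \<in> L}" "b \<in> fst ` {x \<in> ?A. (l, snd x) \<in> L}"
    then obtain x y where xy: "a = fst x" "b = fst y" "x \<in> ?A" "y \<in> ?A" "(snd x, l) \<in> L" "(l, snd y) \<in> L" by blast
    then have "(snd x, snd y) \<in> L" using L_trans by blast
    then have "\<not> fst y < fst x" "fst x \<noteq> fst y"
      using inv xy L_asym unfolding inv1_def by blast+
    then show "a < b" using xy by simp
  qed simp_all
  then obtain q where q: "\<forall>a\<in>fst ` {x \<in> ?A. (snd x, l) \<in> L}. a < q" "\<forall>b\<in>fst ` {x \<in> ?A. (l, snd x) \<in> L}. q < b"
    "q \<notin> set (map fst h)" by blast
  then have "fst x < q \<and> (snd x, l) \<in> L \<or> q < fst x \<and> (l, snd x) \<in> L" if "x \<in> ?A" for x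
    using neq[OF that] that by blast
  with q(3) show ?thesis by blast
qed

definition true_guess :: "nat \<times> (rat \<times> nat) list \<Rightarrow> nat \<times> nat" where
  "true_guess c = (if even (length (snd c)) then (LEAST l. \<forall>s. uncovered_at (snd c) s l, 0)
     else prod_decode (LEAST n. \<forall>s. gap_at (snd c) s n))"

lemma guess_limit:
  assumes "inv1 c h" "tr1 c"
  shows "\<forall>\<^sub>F s in sequentially. guess c s = true_guess c"
proof (cases "even (length (snd c))")
  case True
  have "\<forall>\<^sub>F s in sequentially. (LEAST l. uncovered_at (snd c) s l \<or> l = s) = (LEAST l. \<forall>s. uncovered_at (snd c) s l)"
    by (rule Least_stabilises[OF _ ex_uncovered]) (rule uncovered_antimono)
  then show ?thesis
    unfolding guess_def true_guess_def by (rule eventually_mono) (simp add: True)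
next
  case False
  have "\<forall>\<^sub>F s in sequentially. (LEAST n. gap_at (snd c) s n \<or> n = s) = (LEAST n. \<forall>s. gap_at (snd c) s n)"
    by (rule Least_stabilises[OF _ ex_gap[OF assms]]) (rule gap_antimono)
  then show ?thesis
    unfolding guess_def true_guess_def by (rule eventually_mono) (simp add: False)
qed

lemma true_guess_even:
  assumes "even (length (snd c))"
  shows "x \<in> set (snd c) \<Longrightarrow> \<not> B (fst (true_guess c)) (snd x)"
    and "l < fst (true_guess c) \<Longrightarrow> \<exists>x\<in>set (snd c). B l (snd x)"
proof -
  let ?l = "LEAST l. \<forall>s. uncovered_at (snd c) s l"
  have eq: "fst (true_guess c) = ?l" using assms by (simp add: true_guess_def)
  show "\<not> B (fst (true_guess c)) (snd x)" if "x \<in> set (snd c)"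
    using LeastI_ex[OF ex_uncovered[of "snd c"]] that unfolding eq uncovered_at_def B_iff_B_at by blast
  show "\<exists>x\<in>set (snd c). B l (snd x)" if "l < fst (true_guess c)"
    using not_less_Least[of l "\<lambda>l. \<forall>s. uncovered_at (snd c) s l"] that
    unfolding eq uncovered_at_def B_iff_B_at by blast
qed

lemma true_guess_odd:
  assumes "inv1 c h" "tr1 c" "odd (length (snd c))"
  shows "\<beta> (fst (true_guess c)) < \<beta> (snd (true_guess c))"
    and "x \<in> set (snd c) \<Longrightarrow> fst x < fresh (snd c) \<Longrightarrow> \<beta> (snd x) < \<beta> (fst (true_guess c))"
    and "x \<in> set (snd c) \<Longrightarrow> fresh (snd c) < fst x \<Longrightarrow> \<beta> (snd (true_guess c)) < \<beta> (snd x)"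
proof -
  let ?n = "LEAST n. \<forall>s. gap_at (snd c) s n"
  have eq: "true_guess c = prod_decode ?n" using assms(3) by (simp add: true_guess_def)
  have gap: "gap_at (snd c) s ?n" for s using LeastI_ex[OF ex_gap[OF assms(1,2)]] by blast
  show "\<beta> (fst (true_guess c)) < \<beta> (snd (true_guess c))"
    using gap unfolding eq gap_at_def \<beta>_less_iff B_iff_B_at by simp
  show "x \<in> set (snd c) \<Longrightarrow> fst x < fresh (snd c) \<Longrightarrow> \<beta> (snd x) < \<beta> (fst (true_guess c))"
    and "x \<in> set (snd c) \<Longrightarrow> fresh (snd c) < fst x \<Longrightarrow> \<beta> (snd (true_guess c)) < \<beta> (snd x)"
    using gap unfolding eq gap_at_def \<beta>_less_iff B_iff_B_at by blast+
qed

lemma good1_exists: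
  assumes inv: "inv1 c h" and tr: "tr1 c"
  shows "\<exists>c' h'. good1 c (true_guess c) h c' h'"
proof -
  obtain w A where c: "c = (w, A)" by (cases c)
  have "\<exists>w' q l. good_new A (true_guess c) h w' (q, l)"
  proof (cases "even (length A)")
    case True
    define l where "l = fst (true_guess c)"
    obtain q where "q \<notin> set (map fst h)" "\<forall>x\<in>set A. fst x < q \<and> (snd x, l) \<in> L \<or> q < fst x \<and> (l, snd x) \<in> L"
      using fresh_label[OF inv, of l] true_guess_even(1)[of c] True unfolding c l_def by auto
    then have "good_new A (true_guess c) h 0 (q, l)" using True by (simp add: good_new_def l_def)
    then show ?thesis by blast
  next
    case False
    define a b where "a = fst (true_guess c)" and "b = snd (true_guess c)"
    have ab: "\<beta> a < \<beta> b" "\<And>x. x \<in> set A \<Longrightarrow> fst x < fresh A \<Longrightarrow> \<beta> (snd x) < \<beta> a"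
      "\<And>x. x \<in> set A \<Longrightarrow> fresh A < fst x \<Longrightarrow> \<beta> b < \<beta> (snd x)"
      using true_guess_odd[OF inv tr] False unfolding a_def b_def c by auto
    \<comment> \<open>\<open>n\<close> bounds the listed places of all rationals, so a block with
      \<open>n\<close> places on both sides of its base point has room for whatever is listed for
      the fresh one.\<close>
    define n where "n = Max (insert 0 ((\<lambda>x. nat \<bar>snd x\<bar>) ` set h))"
    have n: "\<bar>snd x\<bar> \<le> int n" if "x \<in> set h" for x
    proof -
      have "nat \<bar>snd x\<bar> \<le> n" unfolding n_def using that by (intro Max_ge) auto
      then show ?thesis by linarith
    qed
    obtain l u v where l: "\<beta> a < \<beta> l" "\<beta> l < \<beta> b" "(u, l) \<in> succ ^^ n" "(l, v) \<in> succ ^^ n"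
      using large_block[OF ab(1)] by blast
    have "\<forall>\<^sub>F w' in sequentially. \<forall>x\<in>set h. shift_at w' l (snd x)"
    proof (rule eventually_ball_finite, simp, rule ballI)
      fix x assume "x \<in> set h"
      then obtain m where "shift l (snd x) m" using shift_exists_bounded[OF l(3,4) n] by blast
      then show "\<forall>\<^sub>F w' in sequentially. shift_at w' l (snd x)" by (rule eventually_shift_at)
    qed
    from eventually_happens'[OF sequentially_bot this]
    obtain w' where w': "\<forall>x\<in>set h. shift_at w' l (snd x)" ..
    have "fst x < fresh A \<and> (snd x, l) \<in> L \<or> fresh A < fst x \<and> (l, snd x) \<in> L" if "x \<in> set A" for x
    proof (cases "fst x" "fresh A" rule: linorder_cases)
      case less
      then show ?thesis using ab(2)[OF that] l(1) \<beta>_lessD by (meson order.strict_trans)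
    next
      case equal
      then show ?thesis using fresh_notin[of A] that by (metis imageI)
    next
      case greater
      then show ?thesis using ab(3)[OF that] l(2) \<beta>_lessD by (meson order.strict_trans)
    qed
    then have "good_new A (true_guess c) h w' (fresh A, l)"
      using False w' l(1,2) \<beta>_lessD by (simp add: good_new_def a_def b_def)
    then show ?thesis by blast
  qed
  then show ?thesis unfolding c using good1I by blast
qed

lemma good1_tr1:
  assumes inv: "inv1 c h" and tr: "tr1 c" and good: "good1 c (true_guess c) h c' h'"
  shows "tr1 c'"
proof -
  obtain q l where c': "snd c' = snd c @ [(q, l)]" and new: "good_new (snd c) (true_guess c) h (fst c') (q, l)"
    using set_good1[OF good] .
  have l: "\<beta> l \<noteq> \<beta> (snd x)" if x: "x \<in> set (snd c)" for x
  proof (cases "even (length (snd c))")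
    case True
    then show ?thesis using new true_guess_even(1)[OF True x] by (simp add: good_new_def \<beta>_eq_iff)
  next
    case False
    \<comment> \<open>The inequalities are weak, as \<open>l\<close> may share the block of a bound.
      This does no harm because the blocks of the bounds are strictly apart from those of the old
      base points.\<close>
    then have "q = fresh (snd c)" "\<beta> (fst (true_guess c)) \<le> \<beta> l" "\<beta> l \<le> \<beta> (snd (true_guess c))"
      using new \<beta>_mono by (auto simp: good_new_def)
    moreover have "fst x < q \<or> q < fst x" using new x by (auto simp: good_new_def)
    ultimately show ?thesis
      using true_guess_odd(2,3)[OF inv tr False x] by auto
  qed
  show ?thesis
    unfolding tr1_def \<beta>_eq_iff[symmetric]
  proof (intro ballI impI)
    fix x y assume xy: "x \<in> set (snd c')" "y \<in> set (snd c')" "\<beta> (snd x) = \<beta> (snd y)"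
    then have "x \<in> set (snd c) \<or> x = (q, l)" "y \<in> set (snd c) \<or> y = (q, l)" by (auto simp: c')
    moreover have "x = y" if "x \<in> set (snd c)" "y \<in> set (snd c)"
      using tr that xy(3) unfolding tr1_def \<beta>_eq_iff[symmetric] by blast
    ultimately show "x = y" using l[of x] l[of y] xy(3) by (metis snd_conv)
  qed
qed

text \<open>The truth predicate includes the existence of a compatible object: convergence of the
  guess relies on the order properties in \<open>inv1\<close>, and \<open>Tr_guess\<close> demands
  convergence without being given an object.\<close>

sublocale finite_injury C guess good1 "(0, [])" "[]" inv1 "\<lambda>c d. prefix (snd c) (snd d)" "\<lambda>c. (\<exists>h. inv1 c h) \<and> tr1 c"
proof
  show "cf (\<lambda>p. guess (fst p) (snd p))" by (rule cf_guess)
  show "cf (\<lambda>p. good1 (fst p) (fst (snd p)) (fst (snd (snd p))) (fst (snd (snd (snd p)))) (snd (snd (snd (snd p)))))"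
    by (rule cf_good1)
  show "cf (dec :: nat \<Rightarrow> nat \<times> (rat \<times> nat) list)" "cf (dec :: nat \<Rightarrow> (rat \<times> int) list)"
    by (intro cf_intros)+
  show "inv1 (0, []) []" by (simp add: inv1_def)
  then show "(\<exists>h. inv1 (0, []) h) \<and> tr1 (0, [])" by (auto simp: tr1_def)
next
  fix c assume "(\<exists>h. inv1 c h) \<and> tr1 c"
  then show "\<exists>v. (\<forall>\<^sub>F s in sequentially. guess c s = v) \<and>
      (\<forall>h. inv1 c h \<longrightarrow> (\<exists>c' h'. good1 c v h c' h') \<and> (\<forall>c' h'. good1 c v h c' h' \<longrightarrow> (\<exists>h. inv1 c' h) \<and> tr1 c'))"
    using guess_limit good1_exists good1_tr1 good1_inv1 by (intro exI[of _ "true_guess c"]) blast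
next
  fix c d :: "nat \<times> (rat \<times> nat) list" and v h c' h'
  show "good1 c v h c' h' \<Longrightarrow> prefix (snd c) (snd c')" unfolding good1_def by (metis prefixI)
  show "inv1 c h \<Longrightarrow> good1 c v h c' h' \<Longrightarrow> inv1 c' h'" by (rule good1_inv1)
  show "prefix (snd d) (snd c) \<Longrightarrow> inv1 d h \<Longrightarrow> inv1 c h \<Longrightarrow> good1 c v h c' h' \<Longrightarrow> inv1 d h'"
    by (rule inv1_below)
qed (auto intro: prefix_order.trans)

section \<open>The limit of the first construction\<close>

lemma new_guess_covers:
  assumes "good1 c (true_guess c) h c' h'" "even (length (snd c))" "\<And>l. l < n \<Longrightarrow> \<exists>x\<in>set (snd c). B l (snd x)"
  shows "l < Suc n \<Longrightarrow> \<exists>x\<in>set (snd c'). B l (snd x)"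
proof -
  assume l: "l < Suc n"
  obtain q m where c': "snd c' = snd c @ [(q, m)]" and new: "good_new (snd c) (true_guess c) h (fst c') (q, m)"
    using set_good1[OF assms(1)] .
  have m: "m = fst (true_guess c)" using new assms(2) by (simp add: good_new_def)
  \<comment> \<open>The true guess is uncovered and the numbers below \<open>n\<close> are covered.
    Being the least uncovered one, it extends the covered initial segment by at least one.\<close>
  have "\<not> m < n" using assms(3) true_guess_even(1)[OF assms(2)] m by blast
  then consider "l < m" | "l = m" using l by linarith
  then show ?thesis
  proof cases
    case 1
    then show ?thesis using true_guess_even(2)[OF assms(2), of l] unfolding c' m by auto
  next
    case 2
    have "B m m" unfolding \<beta>_eq_iff[symmetric] by simp
    then show ?thesis unfolding c' 2 by simp
  qed
qed

lemma new_fresh_covers: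
  assumes "good1 c v h c' h'" "odd (length (snd c))" "\<And>i. i < n \<Longrightarrow> dec i \<in> fst ` set (snd c)"
  shows "i < Suc n \<Longrightarrow> dec i \<in> fst ` set (snd c')"
proof -
  assume i: "i < Suc n"
  obtain q m where c': "snd c' = snd c @ [(q, m)]" and new: "good_new (snd c) v h (fst c') (q, m)"
    using set_good1[OF assms(1)] .
  have q: "q = fresh (snd c)" using new assms(2) by (simp add: good_new_def)
  show ?thesis
  proof (cases "dec i \<in> fst ` set (snd c)")
    case False
    then have "i = n" using assms(3)[of i] i by (cases "i < n") auto
    have "(LEAST i. dec i \<notin> set (map fst (snd c))) = n"
    proof (rule Least_equality)
      show "dec n \<notin> set (map fst (snd c))" using False \<open>i = n\<close> by simp
      fix j assume "dec j \<notin> set (map fst (snd c))"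
      then show "n \<le> j" using assms(3)[of j] by (cases "j < n") auto
    qed
    then have "dec i = q" using \<open>i = n\<close> q by (simp add: fresh_def)
    then show ?thesis by (simp add: c')
  qed (auto simp: c')
qed

text \<open>\<open>\<phi> q\<close> is the base point that \<open>q\<close> has on the true path,
  and \<open>e\<close> lists all that was ever written, also by commitments removed later. Such
  entries are correct for \<open>\<phi> q\<close> nevertheless, since the true commitment that
  contains \<open>q\<close> keeps its invariant at almost all stages.\<close>

theorem labels:
  obtains e :: "nat \<Rightarrow> rat \<times> int" and \<phi> :: "rat \<Rightarrow> nat"
  where "cf e" "\<And>q q'. q < q' \<Longrightarrow> \<beta> (\<phi> q) < \<beta> (\<phi> q')" "\<And>x. \<exists>q. B (\<phi> q) x"
    "range e = {(q, k). \<exists>m. shift (\<phi> q) k m}"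
    "\<And>j. 0 < snd (e j) \<Longrightarrow> (fst (e j), snd (e j) - 1) \<in> e ` {..<j}"
    "\<And>j. snd (e j) < 0 \<Longrightarrow> (fst (e j), snd (e j) + 1) \<in> e ` {..<j}"
proof -
  obtain cs vs r where cs: "cs 0 = (0, [])" "strict_mono r"
    "\<And>j. \<forall>\<^sub>F s in sequentially. guess (cs j) s = vs j"
    "\<And>j. good1 (cs j) (vs j) (H (r j)) (cs (Suc j)) (H (Suc (r j)))"
    "\<And>j. inv1 (cs j) (H (r j))" "\<And>j. (\<exists>h. inv1 (cs j) h) \<and> tr1 (cs j)"
    "\<And>j. \<forall>\<^sub>F s in sequentially. inv1 (cs j) (H s)"
    by (rule true_path, rule that)
  define A where "A j = snd (cs j)" for j
  have vs: "vs j = true_guess (cs j)" for j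
  proof -
    have "\<forall>\<^sub>F s in sequentially. guess (cs j) s = true_guess (cs j)"
      using guess_limit cs(5,6) by blast
    from eventually_happens'[OF sequentially_bot eventually_conj[OF this cs(3)[of j]]] show ?thesis by auto
  qed
  have A_Suc: "\<exists>z. A (Suc j) = A j @ [z]" for j
    using cs(4)[of j] unfolding good1_def A_def by blast
  have len: "length (A j) = j" for j
  proof (induction j)
    case (Suc j)
    then show ?case using A_Suc[of j] by auto
  qed (simp add: A_def cs(1))
  have A_mono: "set (A i) \<subseteq> set (A j)" if "i \<le> j" for i j
    using that
  proof (induction rule: dec_induct)
    case (step j)
    then show ?case using A_Suc[of j] by auto
  qed simp
  \<comment> \<open>Even and odd steps alternate, so there are \<open>n\<close> of each kind before
    index \<open>2 * n\<close>.\<close>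
  have dom: "i < n \<Longrightarrow> dec i \<in> fst ` set (A (2 * n))" for i n
  proof (induction n arbitrary: i)
    case (Suc n)
    have "dec i \<in> fst ` set (A (Suc (2 * n)))" if "i < n" for i
      using Suc.IH[OF that] A_mono[of "2 * n" "Suc (2 * n)"] by auto
    from new_fresh_covers[OF cs(4)[of "Suc (2 * n)"] _ this[unfolded A_def]] Suc.prems show ?case
      using len[of "Suc (2 * n)"] by (simp add: A_def)
  qed simp
  have ran: "l < n \<Longrightarrow> \<exists>x\<in>set (A (2 * n)). B l (snd x)" for l n
  proof (induction n arbitrary: l)
    case (Suc n)
    have "\<exists>x\<in>set (A (Suc (2 * n))). B l (snd x)"
      using new_guess_covers[OF cs(4)[of "2 * n", unfolded vs] _ Suc.IH[unfolded A_def] Suc.prems] len[of "2 * n"]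
      by (simp add: A_def)
    then show ?case using A_mono[of "Suc (2 * n)" "2 * Suc n"] by auto
  qed simp
  have ex_dom: "\<exists>l j. (q, l) \<in> set (A j)" for q
    using dom[of "enc q" "Suc (enc q)"] by force
  define \<phi> where "\<phi> q = (SOME l. \<exists>j. (q, l) \<in> set (A j))" for q
  have \<phi>_A: "\<exists>j. (q, \<phi> q) \<in> set (A j)" for q
    unfolding \<phi>_def using ex_dom by (rule someI_ex)
  have both: "\<exists>j. z \<in> set (A j) \<and> z' \<in> set (A j)" if "z \<in> set (A i)" "z' \<in> set (A i')" for z z' i i'
    using that A_mono[of i "max i i'"] A_mono[of i' "max i i'"] by auto
  have inv: "(\<forall>x\<in>set (A j). \<forall>y\<in>set (A j). (fst x < fst y \<longrightarrow> (snd x, snd y) \<in> L) \<and> (fst x = fst y \<longrightarrow> x = y))" for j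
    using cs(5)[of j] unfolding inv1_def A_def by blast
  have A_\<phi>: "l = \<phi> q" if ql: "(q, l) \<in> set (A j)" for q l j
  proof -
    obtain i where "(q, \<phi> q) \<in> set (A i)" using \<phi>_A by blast
    from both[OF ql this] inv show ?thesis by fastforce
  qed
  have mono: "\<beta> (\<phi> q) < \<beta> (\<phi> q')" if "q < q'" for q q'
  proof -
    obtain i i' where "(q, \<phi> q) \<in> set (A i)" "(q', \<phi> q') \<in> set (A i')" using \<phi>_A by blast
    from both[OF this] obtain j where "(q, \<phi> q) \<in> set (A j)" "(q', \<phi> q') \<in> set (A j)" by blast
    from \<beta>_less_of_ordered[OF cs(5) _ this[unfolded A_def]] cs(6)[of j] that show ?thesis by simp
  qed
  have hit: "\<exists>q. B (\<phi> q) x" for x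
  proof -
    obtain z where z: "z \<in> set (A (2 * Suc x))" "B x (snd z)" using ran[of x "Suc x"] by auto
    then have "snd z = \<phi> (fst z)" using A_\<phi>[of "fst z" "snd z"] by simp
    with z(2) have "B (\<phi> (fst z)) x" unfolding \<beta>_eq_iff[symmetric] by simp
    then show ?thesis ..
  qed
  have pre1: "prefix (H s) (H (Suc s))" for s
    using H_Suc[of s] by (auto simp: good1_def)
  have pre: "prefix (H s) (H t)" if "s \<le> t" for s t
    using that by (induction rule: dec_induct) (auto intro: pre1 prefix_order.trans)
  have H_mono: "set (H s) \<subseteq> set (H t)" if "s \<le> t" for s t
    using pre[OF that] by (rule set_mono_prefix)
  have r_ge: "j \<le> r j" for j using cs(2) by (rule strict_mono_imp_increasing)
  have long: "n \<le> length (H (r n))" for n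
  proof (induction n)
    case (Suc n)
    have "length (H (r n)) < length (H (Suc (r n)))" using cs(4)[of n] by (simp add: good1_def)
    moreover have "length (H (Suc (r n))) \<le> length (H (r (Suc n)))"
      using cs(2) by (intro prefix_length_le pre) (simp add: Suc_le_eq strict_mono_Suc_iff)
    ultimately show ?case using Suc by simp
  qed simp
  have exH: "\<exists>s. n < length (H s)" for n using long[of "Suc n"] by (auto simp: Suc_le_eq)
  define e where "e n = hd (drop n (H (LEAST s. n < length (H s))))" for n
  have e_eq: "e n = H s ! n" if "n < length (H s)" for n s
  proof -
    define t where "t = (LEAST s. n < length (H s))"
    have t: "n < length (H t)" unfolding t_def using that by (rule LeastI)
    have "H t ! n = H s ! n"
      using pre[of s t] pre[of t s] that t by (cases "s \<le> t") (auto simp: prefix_def nth_append)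
    then show ?thesis using t by (simp add: e_def t_def[symmetric] hd_drop_conv_nth)
  qed
  have range_e: "range e = (\<Union>s. set (H s))"
  proof (intro equalityI subsetI)
    fix z assume "z \<in> range e"
    then obtain n where "z = e n" by blast
    moreover obtain s where "n < length (H s)" using exH by blast
    ultimately show "z \<in> (\<Union>s. set (H s))" using e_eq[of n s] nth_mem[of n "H s"] by (metis UN_I UNIV_I)
  next
    fix z assume "z \<in> (\<Union>s. set (H s))"
    then obtain s n where "n < length (H s)" "z = H s ! n" by (auto simp: in_set_conv_nth)
    then have "z = e n" by (simp add: e_eq)
    then show "z \<in> range e" by simp
  qed
  have lab: "(\<exists>s. (q, k) \<in> set (H s)) \<longleftrightarrow> (\<exists>m. shift (\<phi> q) k m)" for q k
  proof
    assume "\<exists>s. (q, k) \<in> set (H s)"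
    then obtain s where s: "(q, k) \<in> set (H s)" ..
    obtain j where j: "(q, \<phi> q) \<in> set (A j)" using \<phi>_A by blast
    from eventually_happens'[OF sequentially_bot eventually_conj[OF cs(7)[of j] eventually_ge_at_top[of s]]]
    obtain t where t: "inv1 (cs j) (H t)" "s \<le> t" by blast
    then have "(q, k) \<in> set (H t)" using H_mono s by blast
    then show "\<exists>m. shift (\<phi> q) k m" using t(1) j unfolding inv1_def A_def by blast
  next
    have zero: "\<exists>s. (q, 0) \<in> set (H s)"
    proof -
      obtain j where j: "(q, \<phi> q) \<in> set (A j)" using \<phi>_A by blast
      then have "(q, 0) \<in> set (H (r j))" using cs(5)[of j] unfolding inv1_def A_def by (metis fst_conv)
      then show ?thesis ..
    qed
    have grow: "\<exists>s. (q, k') \<in> set (H s)"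
      if k: "(q, k) \<in> set (H s)" and k': "0 \<le> k \<and> k' = k + 1 \<or> k \<le> 0 \<and> k' = k - 1" and m: "\<exists>m. shift (\<phi> q) k' m" for k k' s
    proof -
      obtain w where w: "shift_at w (\<phi> q) k'" using m shift_iff_shift_at by blast
      obtain i where i: "(q, \<phi> q) \<in> set (A i)" using \<phi>_A by blast
      \<comment> \<open>Late enough that \<open>(q, k)\<close> is listed, the search bound
        \<open>j\<close> of \<open>grow\<close> exceeds the witnesses for \<open>k'\<close>, and
        \<open>q\<close> has its base point.\<close>
      define j where "j = max s (max w i)"
      have "(q, k) \<in> set (H (r j))" using H_mono[of s "r j"] k r_ge[of j] by (auto simp: j_def)
      moreover have "i \<le> Suc j" by (simp add: j_def le_SucI)
      then have "(q, \<phi> q) \<in> set (A (Suc j))" using A_mono i by blast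
      moreover have "shift_at j (\<phi> q) k'" using shift_at_mono[OF _ w] by (simp add: j_def)
      ultimately have "(q, k') \<in> set (grow j (A (Suc j)) (H (r j)))" unfolding set_grow using k' by blast
      moreover have "H (Suc (r j)) = H (r j) @ (fst (new (A j) (A (Suc j))), 0) # grow j (A (Suc j)) (H (r j))"
        using cs(4)[of j] len[of j] unfolding good1_def A_def by metis
      ultimately have "(q, k') \<in> set (H (Suc (r j)))" by simp
      then show ?thesis ..
    qed
    have pos: "(\<exists>m. shift (\<phi> q) (int n) m) \<Longrightarrow> \<exists>s. (q, int n) \<in> set (H s)" for n
    proof (induction n)
      case (Suc n)
      then obtain m where "(\<phi> q, m) \<in> succ ^^ Suc n" by (auto simp: shift_def nat_add_distrib)
      then obtain m' where "(\<phi> q, m') \<in> succ ^^ n" by (metis relpow_Suc_E)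
      then have "\<exists>m. shift (\<phi> q) (int n) m" by (auto simp: shift_def)
      with Suc.IH obtain s where "(q, int n) \<in> set (H s)" by blast
      then show ?case using grow[of "int n" s "int (Suc n)"] Suc.prems by simp
    qed (use zero in simp)
    have neg: "(\<exists>m. shift (\<phi> q) (- int n) m) \<Longrightarrow> \<exists>s. (q, - int n) \<in> set (H s)" for n
    proof (induction n)
      case (Suc n)
      then obtain m where "(m, \<phi> q) \<in> succ ^^ Suc n" by (auto simp: shift_def nat_add_distrib)
      then obtain m' where "(m', \<phi> q) \<in> succ ^^ n" by (metis relpow_Suc_D2)
      then have "\<exists>m. shift (\<phi> q) (- int n) m" by (cases "n = 0") (auto simp: shift_def)
      with Suc.IH obtain s where "(q, - int n) \<in> set (H s)" by blast
      then show ?case using grow[of "- int n" s "- int (Suc n)"] Suc.prems by simp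
    qed (use zero in simp)
    assume "\<exists>m. shift (\<phi> q) k m"
    then show "\<exists>s. (q, k) \<in> set (H s)"
      using pos[of "nat k"] neg[of "nat (- k)"] by (cases "0 \<le> k") auto
  qed
  have prev: "(0 < snd (e j) \<longrightarrow> (fst (e j), snd (e j) - 1) \<in> e ` {..<j}) \<and>
      (snd (e j) < 0 \<longrightarrow> (fst (e j), snd (e j) + 1) \<in> e ` {..<j})" for j
  proof -
    define s where "s = r (Suc j)"
    have s: "j < length (H s)" using long[of "Suc j"] by (simp add: s_def)
    have "set (take j (H s)) \<subseteq> e ` {..<j}"
    proof
      fix z assume "z \<in> set (take j (H s))"
      then obtain i where "i < j" "z = H s ! i" by (auto simp: in_set_conv_nth)
      then have "z = e i" using e_eq[of i s] s by simp
      with \<open>i < j\<close> show "z \<in> e ` {..<j}" by simp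
    qed
    moreover have "inv1 (cs (Suc j)) (H s)" unfolding s_def by (rule cs(5))
    then have "(0 < snd (H s ! j) \<longrightarrow> (fst (H s ! j), snd (H s ! j) - 1) \<in> set (take j (H s))) \<and>
        (snd (H s ! j) < 0 \<longrightarrow> (fst (H s ! j), snd (H s ! j) + 1) \<in> set (take j (H s)))"
      using s unfolding inv1_def by blast
    ultimately show ?thesis unfolding e_eq[OF s] by blast
  qed
  have cf_HH: "cf s \<Longrightarrow> cf (\<lambda>x. H (s x))" for s :: "nat \<times> nat \<Rightarrow> nat" by (rule cf_comp[OF cf_H])
  have "cf (\<lambda>n. LEAST s. n < length (H s))"
    by (rule cf_Least[OF _ cf_dec_nat exH]) (intro cf_intros cf_HH)
  from cf_comp[OF cf_H this] have "cf e" unfolding e_def by (intro cf_intros)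
  moreover have "range e = {(q, k). \<exists>m. shift (\<phi> q) k m}"
    unfolding range_e using lab by auto
  ultimately show thesis using that mono hit prev by blast
qed

end

text \<open>Labels are coordinates: \<open>\<psi>\<close> takes a label to the place it names
  relative to the base point of its block. Every element has coordinates, because each block has a
  base point and any two elements of a block are finitely many successor steps apart.\<close>

lemma (in eta_order) labels_iso:
  assumes mono: "\<And>q q'. q < q' \<Longrightarrow> \<beta> (\<phi> q) < \<beta> (\<phi> q')" and hit: "\<And>x. \<exists>q. B (\<phi> q) x"
    and T: "T = {(q, k). \<exists>m. shift (\<phi> q) k m}"
  obtains \<psi> where "bij_betw \<psi> T UNIV"
    "\<And>t u. t \<in> T \<Longrightarrow> u \<in> T \<Longrightarrow> label_less t u \<longleftrightarrow> (\<psi> t, \<psi> u) \<in> L"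
    "\<And>t u. t \<in> T \<Longrightarrow> u \<in> T \<Longrightarrow> fst t = fst u \<longleftrightarrow> B (\<psi> t) (\<psi> u)"
proof -
  define \<psi> where "\<psi> t = (SOME m. shift (\<phi> (fst t)) (snd t) m)" for t
  have \<psi>: "shift (\<phi> (fst t)) (snd t) (\<psi> t)" if "t \<in> T" for t
    using that unfolding \<psi>_def T by (auto intro: someI)
  have \<beta>_\<psi>: "\<beta> (\<psi> t) = \<beta> (\<phi> (fst t))" if "t \<in> T" for t
    using shift_B[OF \<psi>[OF that]] \<beta>_eq_iff by metis
  have less: "(\<psi> t, \<psi> u) \<in> L" if tu: "t \<in> T" "u \<in> T" "label_less t u" for t u
  proof (cases "fst t = fst u")
    case True
    then have "snd t < snd u" using tu(3) by (simp add: label_less_def)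
    then show ?thesis using shift_less[OF \<psi>[OF tu(1)]] \<psi>[OF tu(2)] True by simp
  next
    case False
    then have "fst t < fst u" using tu(3) by (simp add: label_less_def)
    then show ?thesis using mono \<beta>_lessD \<beta>_\<psi> tu by metis
  qed
  have iff: "label_less t u \<longleftrightarrow> (\<psi> t, \<psi> u) \<in> L" if "t \<in> T" "u \<in> T" for t u
    using less that label_less_total[of t u] L_asym L_irrefl by metis
  have blk: "fst t = fst u \<longleftrightarrow> B (\<psi> t) (\<psi> u)" if "t \<in> T" "u \<in> T" for t u
    unfolding \<beta>_eq_iff[symmetric] using \<beta>_\<psi> that mono by (metis linorder_neqE order_less_irrefl)
  have "bij_betw \<psi> T UNIV"
    unfolding bij_betw_def
  proof (intro conjI inj_onI)
    fix t u assume "t \<in> T" "u \<in> T" "\<psi> t = \<psi> u"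
    then show "t = u" using iff label_less_total[of t u] L_irrefl by metis
  next
    have "x \<in> \<psi> ` T" for x
    proof -
      obtain q where "B (\<phi> q) x" using hit by blast
      then obtain k where k: "shift (\<phi> q) k x" using B_shift by blast
      then have "(q, k) \<in> T" by (auto simp: T)
      moreover from \<psi>[OF this] k have "\<psi> (q, k) = x" using shift_unique by simp
      ultimately show ?thesis by force
    qed
    then show "\<psi> ` T = UNIV" by blast
  qed
  then show thesis using that iff blk by blast
qed

section \<open>Putting the two constructions together\<close>

lemma comp_cf_rel_iff: "comp.cf (\<lambda>p :: nat \<times> nat. p \<in> R) \<longleftrightarrow> computable_rel R"
proof
  assume "comp.cf (\<lambda>p :: nat \<times> nat. p \<in> R)"
  from comp.cf_comp[OF this comp.cf_prod_decode[OF comp.cf_id]]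
  have "comp.cf (\<lambda>n. if prod_decode n \<in> R then 1 else 0 :: nat)"
    by (intro comp.cf_if comp.cf_const)
  then show "computable_rel R" unfolding computable_rel_iff by (rule comp.cf_natD)
next
  assume "computable_rel R"
  then show "comp.cf (\<lambda>p :: nat \<times> nat. p \<in> R)"
    unfolding computable_rel_iff comp.cf_def by (rule bexI[rotated]) (simp add: enc_prod_def enc_bool_def)
qed

lemma limit_cfI:
  assumes g: "comp.cf (\<lambda>p. g (fst p) (snd p))" and lim: "\<And>x. \<forall>\<^sub>F s in sequentially. g x s = f x"
    and dec: "comp.cf (dec :: nat \<Rightarrow> 'a :: enc)"
  shows "limit.cf (f :: 'a \<Rightarrow> 'b :: enc)"
proof -
  have "(\<lambda>n. enc (f (dec n))) \<in> limit_funs"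
  proof (rule limit_funsI)
    show "comp.cf (\<lambda>p. enc (g (dec (fst p)) (snd p)))"
      by (intro cf_intros comp.cf_comp2[of g, OF g] comp.cf_comp[OF dec])
    show "\<forall>\<^sub>F s in sequentially. enc (g (dec n) s) = enc (f (dec n))" for n
      using lim[of "dec n"] by eventually_elim simp
  qed
  then show ?thesis unfolding limit.cf_def by (rule bexI[rotated]) simp
qed

lemma limit_cfE:
  fixes f :: "nat \<Rightarrow> 'a :: enc"
  assumes f: "limit.cf f" and dec: "comp.cf (dec :: nat \<Rightarrow> 'a)"
  obtains g where "comp.cf (\<lambda>p. g (fst p) (snd p))" "\<And>x. \<forall>\<^sub>F s in sequentially. g x s = f x"
proof -
  obtain f' where f': "f' \<in> limit_funs" "\<And>n. f' n = enc (f n)" using f by (auto simp: limit.cf_def)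
  obtain g where g: "comp.cf (\<lambda>p. g (fst p) (snd p))" "\<And>x. \<forall>\<^sub>F s in sequentially. g x s = f' x"
    using f'(1) unfolding limit_funs_def by blast
  have "comp.cf (\<lambda>p. dec (g (fst p) (snd p)) :: 'a)" by (rule comp.cf_comp[OF dec g(1)])
  moreover have "\<forall>\<^sub>F s in sequentially. dec (g x s) = f x" for x
    using g(2)[of x] by eventually_elim (simp add: f'(2))
  ultimately show thesis by (rule that)
qed

text \<open>At stage \<open>s\<close> only elements below \<open>s\<close> are tried as intermediate
  ones, so the answer changes at most once.\<close>

lemma (in linear_order) limit_cf_succ:
  assumes "comp.cf (\<lambda>p. p \<in> L)"
  shows "limit.cf (\<lambda>p. p \<in> succ)"
proof (rule limit_cfI)
  let ?g = "\<lambda>p s. p \<in> L \<and> (\<forall>z<s. \<not> ((fst p, z) \<in> L \<and> (z, snd p) \<in> L))"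
  note L = comp.cf_comp[OF assms]
  show "comp.cf (\<lambda>p. ?g (fst p) (snd p))" by (intro cf_intros L)
  show "\<forall>\<^sub>F s in sequentially. ?g p s = (p \<in> succ)" for p
  proof (cases "\<exists>z. (fst p, z) \<in> L \<and> (z, snd p) \<in> L")
    case True
    then obtain z where z: "(fst p, z) \<in> L" "(z, snd p) \<in> L" by blast
    from eventually_gt_at_top[of z] show ?thesis
      by eventually_elim (use z in \<open>auto simp: succ_def\<close>)
  next
    case False
    then show ?thesis by (cases p) (auto simp: succ_def)
  qed
  show "comp.cf (dec :: nat \<Rightarrow> nat \<times> nat)" by (intro cf_intros)
qed

lemma block_rel_bij_iff:
  assumes "bij f" "\<And>i j. (i, j) \<in> M \<longleftrightarrow> (f i, f j) \<in> L"
  shows "(i, j) \<in> block_rel UNIV M \<longleftrightarrow> (f i, f j) \<in> block_rel UNIV L"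
proof -
  have eq: "i = j \<longleftrightarrow> f i = f j" for i j using assms(1) by (auto simp: bij_def inj_eq)
  have "f ` closed_interval UNIV M i j = closed_interval UNIV L (f i) (f j)"
  proof (intro equalityI subsetI)
    fix y assume y: "y \<in> closed_interval UNIV L (f i) (f j)"
    obtain x where "y = f x" using assms(1) by (metis bij_pointE)
    then show "y \<in> f ` closed_interval UNIV M i j"
      using y by (auto simp: closed_interval_def assms(2) eq)
  qed (auto simp: closed_interval_def assms(2) eq)
  moreover have "inj_on f (closed_interval UNIV M i j)"
    using assms(1) by (meson bij_is_inj inj_on_subset subset_UNIV)
  ultimately have "finite (closed_interval UNIV M i j) \<longleftrightarrow> finite (closed_interval UNIV L (f i) (f j))"
    using finite_image_iff by metis
  then show ?thesis by (simp add: block_rel_def)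
qed

theorem theorem1:
  fixes L :: "nat rel"
  assumes "computable_linear_order L"
    and "condensation_type_eta UNIV L"
    and "\<not> (\<exists>I. order_interval UNIV L I \<and> infinite I \<and> strongly_eta_like I L)"
  shows "\<exists>M :: nat rel. computable_linear_order M \<and> order_isomorphic UNIV L UNIV M \<and>
           ce_rel (- block_rel UNIV M)"
proof -
  have lin: "strict_linear_order_on UNIV L" and comp_L: "comp.cf (\<lambda>p. p \<in> L)"
    using assms(1) by (auto simp: computable_linear_order_def comp_cf_rel_iff)
  obtain \<beta> where "eta_order L \<beta>" using eta_order_exists[OF lin assms(2,3)] .
  then interpret eta_order L \<beta> .
  have limit_L: "limit.cf (\<lambda>p. p \<in> L)"
    by (rule limit_cfI[where g = "\<lambda>p s. p \<in> L"])
      (auto intro!: comp.cf_comp[OF comp_L] comp.cf_fst comp.cf_id comp.cf_dec_prod comp.cf_dec_nat)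
  interpret lc: label_construction limit_funs L \<beta>
    by unfold_locales (rule limit_L limit_cf_succ[OF comp_L])+
  obtain e :: "nat \<Rightarrow> rat \<times> int" and \<phi> :: "rat \<Rightarrow> nat" where e: "limit.cf e" "\<And>q q'. q < q' \<Longrightarrow> \<beta> (\<phi> q) < \<beta> (\<phi> q')" "\<And>x. \<exists>q. B (\<phi> q) x"
    "range e = {(q, k). \<exists>m. shift (\<phi> q) k m}"
    "\<And>j. 0 < snd (e j) \<Longrightarrow> (fst (e j), snd (e j) - 1) \<in> e ` {..<j}"
    "\<And>j. snd (e j) < 0 \<Longrightarrow> (fst (e j), snd (e j) + 1) \<in> e ` {..<j}"
    by (rule lc.labels, rule that)
  have "comp.cf (dec :: nat \<Rightarrow> rat \<times> int)" by (intro cf_intros)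
  with e(1) obtain e' where e': "comp.cf (\<lambda>p. e' (fst p) (snd p))" "\<And>x. \<forall>\<^sub>F s in sequentially. e' x s = e x"
    by (rule limit_cfE) blast
  interpret ll: limit_labels computable_funs e e'
  proof
    show "(q, 0) \<in> range e" for q unfolding e(4) using shift_0 by blast
  qed (fact e' e(5,6))+
  obtain p :: "nat \<Rightarrow> rat" and F :: "nat \<Rightarrow> rat \<times> int" and K :: "nat \<Rightarrow> rat list" where p: "comp.cf p" "comp.cf K" "bij_betw F UNIV (range e)"
    "\<And>i j. p i < p j \<longleftrightarrow> label_less (F i) (F j)"
    "\<And>i j. p i < p j \<Longrightarrow> fst (F i) \<noteq> fst (F j) \<longleftrightarrow> (\<exists>s. separated (K s) (p i) (p j))"
    by (rule ll.computable_order, rule that)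
  obtain \<psi> where \<psi>: "bij_betw \<psi> (range e) UNIV"
    "\<And>t u. t \<in> range e \<Longrightarrow> u \<in> range e \<Longrightarrow> label_less t u \<longleftrightarrow> (\<psi> t, \<psi> u) \<in> L"
    "\<And>t u. t \<in> range e \<Longrightarrow> u \<in> range e \<Longrightarrow> fst t = fst u \<longleftrightarrow> B (\<psi> t) (\<psi> u)"
    by (rule labels_iso[OF e(2-4)], assumption, rule that)
  \<comment> \<open>A number \<open>i\<close> stands for the \<open>i\<close>-th point created, and
    the points are ordered as rationals, which is decidable. The isomorphism \<open>f\<close> goes
    through the final labels and need not be computable.\<close>
  define M where "M = {(i, j). p i < p j}"
  define f where "f = \<psi> \<circ> F"
  have F: "F i \<in> range e" for i using p(3) by (auto simp: bij_betw_def)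
  have bij: "bij f" unfolding f_def using p(3) \<psi>(1) by (rule bij_betw_trans)
  have f_iff: "(i, j) \<in> M \<longleftrightarrow> (f i, f j) \<in> L" for i j
    using \<psi>(2)[OF F F] by (simp add: M_def f_def p(4))
  have p_eq: "p i = p j \<longleftrightarrow> F i = F j" for i j
    using p(4)[of i j] p(4)[of j i] label_less_total[of "F i" "F j"] by (metis label_less_irrefl linorder_neqE order_less_irrefl)
  have "strict_linear_order_on UNIV M"
    unfolding strict_linear_order_on_def
  proof (intro conjI)
    show "trans M" "irrefl M" by (auto simp: M_def trans_def irrefl_def)
    have "i = j" if "p i = p j" for i j using that p(3) unfolding p_eq bij_betw_def by (auto dest: injD)
    then show "total_on UNIV M" unfolding total_on_def M_def by (simp add: neq_iff[symmetric]) blast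
  qed
  moreover have "computable_rel M"
  proof -
    note cf_p = comp.cf_comp[OF p(1)]
    have "comp.cf (\<lambda>x :: nat \<times> nat. p (fst x) < p (snd x))" by (intro cf_intros cf_p)
    then show ?thesis unfolding comp_cf_rel_iff[symmetric] M_def by (simp add: case_prod_beta)
  qed
  moreover have "order_isomorphic UNIV L UNIV M"
    unfolding order_isomorphic_def
  proof (intro exI[of _ "inv f"] conjI ballI)
    show "bij_betw (inv f) UNIV UNIV" using bij by (rule bij_imp_bij_inv)
    show "(x, y) \<in> L \<longleftrightarrow> (inv f x, inv f y) \<in> M" for x y
      unfolding f_iff using bij by (simp add: bij_is_surj surj_f_inv_f)
  qed
  moreover have "ce_rel (- block_rel UNIV M)"
  proof (rule ce_relI)
    \<comment> \<open>Both directions are tested, since points are numbered by creation and not by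
      size.\<close>
    let ?sep = "\<lambda>i j s. separated (K s) (p i) (p j) \<or> separated (K s) (p j) (p i)"
    let ?D = "\<lambda>n. if ?sep (\<pi>\<^sub>1 (\<pi>\<^sub>1 n)) (\<pi>\<^sub>2 (\<pi>\<^sub>1 n)) (\<pi>\<^sub>2 n) then 0 else 1 :: nat"
    note cf_p = comp.cf_comp[OF p(1)] and cf_K = comp.cf_comp[OF p(2)]
    have "comp.cf ?D" unfolding separated_def by (intro cf_intros cf_p cf_K)
    then show "?D \<in> computable_funs" by (rule comp.cf_natD)
    show "(i, j) \<in> - block_rel UNIV M \<longleftrightarrow> (\<exists>s. ?D (prod_encode (prod_encode (i, j), s)) = 0)" for i j
    proof -
      have "(i, j) \<in> - block_rel UNIV M \<longleftrightarrow> fst (F i) \<noteq> fst (F j)"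
        using block_rel_bij_iff[OF bij f_iff, of i j] \<psi>(3)[OF F F, of i j] by (simp add: B_def f_def)
      moreover have "\<not> separated (K s) a b" if "b \<le> a" for s a b
        using that by (auto simp: separated_def)
      ultimately have "(i, j) \<in> - block_rel UNIV M \<longleftrightarrow> (\<exists>s. ?sep i j s)"
        using p(5)[of i j] p(5)[of j i] p_eq[of i j]
        by (metis linorder_neqE order_less_imp_le order.refl)
      then show ?thesis by simp
    qed
  qed
  ultimately show ?thesis unfolding computable_linear_order_def by blast
qed

end
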